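(* Let $\mathcal{O}=\{t_1,\dots,t_\mu\}$ be an order ideal in $\mathbb{T}^n$, and let $I(\mathbb{B}^{\mathrm{df}}_{\mathcal{O}})=I(\mathbb{B}_{\mathcal{O}})+I^{\mathrm{df}}_{\mathcal{O}}$. Define an ideal $I$ of $K[C]$ as follows. If the Hilbert function $\mathrm{HF}_{\mathcal{O}}$ is not symmetric, let $I=I(\mathbb{B}^{\mathrm{df}}_{\mathcal{O}})$. Otherwise, let $I=I(\mathbb{B}^{\mathrm{df}}_{\mathcal{O}})+J$, where $J$ is constructed as follows: let $\Delta=\#\{i\mid\deg(t_i)=\deg(t_\mu)\}$; for $i=1,\dots,\mu$ let $M^{\mathrm{hom}}_{t_i}=t_i(\mathcal{A}^{\mathrm{hom}}_1,\dots,\mathcal{A}^{\mathrm{hom}}_n)$ with the generic homogeneous multiplication matrices $\mathcal{A}^{\mathrm{hom}}_r$; for $j=1,\dots,\Delta$ let $V_j\in\mathrm{Mat}_\mu(K[C])$ be the matrix whose $i$-th column is the $(\mu-\Delta+j)$-th column of $(M^{\mathrm{hom}}_{t_i})^{\mathrm{tr}}$ for $i=1,\dots,\mu$; and let $J$ be the ideal generated by the maximal minors of the block column matrix $\mathrm{Col}(V_1,\dots,V_\Delta)$. Then $I$ defines a closed subscheme $\mathrm{NonSGor}^{\mathrm{df}}_{\mathcal{O}}$ of $\mathbb{B}^{\mathrm{df}}_{\mathcal{O}}$ whose $K$-rational points represent exactly the 0-dimensional subschemes of $\mathbb{A}^n_K$ which have a degree filtered $\mathcal{O}$-border basis, but are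 not strict Gorenstein schemes.
   Context: $K$ is an arbitrary field, $P=K[x_1,\dots,x_n]$, and $\mathbb{T}^n$ is the monoid of terms (power products) in $x_1,\dots,x_n$. An order ideal is a finite set $\mathcal{O}=\{t_1,\dots,t_\mu\}\subset\mathbb{T}^n$ with $\mu\ge 1$ containing every divisor in $\mathbb{T}^n$ of each of its elements; it is always ordered so that $\deg(t_1)\le\cdots\le\deg(t_\mu)$, hence $t_1=1$. Its border is $\partial\mathcal{O}=(x_1\mathcal{O}\cup\cdots\cup x_n\mathcal{O})\setminus\mathcal{O}=\{b_1,\dots,b_\nu\}$. Its Hilbert function is $\mathrm{HF}_{\mathcal{O}}=(h_0,h_1,\dots)$ with $h_i=\#\{j\mid\deg(t_j)=i\}$; it is symmetric if $h_i=h_{\rho-i}$ for $i=1,\dots,\rho$, where $\rho=\max\{i\ge 0\mid h_i>0\}=\deg(t_\mu)$. Let $C=\{c_{ij}\mid 1\le i\le\mu,\ 1\le j\le\nu\}$ be new indeterminates. The $r$-th generic multiplication matrix $\mathcal{A}_r=(a^{(r)}_{ij})\in\mathrm{Mat}_\mu(K[C])$ has $a^{(r)}_{ij}=\delta_{im}$ if $x_rt_j=t_m$ and $a^{(r)}_{ij}=c_{im}$ if $x_rt_j=b_m$. $I(\mathbb{B}_{\mathcal{O}})\subseteq K[C]$ is generated by the entries of all commutators $\mathcal{A}_r\mathcal{A}_s-\mathcal{A}_s\mathcal{A}_r$, and the border basis scheme $\mathbb{B}_{\mathcal{O}}\subseteq\mathrm{Spec}(K[C])$ is the closed subscheme it defines.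 For a $K$-rational point $\Gamma=(\gamma_{ij})$ of $\mathbb{B}_{\mathcal{O}}$, let $I_\Gamma\subset P$ be generated by $b_j-\sum_i\gamma_{ij}t_i$; $\Gamma$ represents the 0-dimensional scheme $\mathbb{X}_\Gamma\subset\mathbb{A}^n_K$ with vanishing ideal $I_\Gamma$. $I^{\mathrm{df}}_{\mathcal{O}}\subseteq K[C]$ is generated by all $c_{ij}$ with $\deg(t_i)>\deg(b_j)$; $\mathbb{B}^{\mathrm{df}}_{\mathcal{O}}$ is the closed subscheme of $\mathbb{B}_{\mathcal{O}}$ defined by $I(\mathbb{B}_{\mathcal{O}})+I^{\mathrm{df}}_{\mathcal{O}}$. $\mathcal{A}^{\mathrm{hom}}_r$ is obtained from $\mathcal{A}_r$ by setting all $c_{ij}$ with $\deg(t_i)\ne\deg(b_j)$ to zero. For a term $t=x_1^{\alpha_1}\cdots x_n^{\alpha_n}$, $t(M_1,\dots,M_n)=M_1^{\alpha_1}\cdots M_n^{\alpha_n}$. For a 0-dimensional subscheme $\mathbb{X}\subset\mathbb{A}^n_K$ with vanishing ideal $I_{\mathbb{X}}$ put $R_{\mathbb{X}}=P/I_{\mathbb{X}}$ and let $F_iR_{\mathbb{X}}$ be the image of the polynomials of degree $\le i$ (including $0$). $\mathbb{X}$ has a degree filtered $\mathcal{O}$-border basis if for every $i\ge 0$ the residue classes of the elements of $\mathcal{O}$ of degree $\le i$ form a $K$-basis of $F_iR_{\mathbb{X}}$. $\mathbb{X}$ is a strict Gorenstein scheme if the associated graded ring $\mathrm{gr}_{\mathcal{F}}(R_{\mathbb{X}})=\bigoplus_iF_iR_{\mathbb{X}}/F_{i-1}R_{\mathbb{X}}$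 is a Gorenstein ring. Conventions: statements about $K$-rational points may be read for $L$-rational points for any field extension $L\supseteq K$; an ideal is said to define a subscheme up to radical. *)

theory Defs
  imports
    "HOL-Library.Poly_Mapping"
    "HOL-Algebra.QuotRing"
    "HOL-Algebra.Module"
    "HOL-Algebra.Embedded_Algebras"
    "HOL-Algebra.Ring_Divisibility"
    "Jordan_Normal_Form.Determinant"
    "Jordan_Normal_Form.DL_Submatrix"
begin

section \<open>Terms and polynomial rings\<close>

text \<open>A term is its exponent vector, so the product of terms is addition and the term 1 is \<open>0\<close>.
  The indeterminates \<open>x\<^sub>1, \<dots>, x\<^sub>n\<close> are numbered \<open>0, \<dots>, n - 1\<close>.\<close>

type_synonym 'x pterm = "'x \<Rightarrow>\<^sub>0 nat"
type_synonym ('x, 'k) mpoly = "('x \<Rightarrow>\<^sub>0 nat) \<Rightarrow>\<^sub>0 'k"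

definition terms_in :: "'x set \<Rightarrow> 'x pterm set" where
  "terms_in X = {t. Poly_Mapping.keys t \<subseteq> X}"

definition tdeg :: "'x pterm \<Rightarrow> nat" where
  "tdeg t = (\<Sum>x\<in>Poly_Mapping.keys t. Poly_Mapping.lookup t x)"

definition tvar :: "'x \<Rightarrow> 'x pterm" where
  "tvar x = Poly_Mapping.single x 1"

definition pmonom :: "'x pterm \<Rightarrow> ('x, 'k::comm_ring_1) mpoly" where
  "pmonom t = Poly_Mapping.single t 1"

definition pvar :: "'x \<Rightarrow> ('x, 'k::comm_ring_1) mpoly" where
  "pvar x = pmonom (tvar x)"

definition pconst :: "'k \<Rightarrow> ('x, 'k::comm_ring_1) mpoly" where
  "pconst c = Poly_Mapping.single 0 c"

definition mpoly_ring :: "'x set \<Rightarrow> ('x, 'k::comm_ring_1) mpoly ring" where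
  "mpoly_ring X = \<lparr>carrier = {p. Poly_Mapping.keys p \<subseteq> terms_in X},
     monoid.mult = (*), one = 1, zero = 0, add = (+)\<rparr>"

text \<open>The value of a polynomial under \<open>x \<mapsto> f x\<close>, its coefficients being mapped by \<open>\<phi>\<close>.\<close>

definition peval :: "('k::comm_ring_1 \<Rightarrow> 'b::comm_ring_1) \<Rightarrow> ('x \<Rightarrow> 'b) \<Rightarrow> ('x, 'k) mpoly \<Rightarrow> 'b" where
  "peval \<phi> f p = (\<Sum>t\<in>Poly_Mapping.keys p. \<phi> (Poly_Mapping.lookup p t) *
     (\<Prod>x\<in>Poly_Mapping.keys t. f x ^ Poly_Mapping.lookup t x))"


section \<open>Gorenstein rings\<close>

definition self_module :: "('a, 'm) ring_scheme \<Rightarrow> ('a, 'a) module" where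
  "self_module A = \<lparr>carrier = carrier A, monoid.mult = monoid.mult A, one = one A, zero = zero A, add = add A,
     module.smult = monoid.mult A\<rparr>"

definition module_hom :: "('a, 'm) ring_scheme \<Rightarrow> ('a, 'b) module \<Rightarrow> ('a, 'c) module \<Rightarrow> ('b \<Rightarrow> 'c) set" where
  "module_hom A M N = {f \<in> carrier M \<rightarrow> carrier N.
     (\<forall>x\<in>carrier M. \<forall>y\<in>carrier M. f (x \<oplus>\<^bsub>M\<^esub> y) = f x \<oplus>\<^bsub>N\<^esub> f y) \<and>
     (\<forall>a\<in>carrier A. \<forall>x\<in>carrier M. f (a \<odot>\<^bsub>M\<^esub> x) = a \<odot>\<^bsub>N\<^esub> f x)}"

text \<open>Injectivity is stated in the form of Baer's criterion (extension of homomorphisms from ideals),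
  because a definition cannot quantify over modules on arbitrary types.\<close>

definition injective_module :: "('a, 'm) ring_scheme \<Rightarrow> ('a, 'b) module \<Rightarrow> bool" where
  "injective_module A E \<longleftrightarrow> Module.module A E \<and>
     (\<forall>J f. ideal J A \<longrightarrow> f \<in> module_hom A (self_module A\<lparr>carrier := J\<rparr>) E \<longrightarrow>
        (\<exists>g\<in>module_hom A (self_module A) E. \<forall>x\<in>J. g x = f x))"

text \<open>\<open>M\<close> has a finite injective resolution: either \<open>M\<close> is injective, or there is a short exact
  sequence \<open>0 \<rightarrow> M \<rightarrow> E \<rightarrow> C \<rightarrow> 0\<close> with \<open>E\<close> injective and \<open>C\<close> of finite injective dimension.\<close>

inductive finite_injective_dimension :: "('a, 'm) ring_scheme \<Rightarrow> ('a, 'b) module \<Rightarrow> bool"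
  for A :: "('a, 'm) ring_scheme" where
  injective: "injective_module A M \<Longrightarrow> finite_injective_dimension A M"
| cosyzygy: "\<lbrakk>Module.module A M; injective_module A (E :: ('a, 'b) module); Module.module A C;
     f \<in> module_hom A M E; inj_on f (carrier M);
     g \<in> module_hom A E C; g ` carrier E = carrier C;
     {x \<in> carrier E. g x = \<zero>\<^bsub>C\<^esub>} = f ` carrier M;
     finite_injective_dimension A C\<rbrakk> \<Longrightarrow> finite_injective_dimension A M"

definition fraction :: "('a, 'm) ring_scheme \<Rightarrow> 'a set \<Rightarrow> 'a \<Rightarrow> 'a \<Rightarrow> ('a \<times> 'a) set" where
  "fraction R S r s = {(r', s'). r' \<in> carrier R \<and> s' \<in> S \<and>
     (\<exists>u\<in>S. u \<otimes>\<^bsub>R\<^esub> (r \<otimes>\<^bsub>R\<^esub> s') = u \<otimes>\<^bsub>R\<^esub> (r' \<otimes>\<^bsub>R\<^esub> s))}"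

text \<open>In \<open>mult\<close> and \<open>add\<close> the unions range over all representatives; they yield the same fraction.\<close>

definition ring_of_fractions :: "('a, 'm) ring_scheme \<Rightarrow> 'a set \<Rightarrow> ('a \<times> 'a) set ring" where
  "ring_of_fractions R S = \<lparr>carrier = {fraction R S r s | r s. r \<in> carrier R \<and> s \<in> S},
     monoid.mult = (\<lambda>X Y. \<Union>(r, s)\<in>X. \<Union>(r', s')\<in>Y. fraction R S (r \<otimes>\<^bsub>R\<^esub> r') (s \<otimes>\<^bsub>R\<^esub> s')),
     one = fraction R S \<one>\<^bsub>R\<^esub> \<one>\<^bsub>R\<^esub>,
     zero = fraction R S \<zero>\<^bsub>R\<^esub> \<one>\<^bsub>R\<^esub>,
     add = (\<lambda>X Y. \<Union>(r, s)\<in>X. \<Union>(r', s')\<in>Y.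
       fraction R S ((r \<otimes>\<^bsub>R\<^esub> s') \<oplus>\<^bsub>R\<^esub> (r' \<otimes>\<^bsub>R\<^esub> s)) (s \<otimes>\<^bsub>R\<^esub> s'))\<rparr>"

text \<open>Commutative Noetherian rings all of whose localizations at maximal ideals have finite injective
  dimension over themselves. The modules in the injective resolutions of a localization \<open>A\<close> are
  taken on the type of \<open>A\<close>. This is no restriction: if \<open>A\<close> is infinite, the modules in a minimal
  injective resolution have at most the cardinality of \<open>A\<close>; if \<open>A\<close> is finite, hence Artinian,
  finite injective dimension already means that \<open>A\<close> is injective.\<close>

definition gorenstein_ring :: "('a, 'm) ring_scheme \<Rightarrow> bool" where
  "gorenstein_ring R \<longleftrightarrow> cring R \<and> noetherian_ring R \<and>
     (\<forall>\<mm>. maximalideal \<mm> R \<longrightarrow>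
        finite_injective_dimension (ring_of_fractions R (carrier R - \<mm>))
          (self_module (ring_of_fractions R (carrier R - \<mm>))))"


section \<open>The associated graded ring of a filtered ring\<close>

fun filt_below :: "('a, 'm) ring_scheme \<Rightarrow> (nat \<Rightarrow> 'a set) \<Rightarrow> nat \<Rightarrow> 'a set" where
  "filt_below R F 0 = {\<zero>\<^bsub>R\<^esub>}"
| "filt_below R F (Suc i) = F i"

text \<open>Elements of \<open>\<Oplus>\<^sub>i F\<^sub>i / F\<^sub>i\<^sub>-\<^sub>1\<close> are finitely supported families of cosets. The union in
  \<open>mult\<close> ranges over all representatives; they yield the same coset.\<close>

definition assoc_graded_ring :: "('a, 'm) ring_scheme \<Rightarrow> (nat \<Rightarrow> 'a set) \<Rightarrow> (nat \<Rightarrow> 'a set) ring" where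
  "assoc_graded_ring R F = \<lparr>
     carrier = {g. (\<forall>i. \<exists>x\<in>F i. g i = filt_below R F i +>\<^bsub>R\<^esub> x) \<and> finite {i. g i \<noteq> filt_below R F i}},
     monoid.mult = (\<lambda>g h k. \<Union>{filt_below R F k +>\<^bsub>R\<^esub> finsum R (\<lambda>i. x i \<otimes>\<^bsub>R\<^esub> y (k - i)) {..k} | x y.
       (\<forall>i. x i \<in> g i) \<and> (\<forall>i. y i \<in> h i)}),
     one = (\<lambda>i. if i = 0 then filt_below R F 0 +>\<^bsub>R\<^esub> \<one>\<^bsub>R\<^esub> else filt_below R F i),
     zero = filt_below R F,
     add = (\<lambda>g h i. g i <+>\<^bsub>R\<^esub> h i)\<rparr>"


section \<open>Subschemes of affine space\<close>

text \<open>A subscheme of \<open>\<A>\<^sup>n\<close> is given by its vanishing ideal \<open>I\<close> in \<open>P = K[x\<^sub>1, \<dots>, x\<^sub>n]\<close>.\<close>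

abbreviation aff_ring :: "nat \<Rightarrow> (nat, 'k::field) mpoly ring" where
  "aff_ring n \<equiv> mpoly_ring {..<n}"

definition coord_ring :: "nat \<Rightarrow> (nat, 'k::field) mpoly set \<Rightarrow> (nat, 'k) mpoly set ring" where
  "coord_ring n I = aff_ring n Quot I"

text \<open>The Krull dimension of \<open>P / I\<close> is 0.\<close>

definition zero_dimensional :: "nat \<Rightarrow> (nat, 'k::field) mpoly set \<Rightarrow> bool" where
  "zero_dimensional n I \<longleftrightarrow> ideal I (aff_ring n) \<and> I \<noteq> carrier (aff_ring n) \<and>
     (\<forall>\<pp>. primeideal \<pp> (coord_ring n I) \<longrightarrow> maximalideal \<pp> (coord_ring n I))"

definition residue :: "nat \<Rightarrow> (nat, 'k::field) mpoly set \<Rightarrow> (nat, 'k) mpoly \<Rightarrow> (nat, 'k) mpoly set" where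
  "residue n I f = I +>\<^bsub>aff_ring n\<^esub> f"

definition deg_filtration :: "nat \<Rightarrow> (nat, 'k::field) mpoly set \<Rightarrow> nat \<Rightarrow> (nat, 'k) mpoly set set" where
  "deg_filtration n I i =
     residue n I ` {f \<in> carrier (aff_ring n). \<forall>t\<in>Poly_Mapping.keys f. tdeg t \<le> i}"

definition strict_gorenstein :: "nat \<Rightarrow> (nat, 'k::field) mpoly set \<Rightarrow> bool" where
  "strict_gorenstein n I \<longleftrightarrow>
     gorenstein_ring (assoc_graded_ring (coord_ring n I) (deg_filtration n I))"

definition has_df_border_basis :: "nat \<Rightarrow> nat pterm list \<Rightarrow> (nat, 'k::field) mpoly set \<Rightarrow> bool" where
  "has_df_border_basis n ts I \<longleftrightarrow>
     (\<forall>i. let K = range (\<lambda>c. residue n I (pconst c));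
              B = map (\<lambda>t. residue n I (pmonom t)) (filter (\<lambda>t. tdeg t \<le> i) ts)
          in ring.independent (coord_ring n I) K B \<and>
             ring.Span (coord_ring n I) K B = deg_filtration n I i)"


section \<open>Order ideals\<close>

definition order_ideal :: "nat \<Rightarrow> nat pterm set \<Rightarrow> bool" where
  "order_ideal n \<O> \<longleftrightarrow> finite \<O> \<and> \<O> \<noteq> {} \<and> \<O> \<subseteq> terms_in {..<n} \<and>
     (\<forall>s\<in>terms_in {..<n}. \<forall>u\<in>terms_in {..<n}. s + u \<in> \<O> \<longrightarrow> s \<in> \<O>)"

definition border :: "nat \<Rightarrow> nat pterm set \<Rightarrow> nat pterm set" where
  "border n \<O> = (\<Union>r<n. (\<lambda>t. tvar r + t) ` \<O>) - \<O>"

text \<open>\<open>ts = [t\<^sub>1, \<dots>, t\<^sub>\<mu>]\<close> and \<open>bs = [b\<^sub>1, \<dots>, b\<^sub>\<nu>]\<close> enumerate the order ideal and its border.\<close>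

definition order_ideal_enum :: "nat \<Rightarrow> nat pterm list \<Rightarrow> nat pterm list \<Rightarrow> bool" where
  "order_ideal_enum n ts bs \<longleftrightarrow> order_ideal n (set ts) \<and> distinct ts \<and> sorted (map tdeg ts) \<and>
     set bs = border n (set ts) \<and> distinct bs"

definition hilbert_fun :: "nat pterm list \<Rightarrow> nat \<Rightarrow> nat" where
  "hilbert_fun ts i = card {j. j < length ts \<and> tdeg (ts ! j) = i}"

definition hf_symmetric :: "nat pterm list \<Rightarrow> bool" where
  "hf_symmetric ts \<longleftrightarrow> (let \<rho> = Max {i. hilbert_fun ts i > 0}
     in \<forall>i\<in>{1..\<rho>}. hilbert_fun ts i = hilbert_fun ts (\<rho> - i))"


section \<open>Border basis schemes\<close>

text \<open>The indeterminate \<open>c\<^sub>i\<^sub>j\<close> has the name \<open>(i, j)\<close>, all indices being shifted to start at 0.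
  Closed subschemes of \<open>Spec K[C]\<close> are given by their ideals in \<open>K[C]\<close>.\<close>

type_synonym 'k cpoly = "(nat \<times> nat, 'k) mpoly"

definition KC :: "nat pterm list \<Rightarrow> nat pterm list \<Rightarrow> 'k::field cpoly ring" where
  "KC ts bs = mpoly_ring ({..<length ts} \<times> {..<length bs})"

definition gen_mult_mat :: "nat pterm list \<Rightarrow> nat pterm list \<Rightarrow> nat \<Rightarrow> 'k::field cpoly mat" where
  "gen_mult_mat ts bs r = mat (length ts) (length ts) (\<lambda>(i, j).
     if tvar r + ts ! j \<in> set ts then (if ts ! i = tvar r + ts ! j then 1 else 0)
     else pvar (i, THE m. m < length bs \<and> bs ! m = tvar r + ts ! j))"

definition I_BB :: "nat \<Rightarrow> nat pterm list \<Rightarrow> nat pterm list \<Rightarrow> 'k::field cpoly set" where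
  "I_BB n ts bs = Idl\<^bsub>KC ts bs\<^esub> (\<Union>r<n. \<Union>s<n. elements_mat
     (gen_mult_mat ts bs r * gen_mult_mat ts bs s - gen_mult_mat ts bs s * gen_mult_mat ts bs r))"

definition I_df :: "nat pterm list \<Rightarrow> nat pterm list \<Rightarrow> 'k::field cpoly set" where
  "I_df ts bs = Idl\<^bsub>KC ts bs\<^esub>
     {pvar (i, j) | i j. i < length ts \<and> j < length bs \<and> tdeg (ts ! i) > tdeg (bs ! j)}"

definition I_BBdf :: "nat \<Rightarrow> nat pterm list \<Rightarrow> nat pterm list \<Rightarrow> 'k::field cpoly set" where
  "I_BBdf n ts bs = I_BB n ts bs <+>\<^bsub>KC ts bs\<^esub> I_df ts bs"

text \<open>A \<open>K\<close>-rational point is a matrix \<open>\<Gamma> = (\<gamma>\<^sub>i\<^sub>j)\<close> at which all elements of the ideal vanish.\<close>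

definition rational_points :: "nat pterm list \<Rightarrow> nat pterm list \<Rightarrow> 'k::field cpoly set \<Rightarrow> 'k mat set" where
  "rational_points ts bs I =
     {\<Gamma> \<in> carrier_mat (length ts) (length bs). \<forall>f\<in>I. peval id (\<lambda>(i, j). \<Gamma> $$ (i, j)) f = 0}"

definition I_point :: "nat \<Rightarrow> nat pterm list \<Rightarrow> nat pterm list \<Rightarrow> 'k::field mat \<Rightarrow> (nat, 'k) mpoly set" where
  "I_point n ts bs \<Gamma> = Idl\<^bsub>aff_ring n\<^esub>
     {pmonom (bs ! j) - (\<Sum>i<length ts. pconst (\<Gamma> $$ (i, j)) * pmonom (ts ! i)) | j. j < length bs}"


section \<open>The ideal of the non-strictly-Gorenstein locus\<close>

definition hom_mult_mat :: "nat pterm list \<Rightarrow> nat pterm list \<Rightarrow> nat \<Rightarrow> 'k::field cpoly mat" where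
  "hom_mult_mat ts bs r = map_mat
     (peval pconst (\<lambda>(i, j). if tdeg (ts ! i) \<noteq> tdeg (bs ! j) then 0 else pvar (i, j)))
     (gen_mult_mat ts bs r)"

text \<open>\<open>t(M\<^sub>1, \<dots>, M\<^sub>n) = M\<^sub>1\<^bsup>\<alpha>\<^sub>1\<^esup> \<cdots> M\<^sub>n\<^bsup>\<alpha>\<^sub>n\<^esup>\<close> for \<open>\<mu> \<times> \<mu>\<close> matrices; these need not commute, so the
  order of the factors matters.\<close>

definition term_mat :: "nat \<Rightarrow> nat \<Rightarrow> (nat \<Rightarrow> 'a::semiring_1 mat) \<Rightarrow> nat pterm \<Rightarrow> 'a mat" where
  "term_mat n \<mu> M t = foldr (\<lambda>r N. (M r ^\<^sub>m Poly_Mapping.lookup t r) * N) [0..<n] (1\<^sub>m \<mu>)"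

definition M_hom :: "nat \<Rightarrow> nat pterm list \<Rightarrow> nat pterm list \<Rightarrow> nat pterm \<Rightarrow> 'k::field cpoly mat" where
  "M_hom n ts bs t = term_mat n (length ts) (hom_mult_mat ts bs) t"

definition top_count :: "nat pterm list \<Rightarrow> nat" where
  "top_count ts = card {i. i < length ts \<and> tdeg (ts ! i) = tdeg (last ts)}"

definition V_mat :: "nat \<Rightarrow> nat pterm list \<Rightarrow> nat pterm list \<Rightarrow> nat \<Rightarrow> 'k::field cpoly mat" where
  "V_mat n ts bs j = mat_of_cols (length ts)
     (map (\<lambda>i. col (transpose_mat (M_hom n ts bs (ts ! i))) (length ts - top_count ts + j))
       [0..<length ts])"

text \<open>\<open>Col(V\<^sub>1, \<dots>, V\<^sub>\<Delta>)\<close>: the blocks are stacked on top of each other.\<close>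

definition V_col :: "nat \<Rightarrow> nat pterm list \<Rightarrow> nat pterm list \<Rightarrow> 'k::field cpoly mat" where
  "V_col n ts bs = foldr (@\<^sub>r) (map (V_mat n ts bs) [0..<top_count ts]) (0\<^sub>m 0 (length ts))"

definition maximal_minors :: "'a::comm_ring_1 mat \<Rightarrow> 'a set" where
  "maximal_minors M = {det (submatrix M I J) | I J. I \<subseteq> {..<dim_row M} \<and> J \<subseteq> {..<dim_col M} \<and>
     card I = min (dim_row M) (dim_col M) \<and> card J = min (dim_row M) (dim_col M)}"

definition J_minors :: "nat \<Rightarrow> nat pterm list \<Rightarrow> nat pterm list \<Rightarrow> 'k::field cpoly set" where
  "J_minors n ts bs = Idl\<^bsub>KC ts bs\<^esub> (maximal_minors (V_col n ts bs))"

definition I_NonSGor :: "nat \<Rightarrow> nat pterm list \<Rightarrow> nat pterm list \<Rightarrow> 'k::field cpoly set" where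
  "I_NonSGor n ts bs =
     (if hf_symmetric ts then I_BBdf n ts bs <+>\<^bsub>KC ts bs\<^esub> J_minors n ts bs else I_BBdf n ts bs)"

end

theory Submission
  imports Defs
begin

text \<open>At a rational point \<open>\<Gamma>\<close> of the border basis scheme the multiplication matrices
commute, so they make \<open>K\<^sup>\<mu>\<close> a module over \<open>P\<close>, generated by the unit vector \<open>e\<^sub>1\<close> that stands for
\<open>t\<^sub>1 = 1\<close>. In this module \<open>t\<^sub>i\<close> sends \<open>e\<^sub>1\<close> to \<open>e\<^sub>i\<close>, while the generators of \<open>I\<^sub>\<Gamma>\<close> kill \<open>e\<^sub>1\<close>; hence the order
ideal is linearly independent modulo \<open>I\<^sub>\<Gamma>\<close>. If moreover \<open>\<gamma>\<^sub>i\<^sub>j = 0\<close> whenever \<open>deg t\<^sub>i > deg b\<^sub>j\<close>, then border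
terms can be replaced without raising the degree, so that the order ideal is a degree filtered
basis (\<open>term_basis_I_point\<close>). Conversely \<open>\<Gamma>\<close> consists of the coefficients of the normal forms of the
border terms, and any ideal with a degree filtered basis arises in this way (\<open>I_point_inj\<close>,
\<open>I_point_surj\<close>). Such ideals are 0-dimensional, since every residue class is algebraic over \<open>K\<close>.

The associated graded ring is \<open>P\<close> modulo the ideal of leading forms (\<open>gr_map\<close>).
The order ideal is still a basis, reduction now preserves degrees, and the multiplication matrices
are obtained from those of \<open>\<Gamma>\<close> by dropping the entries \<open>\<gamma>\<^sub>i\<^sub>j\<close> with \<open>deg t\<^sub>i \<noteq> deg b\<^sub>j\<close>. If \<open>t\<^sub>\<mu>\<close> is the only term
of maximal degree \<open>\<rho>\<close>, the value of \<open>V\<^sub>1\<close> at \<open>\<Gamma>\<close> is therefore the Gram matrix of the bilinear form that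
maps \<open>(f, g)\<close> to the coefficient of \<open>t\<^sub>\<mu>\<close> in \<open>f g\<close> (\<open>gram_eq_eval_V_mat\<close>).

The graded ring is local Artinian, and over such a ring a module of finite
injective dimension is injective (\<open>finite_injective_dimension_imp_injective\<close>); so being Gorenstein
means being self-injective. In a self-injective local ring the socle lies in every nonzero ideal.
As the socle contains all terms of maximal degree, there is only one of these; and the
form is nondegenerate, because its radical is an ideal that does not contain \<open>t\<^sub>\<mu>\<close>. Conversely, a
nondegenerate form represents every linear functional as \<open>f \<mapsto> (f, b)\<close>, and this extends homomorphisms
from ideals to the ring (\<open>gorenstein_iff\<close>).

The form pairs degree \<open>i\<close> with degree \<open>\<rho> - i\<close> only. If its determinant is nonzero, a nonzero
summand in the Leibniz formula is a permutation which matches these degrees, so the Hilbert function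
is symmetric. Thus an asymmetric order ideal has no strict Gorenstein points at all. A symmetric one
has \<open>\<Delta> = h\<^sub>\<rho> = h\<^sub>0 = 1\<close>, the only maximal minor is \<open>det V\<^sub>1\<close>, and it vanishes at \<open>\<Gamma>\<close> if and only if the scheme is not
strict Gorenstein (\<open>strict_gorenstein_iff\<close>).\<close>

section \<open>Polynomial rings\<close>

abbreviation keys :: "('a \<Rightarrow>\<^sub>0 'b::zero) \<Rightarrow> 'a set" where
  "keys \<equiv> Poly_Mapping.keys"

abbreviation lookup :: "('a \<Rightarrow>\<^sub>0 'b::zero) \<Rightarrow> 'a \<Rightarrow> 'b" where
  "lookup \<equiv> Poly_Mapping.lookup"

abbreviation polys :: "nat \<Rightarrow> (nat, 'k::field) mpoly set" where
  "polys n \<equiv> carrier (aff_ring n)"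

lemma mpoly_ring_simps [simp]:
  "monoid.mult (mpoly_ring X) = (*)" "one (mpoly_ring X) = 1"
  "zero (mpoly_ring X) = 0" "add (mpoly_ring X) = (+)"
  by (simp_all add: mpoly_ring_def)

lemma carrier_mpoly_ring: "p \<in> carrier (mpoly_ring X) \<longleftrightarrow> keys p \<subseteq> terms_in X"
  by (simp add: mpoly_ring_def)

lemma zero_terms_in [simp]: "0 \<in> terms_in X"
  by (simp add: terms_in_def)

lemma keys_add_nat: "keys (s + t) = keys s \<union> keys (t :: 'x pterm)"
  by (auto simp: in_keys_iff lookup_add)

lemma add_terms_in [simp]: "s + t \<in> terms_in X \<longleftrightarrow> s \<in> terms_in X \<and> t \<in> terms_in X"
  by (auto simp: terms_in_def keys_add_nat)

lemma tvar_terms_in [simp]: "tvar x \<in> terms_in X \<longleftrightarrow> x \<in> X"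
  by (simp add: terms_in_def tvar_def)

lemma tdeg_superset:
  assumes "finite A" "keys t \<subseteq> A"
  shows "tdeg t = (\<Sum>x\<in>A. lookup t x)"
  unfolding tdeg_def using assms by (intro sum.mono_neutral_left) (auto simp: in_keys_iff)

lemma tdeg_add: "tdeg (s + t) = tdeg s + tdeg t"
proof -
  let ?A = "keys s \<union> keys t"
  have "tdeg (s + t) = (\<Sum>x\<in>?A. lookup (s + t) x)"
    by (rule tdeg_superset) (auto simp: keys_add_nat)
  also have "\<dots> = (\<Sum>x\<in>?A. lookup s x) + (\<Sum>x\<in>?A. lookup t x)"
    by (simp add: lookup_add sum.distrib)
  also have "\<dots> = tdeg s + tdeg t"
    using tdeg_superset[of ?A s] tdeg_superset[of ?A t] by simp
  finally show ?thesis .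
qed

lemma tdeg_0 [simp]: "tdeg 0 = 0"
  by (simp add: tdeg_def)

lemma tdeg_tvar [simp]: "tdeg (tvar x) = 1"
  by (simp add: tdeg_def tvar_def)

lemma tdeg_eq_0_iff [simp]: "tdeg t = 0 \<longleftrightarrow> t = 0"
proof
  assume "tdeg t = 0"
  then have "\<forall>x\<in>keys t. lookup t x = 0"
    by (simp add: tdeg_def)
  then have "lookup t x = 0" for x
    by (cases "x \<in> keys t") (auto simp: in_keys_iff)
  then show "t = 0" by (intro poly_mapping_eqI) simp
qed simp

lemma term_decompose:
  assumes "t \<in> terms_in X" "t \<noteq> 0"
  obtains x s where "x \<in> X" "s \<in> terms_in X" "t = tvar x + s"
proof -
  from \<open>t \<noteq> 0\<close> obtain x where x: "x \<in> keys t"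
    by (metis keys_eq_empty ex_in_conv)
  let ?s = "t - tvar x"
  have "t = tvar x + ?s"
    by (rule poly_mapping_eqI)
      (use x in \<open>auto simp: lookup_add lookup_minus tvar_def lookup_single when_def in_keys_iff\<close>)
  moreover have "x \<in> X" using x assms(1) by (auto simp: terms_in_def)
  moreover from calculation(1) have "?s \<in> terms_in X" by (metis assms(1) add_terms_in)
  ultimately show ?thesis by (intro that)
qed

lemma pconst_mult_pmonom: "pconst c * pmonom t = Poly_Mapping.single t c"
  by (simp add: pconst_def pmonom_def mult_single)

lemma pmonom_mult: "pmonom s * pmonom t = (pmonom (s + t) :: ('x, 'k::comm_ring_1) mpoly)"
  by (simp add: pmonom_def mult_single)

lemma pmonom_0 [simp]: "pmonom 0 = 1"
  by (simp add: pmonom_def)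

lemma pconst_simps [simp]:
  "pconst 0 = 0" "pconst 1 = 1"
  by (simp_all add: pconst_def)

lemma pconst_add: "pconst (a + b) = pconst a + pconst b"
  by (simp add: pconst_def single_add)

lemma pconst_mult: "pconst (a * b) = pconst a * pconst b"
  by (simp add: pconst_def mult_single)

lemma lookup_pconst_mult: "lookup (pconst c * p) t = c * lookup p t"
  by (simp add: pconst_def flip: mult_map_scale_conv_mult) (simp add: Poly_Mapping.map.rep_eq when_def)

lemma lookup_pconst_0: "lookup (pconst c) 0 = c"
  by (simp add: pconst_def)

lemma poly_expand: "p = (\<Sum>t\<in>keys p. pconst (lookup p t) * pmonom t)"
  by (rule poly_mapping_eqI)
    (auto simp: lookup_sum pconst_mult_pmonom lookup_single when_def in_keys_iff)

lemma mpoly_0_closed [simp]: "0 \<in> carrier (mpoly_ring X)"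
  and mpoly_1_closed [simp]: "1 \<in> carrier (mpoly_ring X)"
  by (simp_all add: carrier_mpoly_ring terms_in_def)

lemma mpoly_add_closed [simp]:
  "p \<in> carrier (mpoly_ring X) \<Longrightarrow> q \<in> carrier (mpoly_ring X) \<Longrightarrow> p + q \<in> carrier (mpoly_ring X)"
  using keys_add[of p q] by (auto simp: carrier_mpoly_ring)

lemma mpoly_uminus_closed [simp]:
  "p \<in> carrier (mpoly_ring X) \<Longrightarrow> - p \<in> carrier (mpoly_ring X)"
  by (auto simp: carrier_mpoly_ring in_keys_iff subset_iff)

lemma mpoly_diff_closed [simp]:
  "p \<in> carrier (mpoly_ring X) \<Longrightarrow> q \<in> carrier (mpoly_ring X) \<Longrightarrow> p - q \<in> carrier (mpoly_ring X)"
  using mpoly_add_closed[of p X "- q"] by simp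

lemma mpoly_mult_closed [simp]:
  "p \<in> carrier (mpoly_ring X) \<Longrightarrow> q \<in> carrier (mpoly_ring X) \<Longrightarrow> p * q \<in> carrier (mpoly_ring X)"
  using keys_mult[of p q] by (force simp: carrier_mpoly_ring)

lemma mpoly_power_closed [simp]:
  "p \<in> carrier (mpoly_ring X) \<Longrightarrow> p ^ k \<in> carrier (mpoly_ring X)"
  by (induction k) auto

lemma mpoly_sum_closed [simp]:
  "(\<And>i. i \<in> A \<Longrightarrow> f i \<in> carrier (mpoly_ring X)) \<Longrightarrow> sum f A \<in> carrier (mpoly_ring X)"
  by (induction A rule: infinite_finite_induct) auto

lemma mpoly_prod_closed [simp]:
  "(\<And>i. i \<in> A \<Longrightarrow> f i \<in> carrier (mpoly_ring X)) \<Longrightarrow> prod f A \<in> carrier (mpoly_ring X)"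
  by (induction A rule: infinite_finite_induct) auto

lemma pconst_closed [simp]: "pconst c \<in> carrier (mpoly_ring X)"
  by (simp add: carrier_mpoly_ring pconst_def)

lemma pmonom_closed [simp]: "t \<in> terms_in X \<Longrightarrow> pmonom t \<in> carrier (mpoly_ring X)"
  by (simp add: carrier_mpoly_ring pmonom_def)

lemma pvar_closed [simp]: "x \<in> X \<Longrightarrow> pvar x \<in> carrier (mpoly_ring X)"
  by (simp add: pvar_def)

lemma mpoly_induct [consumes 1, case_names zero add monom]:
  assumes "p \<in> carrier (mpoly_ring X)"
    and "Q 0" "\<And>p q. p \<in> carrier (mpoly_ring X) \<Longrightarrow> q \<in> carrier (mpoly_ring X) \<Longrightarrow> Q p \<Longrightarrow> Q q \<Longrightarrow> Q (p + q)"
    and "\<And>c t. t \<in> terms_in X \<Longrightarrow> Q (pconst c * pmonom t)"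
  shows "Q p"
proof -
  have "sum (\<lambda>t. pconst (lookup p t) * pmonom t) A \<in> carrier (mpoly_ring X)
     \<and> Q (sum (\<lambda>t. pconst (lookup p t) * pmonom t) A)"
    if "A \<subseteq> keys p" "finite A" for A
    using that(2,1)
  proof (induction A rule: finite_induct)
    case empty
    then show ?case using assms(2) by simp
  next
    case (insert t A)
    then have "t \<in> terms_in X" using assms(1) by (auto simp: carrier_mpoly_ring)
    then show ?case using insert assms(3,4) by simp
  qed
  from this[of "keys p"] show ?thesis
    by (simp flip: poly_expand)
qed

lemma mpoly_ring_cring: "cring (mpoly_ring X :: ('x, 'k::comm_ring_1) mpoly ring)"
proof (rule cringI)
  show "abelian_group (mpoly_ring X :: ('x, 'k) mpoly ring)"
  proof (rule abelian_groupI)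
    fix p :: "('x, 'k) mpoly" assume "p \<in> carrier (mpoly_ring X)"
    then show "\<exists>q\<in>carrier (mpoly_ring X). q \<oplus>\<^bsub>mpoly_ring X\<^esub> p = \<zero>\<^bsub>mpoly_ring X\<^esub>"
      by (intro bexI[of _ "- p"]) auto
  qed (auto simp: algebra_simps)
  show "comm_monoid (mpoly_ring X :: ('x, 'k) mpoly ring)"
    by (rule comm_monoidI) (auto simp: algebra_simps)
qed (auto simp: algebra_simps)

lemma mpoly_ring_ring: "ring (mpoly_ring X :: ('x, 'k::comm_ring_1) mpoly ring)"
  using mpoly_ring_cring cring.axioms(1) by blast

lemma mpoly_a_inv: "p \<in> carrier (mpoly_ring X) \<Longrightarrow> \<ominus>\<^bsub>mpoly_ring X\<^esub> p = - p"
proof -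
  assume p: "p \<in> carrier (mpoly_ring X)"
  interpret cring "mpoly_ring X :: ('a, 'b) mpoly ring" by (rule mpoly_ring_cring)
  show ?thesis using p by (intro minus_equality) auto
qed

lemma mpoly_a_minus:
  "p \<in> carrier (mpoly_ring X) \<Longrightarrow> q \<in> carrier (mpoly_ring X) \<Longrightarrow> p \<ominus>\<^bsub>mpoly_ring X\<^esub> q = p - q"
  by (simp add: a_minus_def mpoly_a_inv)

lemma mpoly_idealI:
  assumes "I \<subseteq> carrier (mpoly_ring X)" "0 \<in> I"
    and "\<And>p q. p \<in> I \<Longrightarrow> q \<in> I \<Longrightarrow> p + q \<in> I"
    and "\<And>p q. p \<in> carrier (mpoly_ring X) \<Longrightarrow> q \<in> I \<Longrightarrow> p * q \<in> I"
  shows "ideal I (mpoly_ring X :: ('x, 'k::comm_ring_1) mpoly ring)"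
proof (rule idealI)
  show "ring (mpoly_ring X :: ('x, 'k::comm_ring_1) mpoly ring)" by (rule mpoly_ring_ring)
  interpret cring "mpoly_ring X :: ('x, 'k) mpoly ring" by (rule mpoly_ring_cring)
  show "subgroup I (add_monoid (mpoly_ring X :: ('x, 'k::comm_ring_1) mpoly ring))"
  proof (rule add.subgroupI)
    show "\<ominus>\<^bsub>mpoly_ring X\<^esub> p \<in> I" if "p \<in> I" for p
    proof -
      have "- 1 * p \<in> I" using that assms(1) by (intro assms(4)) auto
      then show ?thesis using that assms(1) by (simp add: mpoly_a_inv subset_iff)
    qed
  qed (use assms in auto)
  show "\<And>a x. a \<in> I \<Longrightarrow> x \<in> carrier (mpoly_ring X) \<Longrightarrow> a \<otimes>\<^bsub>mpoly_ring X\<^esub> x \<in> I"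
    by (subst mpoly_ring_simps(1), subst mult.commute) (rule assms(4))
qed (use assms in auto)

lemma mpoly_ideal_closed:
  assumes "ideal I (mpoly_ring X :: ('x, 'k::comm_ring_1) mpoly ring)"
  shows "p \<in> I \<Longrightarrow> p \<in> carrier (mpoly_ring X)" "0 \<in> I"
    "p \<in> I \<Longrightarrow> q \<in> I \<Longrightarrow> p + q \<in> I" "p \<in> I \<Longrightarrow> q \<in> I \<Longrightarrow> p - q \<in> I" "p \<in> I \<Longrightarrow> - p \<in> I"
    "p \<in> I \<Longrightarrow> q \<in> carrier (mpoly_ring X) \<Longrightarrow> p * q \<in> I"
    "p \<in> I \<Longrightarrow> q \<in> carrier (mpoly_ring X) \<Longrightarrow> q * p \<in> I"
proof -
  interpret ideal I "mpoly_ring X :: ('x, 'k) mpoly ring" by fact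
  show 1: "p \<in> I \<Longrightarrow> p \<in> carrier (mpoly_ring X)" for p using Icarr by auto
  show "0 \<in> I" using additive_subgroup.zero_closed[OF is_additive_subgroup] by simp
  show 2: "p \<in> I \<Longrightarrow> q \<in> I \<Longrightarrow> p + q \<in> I" for p q using additive_subgroup.a_closed[OF is_additive_subgroup, of p q] by simp
  show 3: "p \<in> I \<Longrightarrow> - p \<in> I" for p using I_l_closed[of p "- 1"] by simp
  show "p \<in> I \<Longrightarrow> q \<in> I \<Longrightarrow> p - q \<in> I" using 2[of p "- q"] 3 by simp
  show "p \<in> I \<Longrightarrow> q \<in> carrier (mpoly_ring X) \<Longrightarrow> p * q \<in> I" using I_r_closed by simp
  show "p \<in> I \<Longrightarrow> q \<in> carrier (mpoly_ring X) \<Longrightarrow> q * p \<in> I" using I_l_closed by simp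
qed

lemma mpoly_ideal_sum:
  assumes "ideal I (mpoly_ring X :: ('x, 'k::comm_ring_1) mpoly ring)"
  shows "(\<And>i. i \<in> A \<Longrightarrow> f i \<in> I) \<Longrightarrow> sum f A \<in> I"
  by (induction A rule: infinite_finite_induct) (auto intro: mpoly_ideal_closed[OF assms])

section \<open>Evaluation of polynomials\<close>

lemma peval_superset:
  assumes "finite A" "keys p \<subseteq> A"
  shows "peval id f p = (\<Sum>t\<in>A. lookup p t *
     (\<Prod>x\<in>keys t. f x ^ lookup t x))"
  unfolding peval_def using assms by (intro sum.mono_neutral_cong_left) (auto simp: in_keys_iff)

lemma peval_0 [simp]: "peval \<phi> f 0 = 0"
  by (simp add: peval_def)

lemma peval_1 [simp]: "peval \<phi> f (1 :: ('x, 'k::comm_ring_1) mpoly) = \<phi> 1"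
  by (simp add: peval_def)

lemma peval_pvar [simp]: "peval \<phi> f (pvar x :: ('x, 'k::comm_ring_1) mpoly) = \<phi> 1 * f x"
  by (simp add: peval_def pvar_def pmonom_def tvar_def)

lemma peval_add: "peval id f (p + q) = peval id f p + peval id f q"
proof -
  let ?A = "keys p \<union> keys q"
  have "finite ?A" "keys (p + q) \<subseteq> ?A" by (simp_all add: keys_add)
  then show ?thesis
    using peval_superset[of ?A p f] peval_superset[of ?A q f] peval_superset[of ?A "p + q" f]
    by (simp add: lookup_add algebra_simps sum.distrib)
qed

lemma peval_sum: "peval id f (sum g A) = (\<Sum>i\<in>A. peval id f (g i))"
  by (induction A rule: infinite_finite_induct)
    (simp_all only: sum.infinite sum.empty sum.insert peval_0 peval_add not_False_eq_True)

lemma term_value_superset: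
  fixes f :: "'x \<Rightarrow> 'b::comm_ring_1"
  assumes "finite A" "keys t \<subseteq> A"
  shows "(\<Prod>x\<in>keys t. f x ^ lookup t x) = (\<Prod>x\<in>A. f x ^ lookup t x)"
  using assms by (intro prod.mono_neutral_left) (auto simp: in_keys_iff)

lemma term_value_add:
  fixes f :: "'x \<Rightarrow> 'b::comm_ring_1" and s t :: "'x pterm"
  shows "(\<Prod>x\<in>keys (s + t). f x ^ lookup (s + t) x) =
    (\<Prod>x\<in>keys s. f x ^ lookup s x) *
    (\<Prod>x\<in>keys t. f x ^ lookup t x)"
proof -
  let ?A = "keys s \<union> keys t"
  show ?thesis
    using term_value_superset[of ?A s f] term_value_superset[of ?A t f]
      term_value_superset[of ?A "s + t" f]
    by (simp add: keys_add_nat lookup_add power_add prod.distrib)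
qed

lemma peval_single: "peval id f (Poly_Mapping.single t c) =
    c * (\<Prod>x\<in>keys t. f x ^ lookup t x)"
  by (simp add: peval_def)

lemma peval_mult: "peval id f (p * q) = peval id f p * peval id f q"
proof -
  let ?v = "\<lambda>t. \<Prod>x\<in>keys t. f x ^ lookup t x"
  have "p * q = (\<Sum>s\<in>keys p. pconst (lookup p s) * pmonom s)
      * (\<Sum>t\<in>keys q. pconst (lookup q t) * pmonom t)"
    by (simp flip: poly_expand)
  also have "\<dots> = (\<Sum>s\<in>keys p. \<Sum>t\<in>keys q.
      Poly_Mapping.single (s + t) (lookup p s * lookup q t))"
    by (simp add: sum_product pconst_mult_pmonom mult_single)
  finally have "peval id f (p * q) = (\<Sum>s\<in>keys p. \<Sum>t\<in>keys q.
      (lookup p s * ?v s) * (lookup q t * ?v t))"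
    by (simp add: peval_sum peval_single term_value_add algebra_simps)
  also have "\<dots> = peval id f p * peval id f q"
    by (simp add: peval_def sum_product)
  finally show ?thesis .
qed

lemma peval_hom: "comm_ring_hom (peval id f)"
  by unfold_locales (auto simp: peval_add peval_mult)

text \<open>The polynomials that vanish at a given point form an ideal.\<close>

lemma peval_vanishes_genideal:
  assumes "S \<subseteq> carrier (mpoly_ring X)"
  shows "(\<forall>p\<in>Idl\<^bsub>mpoly_ring X\<^esub> S. peval id f p = 0) \<longleftrightarrow> (\<forall>p\<in>S. peval id f p = 0)"
proof
  interpret cring "mpoly_ring X :: ('a, 'b) mpoly ring" by (rule mpoly_ring_cring)
  show "\<forall>p\<in>S. peval id f p = 0" if "\<forall>p\<in>Idl\<^bsub>mpoly_ring X\<^esub> S. peval id f p = 0"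
    using that genideal_self[OF assms] by auto
  assume S: "\<forall>p\<in>S. peval id f p = 0"
  have "ideal {p \<in> carrier (mpoly_ring X). peval id f p = 0} (mpoly_ring X)"
    by (rule mpoly_idealI) (auto simp: peval_add peval_mult)
  moreover have "S \<subseteq> {p \<in> carrier (mpoly_ring X). peval id f p = 0}" using assms S by auto
  ultimately have "Idl\<^bsub>mpoly_ring X\<^esub> S \<subseteq> {p \<in> carrier (mpoly_ring X). peval id f p = 0}"
    by (rule genideal_minimal)
  then show "\<forall>p\<in>Idl\<^bsub>mpoly_ring X\<^esub> S. peval id f p = 0" by auto
qed

lemma peval_vanishes_sum_ideal:
  assumes "ideal I (mpoly_ring X)" "ideal J (mpoly_ring X)"
  shows "(\<forall>p\<in>I <+>\<^bsub>mpoly_ring X\<^esub> J. peval id f p = 0) \<longleftrightarrow>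
    (\<forall>p\<in>I. peval id f p = 0) \<and> (\<forall>p\<in>J. peval id f p = 0)"
proof -
  have "p \<in> I <+>\<^bsub>mpoly_ring X\<^esub> J" if "p \<in> I" for p
    using that mpoly_ideal_closed(2)[OF assms(2)] by (force simp: set_add_def')
  moreover have "p \<in> I <+>\<^bsub>mpoly_ring X\<^esub> J" if "p \<in> J" for p
    using that mpoly_ideal_closed(2)[OF assms(1)] by (force simp: set_add_def')
  ultimately have "(\<forall>p\<in>I. peval id f p = 0) \<and> (\<forall>p\<in>J. peval id f p = 0)"
    if "\<forall>p\<in>I <+>\<^bsub>mpoly_ring X\<^esub> J. peval id f p = 0"
    using that by blast
  moreover have "peval id f p = 0"
    if "(\<forall>p\<in>I. peval id f p = 0) \<and> (\<forall>p\<in>J. peval id f p = 0)"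
      and "p \<in> I <+>\<^bsub>mpoly_ring X\<^esub> J" for p
  proof -
    from that(2) obtain q r where "q \<in> I" "r \<in> J" "p = q + r"
      by (auto simp: set_add_def')
    then show ?thesis using that(1) by (simp only: peval_add) simp
  qed
  ultimately show ?thesis by blast
qed

section \<open>Normal forms modulo an ideal\<close>

lemma keys_pconst_mult: "keys (pconst c * p) \<subseteq> keys p"
  by (auto simp: in_keys_iff lookup_pconst_mult)

lemma keys_sum_subset:
  "(\<And>i. i \<in> A \<Longrightarrow> keys (f i) \<subseteq> B) \<Longrightarrow> keys (sum f A) \<subseteq> B"
  by (rule order_trans[OF keys_sum]) auto

lemma keys_pmonom [simp]: "keys (pmonom t :: ('x, 'k::comm_ring_1) mpoly) = {t}"
  by (simp add: pmonom_def)

lemma poly_expand_superset: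
  assumes "finite A" "keys p \<subseteq> A"
  shows "p = (\<Sum>t\<in>A. pconst (lookup p t) * pmonom t)"
proof -
  have "p = (\<Sum>t\<in>keys p. pconst (lookup p t) * pmonom t)"
    by (rule poly_expand)
  also have "\<dots> = (\<Sum>t\<in>A. pconst (lookup p t) * pmonom t)"
    using assms by (intro sum.mono_neutral_left) (auto simp: in_keys_iff)
  finally show ?thesis .
qed

text \<open>The terms in \<open>B\<close> represent a basis of \<open>P / I\<close>, and \<open>rel\<close> says which degrees may occur when a term is reduced.
With \<open>\<le>\<close> the basis is degree filtered; with \<open>=\<close> the ideal is homogeneous and reduction preserves
degrees. A linear combination of basis elements is a polynomial whose \<open>keys\<close> lie in \<open>B\<close>.\<close>

locale term_basis =
  fixes n :: nat and B :: "nat pterm set" and I :: "(nat, 'k::field) mpoly set"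
    and rel :: "nat \<Rightarrow> nat \<Rightarrow> bool"
  assumes ideal: "ideal I (aff_ring n)"
    and finite_B: "finite B" and B_terms: "B \<subseteq> terms_in {..<n}"
    and reduce: "t \<in> terms_in {..<n} \<Longrightarrow>
      \<exists>p. keys p \<subseteq> {s \<in> B. rel (tdeg s) (tdeg t)} \<and> pmonom t - p \<in> I"
    and indep: "keys p \<subseteq> B \<Longrightarrow> p \<in> I \<Longrightarrow> p = 0"
begin

lemmas ideal_closed = mpoly_ideal_closed[OF ideal]

lemma keys_B_closed: "keys p \<subseteq> B \<Longrightarrow> p \<in> polys n"
  using B_terms by (auto simp: carrier_mpoly_ring)

lemma reduce_poly:
  assumes "f \<in> polys n"
  shows "\<exists>p. keys p \<subseteq> {s \<in> B. \<exists>t\<in>keys f. rel (tdeg s) (tdeg t)} \<and> f - p \<in> I"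
proof -
  from assms have "\<forall>t\<in>keys f.
      \<exists>p. keys p \<subseteq> {s \<in> B. rel (tdeg s) (tdeg t)} \<and> pmonom t - p \<in> I"
    using reduce by (auto simp: carrier_mpoly_ring)
  then obtain P where P: "\<And>t. t \<in> keys f \<Longrightarrow>
      keys (P t) \<subseteq> {s \<in> B. rel (tdeg s) (tdeg t)} \<and> pmonom t - P t \<in> I"
    by metis
  let ?p = "\<Sum>t\<in>keys f. pconst (lookup f t) * P t"
  have "keys ?p \<subseteq> {s \<in> B. \<exists>t\<in>keys f. rel (tdeg s) (tdeg t)}"
  proof (rule keys_sum_subset)
    fix t assume "t \<in> keys f"
    then show "keys (pconst (lookup f t) * P t)
        \<subseteq> {s \<in> B. \<exists>t\<in>keys f. rel (tdeg s) (tdeg t)}"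
      using P[of t] keys_pconst_mult[of "lookup f t" "P t"] by blast
  qed
  moreover have "f - ?p =
      (\<Sum>t\<in>keys f. pconst (lookup f t) * (pmonom t - P t))"
    by (subst (1) poly_expand[of f]) (simp add: sum_subtractf algebra_simps)
  moreover have "(\<Sum>t\<in>keys f. pconst (lookup f t) * (pmonom t - P t)) \<in> I"
    using P by (intro mpoly_ideal_sum[OF ideal] ideal_closed(7)) auto
  ultimately show ?thesis by auto
qed

definition NF :: "(nat, 'k) mpoly \<Rightarrow> (nat, 'k) mpoly" where
  "NF f = (SOME p. keys p \<subseteq> {s \<in> B. \<exists>t\<in>keys f. rel (tdeg s) (tdeg t)} \<and> f - p \<in> I)"

lemma NF:
  assumes "f \<in> polys n"
  shows "keys (NF f) \<subseteq> {s \<in> B. \<exists>t\<in>keys f. rel (tdeg s) (tdeg t)}"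
    "f - NF f \<in> I"
  using someI_ex[OF reduce_poly[OF assms]] by (auto simp: NF_def)

lemma NF_keys: "f \<in> polys n \<Longrightarrow> keys (NF f) \<subseteq> B"
  using NF(1) by blast

lemma NF_closed: "f \<in> polys n \<Longrightarrow> NF f \<in> polys n"
  using NF_keys keys_B_closed by blast

lemma NF_unique:
  assumes "keys p \<subseteq> B" "f - p \<in> I" "f \<in> polys n"
  shows "NF f = p"
proof -
  have "NF f - p \<in> I" using ideal_closed(4)[OF assms(2) NF(2)[OF assms(3)]] by simp
  moreover have "keys (NF f - p) \<subseteq> B"
    using NF_keys[OF assms(3)] assms(1) keys_diff[of "NF f" p] by blast
  ultimately show ?thesis using indep by fastforce
qed

lemma NF_id: "keys p \<subseteq> B \<Longrightarrow> NF p = p"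
  by (rule NF_unique) (auto simp: keys_B_closed ideal_closed)

lemma NF_eqI: "f \<in> polys n \<Longrightarrow> g \<in> polys n \<Longrightarrow> f - g \<in> I \<Longrightarrow> NF f = NF g"
  using ideal_closed(3)[of "f - g" "g - NF g"] NF(2)[of g] NF_keys[of g] by (intro NF_unique) auto

lemma NF_0_iff: "f \<in> polys n \<Longrightarrow> NF f = 0 \<longleftrightarrow> f \<in> I"
  using NF(2)[of f] NF_unique[of 0 f] by auto

lemma NF_add:
  assumes "f \<in> polys n" "g \<in> polys n"
  shows "NF (f + g) = NF f + NF g"
proof (rule NF_unique)
  show "keys (NF f + NF g) \<subseteq> B"
    using NF_keys assms keys_add[of "NF f" "NF g"] by blast
  have "(f - NF f) + (g - NF g) \<in> I" using assms NF(2) by (intro ideal_closed(3))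
  then show "f + g - (NF f + NF g) \<in> I" by (simp add: algebra_simps)
qed (use assms in auto)

lemma NF_scale:
  assumes "f \<in> polys n"
  shows "NF (pconst c * f) = pconst c * NF f"
proof (rule NF_unique)
  show "keys (pconst c * NF f) \<subseteq> B"
    using NF_keys assms keys_pconst_mult[of c "NF f"] by blast
  have "pconst c * (f - NF f) \<in> I" using assms NF(2) by (intro ideal_closed(7)) auto
  then show "pconst c * f - pconst c * NF f \<in> I" by (simp add: algebra_simps)
qed (use assms in auto)

lemma NF_0: "NF 0 = 0"
  by (rule NF_id) simp

lemma NF_sum:
  "(\<And>i. i \<in> A \<Longrightarrow> f i \<in> polys n) \<Longrightarrow> NF (sum f A) = (\<Sum>i\<in>A. NF (f i))"
  by (induction A rule: infinite_finite_induct) (auto simp: NF_add NF_0)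

lemma NF_mult_NF:
  assumes "f \<in> polys n" "g \<in> polys n"
  shows "NF (f * NF g) = NF (f * g)"
proof (rule NF_eqI)
  have "- f * (g - NF g) \<in> I" using assms NF(2) by (intro ideal_closed(7)) auto
  then show "f * NF g - f * g \<in> I" by (simp add: algebra_simps)
qed (use assms NF_closed in auto)

end

section \<open>Residue class rings of the polynomial ring\<close>

locale aff_ideal =
  fixes n :: nat and I :: "(nat, 'k::field) mpoly set"
  assumes ideal: "ideal I (aff_ring n)"
begin

lemmas ideal_closed = mpoly_ideal_closed[OF ideal]

lemma residue_hom: "residue n I \<in> Ring.ring_hom (aff_ring n) (coord_ring n I)"
  unfolding coord_ring_def residue_def[abs_def] by (rule ideal.rcos_ring_hom[OF ideal])

lemma residue_ring_hom: "ring_hom_ring (aff_ring n) (coord_ring n I) (residue n I)"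
  unfolding coord_ring_def residue_def[abs_def] by (rule ideal.rcos_ring_hom_ring[OF ideal])

lemma coord_cring: "cring (coord_ring n I)"
  unfolding coord_ring_def by (rule ideal.quotient_is_cring[OF ideal mpoly_ring_cring])

lemma coord_ring: "ring (coord_ring n I)"
  using coord_cring cring.axioms(1) by blast

lemma coord_carrier: "carrier (coord_ring n I) = residue n I ` polys n"
  by (auto simp: coord_ring_def FactRing_def A_RCOSETS_def' residue_def)

lemma residue_closed: "f \<in> polys n \<Longrightarrow> residue n I f \<in> carrier (coord_ring n I)"
  by (simp add: coord_carrier)

lemma residue_simps:
  assumes "f \<in> polys n" "g \<in> polys n"
  shows "residue n I f \<oplus>\<^bsub>coord_ring n I\<^esub> residue n I g = residue n I (f + g)"
    "residue n I f \<otimes>\<^bsub>coord_ring n I\<^esub> residue n I g = residue n I (f * g)"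
  using ring_hom_add[OF residue_hom assms] ring_hom_mult[OF residue_hom assms] by simp_all

lemma residue_1: "\<one>\<^bsub>coord_ring n I\<^esub> = residue n I 1"
  using ring_hom_one[OF residue_hom] by simp

lemma residue_0: "\<zero>\<^bsub>coord_ring n I\<^esub> = residue n I 0"
  using ring_hom_zero[OF residue_hom mpoly_ring_ring coord_ring] by simp

lemma residue_eq_iff:
  assumes "f \<in> polys n" "g \<in> polys n"
  shows "residue n I f = residue n I g \<longleftrightarrow> f - g \<in> I"
  using ring.quotient_eq_iff_same_a_r_cos[OF mpoly_ring_ring ideal assms]
  by (simp add: residue_def mpoly_a_minus assms)

text \<open>Spans are defined by recursion on the list of generators. This lemma and the next one translate
spans and independence over the image of \<open>K\<close> in \<open>P / I\<close> into statements on polynomials and \<open>I\<close>.\<close>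

lemma Span_residues:
  assumes "set us \<subseteq> terms_in {..<n}"
  shows "ring.Span (coord_ring n I) (range (\<lambda>c. residue n I (pconst c))) (map (\<lambda>t. residue n I (pmonom t)) us)
    = residue n I ` {p. keys p \<subseteq> set us}"
  using assms
proof (induction us)
  case Nil
  interpret ring "coord_ring n I" by (rule coord_ring)
  show ?case by (simp add: residue_0)
next
  case (Cons u us)
  interpret ring "coord_ring n I" by (rule coord_ring)
  let ?K = "range (\<lambda>c. residue n I (pconst c))"
  have IH: "Span ?K (map (\<lambda>t. residue n I (pmonom t)) us) = residue n I ` {p. keys p \<subseteq> set us}"
    using Cons by simp
  have car: "p \<in> polys n" if "keys p \<subseteq> set (u # us)" for p
    using that Cons.prems by (auto simp: carrier_mpoly_ring)
  have u: "u \<in> terms_in {..<n}" using Cons.prems by simp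
  have "Span ?K (map (\<lambda>t. residue n I (pmonom t)) (u # us)) =
    line_extension ?K (residue n I (pmonom u)) (Span ?K (map (\<lambda>t. residue n I (pmonom t)) us))"
    by simp
  also have "\<dots> = {residue n I (pconst c * pmonom u + p) | c p. keys p \<subseteq> set us}"
  proof -
    have "residue n I (pconst c) \<otimes>\<^bsub>coord_ring n I\<^esub> residue n I (pmonom u) \<oplus>\<^bsub>coord_ring n I\<^esub> residue n I p
      = residue n I (pconst c * pmonom u + p)" if "keys p \<subseteq> set us" for c p
      using u car[of p] that by (simp add: residue_simps subset_insertI2)
    then show ?thesis
      unfolding IH by (fastforce simp: line_extension_mem_iff)
  qed
  also have "\<dots> = residue n I ` {p. keys p \<subseteq> set (u # us)}"
  proof (intro Set.set_eqI iffI)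
    fix x assume "x \<in> {residue n I (pconst c * pmonom u + p) | c p. keys p \<subseteq> set us}"
    then obtain c p where *: "x = residue n I (pconst c * pmonom u + p)" "keys p \<subseteq> set us"
      by auto
    have "keys (pconst c * pmonom u + p) \<subseteq> set (u # us)"
      using *(2) keys_add[of "pconst c * pmonom u" p] keys_pconst_mult[of c "pmonom u"] by fastforce
    then show "x \<in> residue n I ` {p. keys p \<subseteq> set (u # us)}"
      using * by blast
  next
    fix x assume "x \<in> residue n I ` {p. keys p \<subseteq> set (u # us)}"
    then obtain p where p: "x = residue n I p" "keys p \<subseteq> set (u # us)" by auto
    let ?q = "p - pconst (lookup p u) * pmonom u"
    have "keys ?q \<subseteq> keys p - {u}"
      by (auto simp: in_keys_iff lookup_minus lookup_pconst_mult pmonom_def lookup_single when_def split: if_splits)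
    then have "keys ?q \<subseteq> set us" using p by auto
    moreover have "x = residue n I (pconst (lookup p u) * pmonom u + ?q)" using p by simp
    ultimately show "x \<in> {residue n I (pconst c * pmonom u + p) | c p. keys p \<subseteq> set us}"
      by blast
  qed
  finally show ?case .
qed

text \<open>A relation in which the first term \<open>u\<close> occurs can be scaled to the form \<open>u - p\<close> with \<open>p\<close> supported on the
remaining terms, so it says that \<open>u\<close> lies in their span.\<close>

lemma independent_residues:
  assumes "set us \<subseteq> terms_in {..<n}" "distinct us"
  shows "ring.independent (coord_ring n I) (range (\<lambda>c. residue n I (pconst c))) (map (\<lambda>t. residue n I (pmonom t)) us)
    \<longleftrightarrow> (\<forall>p\<in>I. keys p \<subseteq> set us \<longrightarrow> p = 0)"
  using assms
proof (induction us)
  case Nil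
  interpret ring "coord_ring n I" by (rule coord_ring)
  show ?case by (simp add: keys_eq_empty)
next
  case (Cons u us)
  interpret ring "coord_ring n I" by (rule coord_ring)
  let ?K = "range (\<lambda>c. residue n I (pconst c))"
  have u: "u \<in> terms_in {..<n}" using Cons.prems by simp
  have car: "p \<in> polys n" if "keys p \<subseteq> set us" for p
    using that Cons.prems by (auto simp: carrier_mpoly_ring)
  have "independent ?K (map (\<lambda>t. residue n I (pmonom t)) (u # us)) \<longleftrightarrow>
     residue n I (pmonom u) \<notin> Span ?K (map (\<lambda>t. residue n I (pmonom t)) us) \<and>
     independent ?K (map (\<lambda>t. residue n I (pmonom t)) us)"
    using independent_backwards[of ?K "residue n I (pmonom u)" "map (\<lambda>t. residue n I (pmonom t)) us"]
      li_Cons[of "residue n I (pmonom u)" ?K "map (\<lambda>t. residue n I (pmonom t)) us"]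
      residue_closed u by (auto simp del: Span.simps)
  also have "\<dots> \<longleftrightarrow> (\<forall>p. keys p \<subseteq> set us \<longrightarrow> pmonom u - p \<notin> I) \<and>
      (\<forall>p\<in>I. keys p \<subseteq> set us \<longrightarrow> p = 0)"
  proof -
    have "set us \<subseteq> terms_in {..<n}" using Cons.prems by simp
    moreover have "residue n I (pmonom u) = residue n I p \<longleftrightarrow> pmonom u - p \<in> I"
      if "keys p \<subseteq> set us" for p
      using u car[OF that] by (intro residue_eq_iff) auto
    then have "residue n I (pmonom u) \<in> residue n I ` {p. keys p \<subseteq> set us} \<longleftrightarrow>
        (\<exists>p. keys p \<subseteq> set us \<and> pmonom u - p \<in> I)"
      by blast
    ultimately show ?thesis
      using Cons by (simp only: Span_residues distinct.simps) blast
  qed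
  also have "\<dots> \<longleftrightarrow> (\<forall>p\<in>I. keys p \<subseteq> set (u # us) \<longrightarrow> p = 0)"
  proof (intro iffI conjI allI ballI impI)
    fix p :: "(nat, 'k) mpoly"
    assume *: "\<forall>p\<in>I. keys p \<subseteq> set (u # us) \<longrightarrow> p = 0" and p: "keys p \<subseteq> set us"
    show "pmonom u - p \<notin> I"
    proof
      assume "pmonom u - p \<in> I"
      moreover have "keys (pmonom u - p) \<subseteq> set (u # us)"
        using p keys_diff[of "pmonom u" p] by auto
      ultimately have "pmonom u = p" using * by fastforce
      then show False using p Cons.prems by auto
    qed
  next
    fix p
    assume *: "(\<forall>p. keys p \<subseteq> set us \<longrightarrow> pmonom u - p \<notin> I) \<and>
      (\<forall>p\<in>I. keys p \<subseteq> set us \<longrightarrow> p = 0)"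
      and p: "p \<in> I" "keys p \<subseteq> set (u # us)"
    let ?c = "lookup p u"
    show "p = 0"
    proof (cases "?c = 0")
      case True
      then have "keys p \<subseteq> set us" using p by (auto simp: in_keys_iff)
      then show ?thesis using * p by auto
    next
      case False
      let ?q = "pmonom u - pconst (1 / ?c) * p"
      have "keys ?q \<subseteq> keys p - {u}"
        using False
        by (auto simp: in_keys_iff lookup_minus lookup_pconst_mult pmonom_def lookup_single when_def split: if_splits)
      then have "keys ?q \<subseteq> set us" using p by auto
      then have "pmonom u - ?q \<notin> I" using * by blast
      moreover have "pmonom u - ?q = pconst (1 / ?c) * p" by simp
      ultimately show ?thesis using ideal_closed(7)[OF p(1)] by (metis pconst_closed)
    qed
  qed auto
  finally show ?case .
qed

end

text \<open>Independence in all degrees is independence of the whole order ideal, since a relation involves only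
degrees up to the maximal one. The filtration is spanned in every degree \<open>i\<close> if and only if each term
reduces to elements of the order ideal whose degree is not larger.\<close>

lemma has_df_border_basis_iff:
  assumes "ideal I (aff_ring n)" "set ts \<subseteq> terms_in {..<n}" "distinct ts"
  shows "has_df_border_basis n ts I \<longleftrightarrow> term_basis n (set ts) I (\<le>)"
proof -
  interpret aff_ideal n I using assms(1) by (rule aff_ideal.intro)
  have "has_df_border_basis n ts I \<longleftrightarrow>
    (\<forall>i. (\<forall>p\<in>I. keys p \<subseteq> {t \<in> set ts. tdeg t \<le> i} \<longrightarrow> p = 0) \<and>
      residue n I ` {p. keys p \<subseteq> {t \<in> set ts. tdeg t \<le> i}} = deg_filtration n I i)"
    unfolding has_df_border_basis_def Let_def
    using assms(2,3) independent_residues[of "filter (\<lambda>t. tdeg t \<le> i) ts" for i]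
      Span_residues[of "filter (\<lambda>t. tdeg t \<le> i) ts" for i]
    by (simp del: ring.Span.simps) (simp add: subset_iff)
  also have "\<dots> \<longleftrightarrow> term_basis n (set ts) I (\<le>)"
  proof
    assume *: "\<forall>i. (\<forall>p\<in>I. keys p \<subseteq> {t \<in> set ts. tdeg t \<le> i} \<longrightarrow> p = 0) \<and>
      residue n I ` {p. keys p \<subseteq> {t \<in> set ts. tdeg t \<le> i}} = deg_filtration n I i"
    show "term_basis n (set ts) I (\<le>)"
    proof (rule term_basis.intro[OF assms(1)])
      fix p assume p: "keys p \<subseteq> set ts" "p \<in> I"
      have "keys p \<subseteq> {t \<in> set ts. tdeg t \<le> Max (tdeg ` set ts)}"
        using p by auto
      then show "p = 0" using * p by blast
    next
      fix t :: "nat pterm" assume t: "t \<in> terms_in {..<n}"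
      then have "residue n I (pmonom t) \<in> deg_filtration n I (tdeg t)"
        by (auto simp: deg_filtration_def)
      then obtain p where p: "keys p \<subseteq> {s \<in> set ts. tdeg s \<le> tdeg t}"
        "residue n I (pmonom t) = residue n I p" using * by blast
      moreover have "p \<in> polys n" using p assms(2) by (auto simp: carrier_mpoly_ring)
      ultimately show "\<exists>p. keys p \<subseteq> {s \<in> set ts. tdeg s \<le> tdeg t} \<and> pmonom t - p \<in> I"
        using t by (auto simp: residue_eq_iff)
    qed (use assms in auto)
  next
    assume "term_basis n (set ts) I (\<le>)"
    then interpret B: term_basis n "set ts" I "(\<le>)" .
    show "\<forall>i. (\<forall>p\<in>I. keys p \<subseteq> {t \<in> set ts. tdeg t \<le> i} \<longrightarrow> p = 0) \<and>
      residue n I ` {p. keys p \<subseteq> {t \<in> set ts. tdeg t \<le> i}} = deg_filtration n I i"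
    proof (intro allI conjI ballI impI)
      fix i p assume "p \<in> I" "keys p \<subseteq> {t \<in> set ts. tdeg t \<le> i}"
      then show "p = 0" using B.indep by auto
    next
      fix i
      show "residue n I ` {p. keys p \<subseteq> {t \<in> set ts. tdeg t \<le> i}} = deg_filtration n I i"
      proof
        show "residue n I ` {p. keys p \<subseteq> {t \<in> set ts. tdeg t \<le> i}} \<subseteq> deg_filtration n I i"
          using assms(2) by (auto simp: deg_filtration_def carrier_mpoly_ring)
        show "deg_filtration n I i \<subseteq> residue n I ` {p. keys p \<subseteq> {t \<in> set ts. tdeg t \<le> i}}"
        proof
          fix x assume "x \<in> deg_filtration n I i"
          then obtain f where f: "f \<in> polys n" "\<forall>t\<in>keys f. tdeg t \<le> i"
            "x = residue n I f" by (auto simp: deg_filtration_def)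
          then have "keys (B.NF f) \<subseteq> {t \<in> set ts. tdeg t \<le> i}"
            using B.NF(1)[OF f(1)] by fastforce
          moreover have "x = residue n I (B.NF f)"
            using f B.NF(2)[OF f(1)] B.NF_closed[OF f(1)] by (simp add: residue_eq_iff)
          ultimately show "x \<in> residue n I ` {p. keys p \<subseteq> {t \<in> set ts. tdeg t \<le> i}}"
            by blast
        qed
      qed
    qed
  qed
  finally show ?thesis .
qed

section \<open>Zero-dimensionality\<close>

context term_basis
begin

text \<open>The \<open>\<mu> + 1\<close> powers \<open>f\<^sup>0, \<dots>, f\<^sup>\<mu>\<close> are linearly dependent in a space of dimension \<open>\<mu>\<close>.\<close>

lemma algebraic_relation:
  assumes f: "f \<in> polys n"
  shows "\<exists>c :: nat \<Rightarrow> 'k. (\<exists>j\<le>card B. c j \<noteq> 0) \<and> (\<Sum>j\<le>card B. pconst (c j) * f ^ j) \<in> I"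
proof -
  obtain ts where ts: "set ts = B" "distinct ts" using finite_B finite_distinct_list by blast
  let ?\<mu> = "card B"
  have len: "length ts = ?\<mu>" using distinct_card[OF ts(2)] ts(1) by simp
  \<comment> \<open>The columns are the coordinates of the powers of \<open>f\<close>. A zero row at the bottom makes the matrix
  square and hence singular.\<close>
  define M where "M = mat (Suc ?\<mu>) (Suc ?\<mu>) (\<lambda>(i, j). if i < ?\<mu> then lookup (NF (f ^ j)) (ts ! i) else 0)"
  have M: "M \<in> carrier_mat (Suc ?\<mu>) (Suc ?\<mu>)" by (simp add: M_def)
  have "transpose_mat M *\<^sub>v unit_vec (Suc ?\<mu>) ?\<mu> = 0\<^sub>v (Suc ?\<mu>)"
    by (intro eq_vecI) (auto simp: M_def)
  moreover have "unit_vec (Suc ?\<mu>) ?\<mu> \<noteq> (0\<^sub>v (Suc ?\<mu>) :: 'k vec)" by simp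
  ultimately have "det (transpose_mat M) = 0"
    using det_0_iff_vec_prod_zero_field[OF transpose_carrier_mat[THEN iffD2, OF M]] unit_vec_carrier by blast
  then have "det M = 0" using det_transpose[OF M] by simp
  then obtain v where v: "v \<in> carrier_vec (Suc ?\<mu>)" "v \<noteq> 0\<^sub>v (Suc ?\<mu>)" "M *\<^sub>v v = 0\<^sub>v (Suc ?\<mu>)"
    using det_0_iff_vec_prod_zero_field[OF M] by blast
  let ?h = "\<Sum>j\<le>?\<mu>. pconst (v $ j) * f ^ j"
  have h: "?h \<in> polys n" using f by auto
  have NFh: "NF ?h = (\<Sum>j\<le>?\<mu>. pconst (v $ j) * NF (f ^ j))"
    using f by (simp add: NF_sum NF_scale)
  have "lookup (NF ?h) t = 0" for t
  proof (cases "t \<in> B")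
    case True
    then obtain i where i: "i < ?\<mu>" "t = ts ! i" using ts len by (metis in_set_conv_nth)
    have "(M *\<^sub>v v) $ i = (\<Sum>j\<le>?\<mu>. v $ j * lookup (NF (f ^ j)) t)"
      using i v(1) by (simp add: M_def scalar_prod_def atLeast0LessThan lessThan_Suc_atMost mult.commute del: sum.lessThan_Suc)
    then show ?thesis using v(3) i by (simp add: NFh lookup_sum lookup_pconst_mult)
  next
    case False
    then show ?thesis using NF_keys[OF h] by (auto simp: in_keys_iff)
  qed
  then have "NF ?h = 0" by (intro poly_mapping_eqI) simp
  then have "?h \<in> I" using NF_0_iff[OF h] by simp
  moreover obtain j where "j \<le> ?\<mu>" "v $ j \<noteq> 0"
  proof -
    have "\<exists>j<Suc ?\<mu>. v $ j \<noteq> 0"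
    proof (rule ccontr)
      assume "\<not> ?thesis"
      then have "v = 0\<^sub>v (Suc ?\<mu>)" using v(1) by (intro eq_vecI) auto
      then show False using v(2) by simp
    qed
    then show ?thesis using that by (auto simp: less_Suc_eq_le)
  qed
  ultimately show ?thesis by (intro exI[of _ "\<lambda>j. v $ j"]) auto
qed

lemma one_notin: "0 \<in> B \<Longrightarrow> 1 \<notin> I"
  using indep[of 1] by auto

text \<open>An integral domain that is algebraic over a field is itself a field. In terms of ideals: let an ideal \<open>J\<close>
contain a prime \<open>\<pp>\<close> and some \<open>f \<notin> \<pp>\<close>. Cancelling the lowest power \<open>f\<^sup>m\<close> from an algebraic relation leaves an
element of \<open>\<pp>\<close> with nonzero constant term \<open>c\<^sub>m\<close> and all other terms divisible by \<open>f\<close>, so \<open>c\<^sub>m \<in> J\<close> and \<open>J\<close> is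
the whole ring.\<close>

lemma zero_dimensional:
  assumes "0 \<in> B"
  shows "zero_dimensional n I"
  unfolding zero_dimensional_def
proof (intro conjI allI impI)
  show "ideal I (aff_ring n)" by (rule ideal)
  show "I \<noteq> polys n" using one_notin[OF assms] by auto
next
  interpret A: aff_ideal n I using ideal by (rule aff_ideal.intro)
  interpret R: cring "coord_ring n I" by (rule A.coord_cring)
  fix \<pp> assume \<pp>: "primeideal \<pp> (coord_ring n I)"
  then interpret \<pp>: primeideal \<pp> "coord_ring n I" .
  define Q where "Q = {f \<in> polys n. residue n I f \<in> \<pp>}"
  have Qideal: "ideal Q (aff_ring n)"
    unfolding Q_def using ring_hom_ring.ideal_vimage[OF A.residue_ring_hom \<pp>.is_ideal] .
  have IQ: "I \<subseteq> Q"
  proof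
    fix f assume "f \<in> I"
    then have "residue n I f = residue n I 0" "f \<in> polys n"
      using A.residue_eq_iff[of f 0] ideal_closed(1) by auto
    then show "f \<in> Q" using \<pp>.zero_closed by (simp add: Q_def A.residue_0)
  qed
  have Qprime: "g \<in> Q \<or> h \<in> Q" if "g \<in> polys n" "h \<in> polys n" "g * h \<in> Q" for g h
    using that \<pp>.I_prime[of "residue n I g" "residue n I h"] A.residue_closed
    by (auto simp: Q_def A.residue_simps)
  have Q1: "1 \<notin> Q"
    using \<pp>.one_imp_carrier \<pp>.I_notcarr by (auto simp: Q_def A.residue_1)
  show "maximalideal \<pp> (coord_ring n I)"
  proof (rule maximalidealI[OF \<pp>.is_ideal])
    show "carrier (coord_ring n I) \<noteq> \<pp>" by (rule \<pp>.I_notcarr)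
    fix J assume J: "ideal J (coord_ring n I)" "\<pp> \<subseteq> J" "J \<subseteq> carrier (coord_ring n I)"
    show "J = \<pp> \<or> J = carrier (coord_ring n I)"
    proof (rule disjCI)
      assume "J \<noteq> carrier (coord_ring n I)"
      interpret J: ideal J "coord_ring n I" by fact
      define J' where "J' = {f \<in> polys n. residue n I f \<in> J}"
      have J'ideal: "ideal J' (aff_ring n)"
        unfolding J'_def using ring_hom_ring.ideal_vimage[OF A.residue_ring_hom J.is_ideal] .
      note J'c = mpoly_ideal_closed[OF J'ideal]
      have QJ: "Q \<subseteq> J'" using J by (auto simp: Q_def J'_def)
      have J1: "1 \<notin> J'" using \<open>J \<noteq> carrier (coord_ring n I)\<close> J.one_imp_carrier
        by (auto simp: J'_def A.residue_1)
      have "x \<in> \<pp>" if xJ: "x \<in> J" for x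
      proof (rule ccontr)
        assume "x \<notin> \<pp>"
        obtain f where f: "f \<in> polys n" "x = residue n I f"
          using J.Icarr[OF xJ] unfolding A.coord_carrier by auto
        have fJ: "f \<in> J'" and fQ: "f \<notin> Q" using f xJ \<open>x \<notin> \<pp>\<close> by (auto simp: J'_def Q_def)
        obtain c :: "nat \<Rightarrow> 'k" where c: "\<exists>j\<le>card B. c j \<noteq> 0" "(\<Sum>j\<le>card B. pconst (c j) * f ^ j) \<in> I"
          using algebraic_relation[OF f(1)] by blast
        define m where "m = (LEAST j. c j \<noteq> 0)"
        obtain j where j: "j \<le> card B" "c j \<noteq> 0" using c(1) by blast
        have m: "c m \<noteq> 0" "m \<le> card B"
          unfolding m_def using LeastI[of "\<lambda>j. c j \<noteq> 0", OF j(2)] Least_le[of "\<lambda>j. c j \<noteq> 0", OF j(2)] j(1)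
          by simp_all
        have m': "c j = 0" if "j < m" for j
          using not_less_Least[of j "\<lambda>j. c j \<noteq> 0"] that by (simp add: m_def)
        have "(\<Sum>j\<le>card B. pconst (c j) * f ^ j) = (\<Sum>j=m..card B. pconst (c j) * f ^ j)"
          using m' by (intro sum.mono_neutral_right) (auto simp: not_le)
        also have "\<dots> = f ^ m * (\<Sum>j=m..card B. pconst (c j) * f ^ (j - m))"
          unfolding sum_distrib_left
        proof (rule sum.cong)
          fix j assume "j \<in> {m..card B}"
          then have "f ^ j = f ^ m * f ^ (j - m)" by (simp flip: power_add)
          then show "pconst (c j) * f ^ j = f ^ m * (pconst (c j) * f ^ (j - m))" by (simp add: algebra_simps)
        qed simp
        finally have "f ^ m * (\<Sum>j=m..card B. pconst (c j) * f ^ (j - m)) \<in> Q"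
          using c(2) IQ by auto
        moreover have "f ^ k \<notin> Q" for k
        proof (induction k)
          case (Suc k)
          then show ?case using Qprime[OF f(1) mpoly_power_closed[OF f(1)], of k] fQ by auto
        qed (use Q1 in simp)
        ultimately have "(\<Sum>j=m..card B. pconst (c j) * f ^ (j - m)) \<in> J'"
          using Qprime[of "f ^ m" "\<Sum>j=m..card B. pconst (c j) * f ^ (j - m)"] f(1) QJ by auto
        also have "(\<Sum>j=m..card B. pconst (c j) * f ^ (j - m)) =
            pconst (c m) + (\<Sum>j=Suc m..card B. pconst (c j) * f ^ (j - m))"
          using m(2) by (subst sum.atLeast_Suc_atMost) auto
        finally have "pconst (c m) + (\<Sum>j=Suc m..card B. pconst (c j) * f ^ (j - m)) \<in> J'" .
        moreover have "(\<Sum>j=Suc m..card B. pconst (c j) * f ^ (j - m)) \<in> J'"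
        proof (rule mpoly_ideal_sum[OF J'ideal])
          fix j assume "j \<in> {Suc m..card B}"
          then have "j - m = Suc (j - Suc m)" by auto
          then have "pconst (c j) * f ^ (j - m) = (pconst (c j) * f ^ (j - Suc m)) * f"
            by (metis mult.assoc power_Suc2)
          then show "pconst (c j) * f ^ (j - m) \<in> J'"
            using J'c(7)[OF fJ, of "pconst (c j) * f ^ (j - Suc m)"] f by (simp only:) simp
        qed
        ultimately have "pconst (c m) \<in> J'" using J'c(4) by fastforce
        then have "pconst (1 / c m) * pconst (c m) \<in> J'" by (intro J'c(7)) auto
        then show False using J1 m(1) by (simp flip: pconst_mult)
      qed
      then show "J = \<pp>" using J(2) by (metis Set.equalityI Set.subsetI)
    qed
  qed
qed

end

section \<open>Multiplication matrices\<close>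

definition lin_comb :: "nat pterm list \<Rightarrow> (nat \<Rightarrow> 'k::field) \<Rightarrow> (nat, 'k) mpoly" where
  "lin_comb ts c = (\<Sum>i<length ts. pconst (c i) * pmonom (ts ! i))"

lemma lin_comb_cong: "(\<And>i. i < length ts \<Longrightarrow> c i = d i) \<Longrightarrow> lin_comb ts c = lin_comb ts d"
  by (simp add: lin_comb_def)

lemma lin_comb_unit: "j < length ts \<Longrightarrow> lin_comb ts (\<lambda>i. if i = j then 1 else 0) = pmonom (ts ! j)"
  by (simp add: lin_comb_def if_distrib[of "\<lambda>x. x * _"] if_distrib[of pconst] cong: if_cong)

lemma keys_lin_comb: "keys (lin_comb ts c) \<subseteq> set ts"
  unfolding lin_comb_def
proof (rule keys_sum_subset)
  fix i assume "i \<in> {..<length ts}"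
  then show "keys (pconst (c i) * pmonom (ts ! i)) \<subseteq> set ts"
    using keys_pconst_mult[of "c i" "pmonom (ts ! i)"] by auto
qed

lemma lookup_lin_comb:
  assumes "distinct ts" "i < length ts"
  shows "lookup (lin_comb ts c) (ts ! i) = c i"
proof -
  have "lookup (lin_comb ts c) (ts ! i) = (\<Sum>j<length ts. if j = i then c j else 0)"
    unfolding lin_comb_def lookup_sum using assms
    by (intro sum.cong) (auto simp: pconst_mult_pmonom lookup_single when_def nth_eq_iff_index_eq)
  then show ?thesis using assms by simp
qed

lemma lin_comb_lookup:
  assumes "distinct ts" "keys p \<subseteq> set ts"
  shows "lin_comb ts (\<lambda>i. lookup p (ts ! i)) = p"
proof (rule poly_mapping_eqI)
  fix t
  show "lookup (lin_comb ts (\<lambda>i. lookup p (ts ! i))) t = lookup p t"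
  proof (cases "t \<in> set ts")
    case True
    then show ?thesis using assms by (auto simp: in_set_conv_nth lookup_lin_comb)
  next
    case False
    then show ?thesis using assms keys_lin_comb by (metis in_keys_iff subsetD)
  qed
qed

lemma mult_unit_vec:
  fixes A :: "'a::semiring_1 mat"
  assumes "A \<in> carrier_mat m k" "j < k"
  shows "A *\<^sub>v unit_vec k j = col A j"
  using assms by (intro eq_vecI) auto

lemma term_mat_carrier:
  assumes "\<And>r. r < n \<Longrightarrow> M r \<in> carrier_mat \<mu> \<mu>"
  shows "term_mat n \<mu> M t \<in> carrier_mat \<mu> \<mu>"
proof -
  have "foldr (\<lambda>r N. (M r ^\<^sub>m lookup t r) * N) rs (1\<^sub>m \<mu>) \<in> carrier_mat \<mu> \<mu>"
    if "set rs \<subseteq> {..<n}" for rs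
    using that by (induction rs) (auto intro!: mult_carrier_mat pow_carrier_mat assms)
  from this[of "[0..<n]"] show ?thesis unfolding term_mat_def by (simp add: subset_iff)
qed

lemma term_mat_0:
  assumes "\<And>r. r < n \<Longrightarrow> M r \<in> carrier_mat m m"
  shows "term_mat n m M 0 = 1\<^sub>m m"
proof -
  have "foldr (\<lambda>r N. (M r ^\<^sub>m lookup 0 r) * N) rs (1\<^sub>m m) = 1\<^sub>m m" if "set rs \<subseteq> {..<n}" for rs
    using that
  proof (induction rs)
    case (Cons r rs)
    then have "M r \<in> carrier_mat m m" using assms by auto
    then show ?case using Cons by auto
  qed simp
  from this[of "[0..<n]"] show ?thesis by (simp add: term_mat_def subset_iff)
qed

lemma pow_mat_commute:
  assumes "A \<in> carrier_mat m m" "B \<in> carrier_mat m m" "A * B = B * (A :: 'a::semiring_1 mat)"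
  shows "A ^\<^sub>m k * B = B * A ^\<^sub>m k"
proof (induction k)
  case 0
  then show ?case using assms by simp
next
  case (Suc k)
  have P: "A ^\<^sub>m k \<in> carrier_mat m m" using assms by simp
  have "A ^\<^sub>m Suc k * B = A ^\<^sub>m k * (A * B)" using assms(1,2) P by (simp add: assoc_mult_mat[of _ m m _ m _ m])
  also have "\<dots> = A ^\<^sub>m k * B * A" unfolding assms(3) using assms(1,2) P by (simp add: assoc_mult_mat[of _ m m _ m _ m])
  also have "\<dots> = B * A ^\<^sub>m Suc k" using assms P Suc by (simp add: assoc_mult_mat[of _ m m _ m _ m])
  finally show ?case .
qed

text \<open>The factors of \<open>term_mat\<close> come in the order of the variables; the additional factor \<open>M s\<close> has to be moved
past those of the variables before \<open>s\<close>.\<close>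

lemma term_mat_tvar_add:
  fixes M :: "nat \<Rightarrow> 'a::semiring_1 mat"
  assumes M: "\<And>r. r < n \<Longrightarrow> M r \<in> carrier_mat \<mu> \<mu>"
    and comm: "\<And>r s. r < n \<Longrightarrow> s < n \<Longrightarrow> M r * M s = M s * M r"
    and s: "s < n"
  shows "term_mat n \<mu> M (tvar s + t) = M s * term_mat n \<mu> M t"
proof -
  let ?F = "\<lambda>t rs. foldr (\<lambda>r N. (M r ^\<^sub>m lookup t r) * N) rs (1\<^sub>m \<mu>)"
  have C: "?F t rs \<in> carrier_mat \<mu> \<mu>" if "set rs \<subseteq> {..<n}" for rs t
    using that by (induction rs) (auto intro!: mult_carrier_mat pow_carrier_mat M)
  have "?F (tvar s + t) rs = (if s \<in> set rs then M s * ?F t rs else ?F t rs)"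
    if "distinct rs" "set rs \<subseteq> {..<n}" for rs
    using that
  proof (induction rs)
    case (Cons r rs)
    have r: "M r \<in> carrier_mat \<mu> \<mu>" "M s \<in> carrier_mat \<mu> \<mu>" using Cons M s by auto
    note Ct = C[of rs t]
    have Crs: "?F t rs \<in> carrier_mat \<mu> \<mu>" using Cons by (intro C) auto
    show ?case
    proof (cases "r = s")
      case True
      have "M s ^\<^sub>m Suc k * N = M s * (M s ^\<^sub>m k * N)" if "N \<in> carrier_mat \<mu> \<mu>" for k N
      proof -
        have "M s ^\<^sub>m Suc k * N = (M s * M s ^\<^sub>m k) * N"
          using pow_mat_commute[of "M s" \<mu> "M s" k] r by simp
        also have "\<dots> = M s * (M s ^\<^sub>m k * N)"
          using r that by (intro assoc_mult_mat) auto
        finally show ?thesis .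
      qed
      then show ?thesis using Cons True Crs by (simp add: lookup_add tvar_def)
    next
      case False
      have "M r ^\<^sub>m k * (M s * N) = M s * (M r ^\<^sub>m k * N)" if "N \<in> carrier_mat \<mu> \<mu>" for k N
      proof -
        have "M r ^\<^sub>m k * (M s * N) = (M r ^\<^sub>m k * M s) * N"
          using r that by (intro assoc_mult_mat[symmetric]) auto
        also have "\<dots> = (M s * M r ^\<^sub>m k) * N"
          using pow_mat_commute[of "M r" \<mu> "M s" k] r Cons.prems s by (simp add: comm)
        also have "\<dots> = M s * (M r ^\<^sub>m k * N)"
          using r that by (intro assoc_mult_mat) auto
        finally show ?thesis .
      qed
      then show ?thesis using Cons False Crs by (auto simp: lookup_add tvar_def lookup_single)
    qed
  qed auto
  from this[of "[0..<n]"] show ?thesis using s by (simp add: term_mat_def subset_iff)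
qed

text \<open>This is the product that \<open>term_mat\<close> imitates, with the same order of the factors.\<close>

lemma pmonom_eq_prod_list:
  assumes "t \<in> terms_in {..<n}"
  shows "(pmonom t :: (nat, 'k::comm_ring_1) mpoly) = prod_list (map (\<lambda>r. pvar r ^ lookup t r) [0..<n])"
proof -
  have power: "(pvar r :: (nat, 'k) mpoly) ^ k = pmonom (Poly_Mapping.single r k)" for r k
  proof (induction k)
    case (Suc k)
    then show ?case by (simp add: pvar_def tvar_def pmonom_mult flip: single_add)
  qed simp
  have "prod_list (map (\<lambda>r. pvar r ^ lookup t r) rs) =
      (pmonom (\<Sum>r\<leftarrow>rs. Poly_Mapping.single r (lookup t r)) :: (nat, 'k) mpoly)" for rs
    by (induction rs) (auto simp: power pmonom_mult)
  moreover have "(\<Sum>r\<leftarrow>[0..<n]. Poly_Mapping.single r (lookup t r)) = t"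
  proof (rule poly_mapping_eqI)
    fix x
    have "lookup (\<Sum>r\<leftarrow>[0..<n]. Poly_Mapping.single r (lookup t r)) x =
        (\<Sum>r<n. if r = x then lookup t r else 0)"
      by (simp add: interv_sum_list_conv_sum_set_nat lookup_sum lookup_single when_def atLeast0LessThan)
    also have "\<dots> = lookup t x"
      using assms by (auto simp: terms_in_def in_keys_iff subset_iff)
    finally show "lookup (\<Sum>r\<leftarrow>[0..<n]. Poly_Mapping.single r (lookup t r)) x =
      lookup t x" .
  qed
  ultimately show ?thesis by metis
qed

text \<open>The condition on the columns determines the matrices: \<open>M r\<close> describes multiplication by \<open>x\<^sub>r\<close> on \<open>P / I\<close> in
coordinates with respect to the terms \<open>ts\<close>.\<close>

locale mult_matrices = term_basis n "set ts" I rel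
  for n :: nat and ts :: "nat pterm list" and I :: "(nat, 'k::field) mpoly set" and rel +
  fixes M :: "nat \<Rightarrow> 'k mat"
  assumes distinct: "distinct ts"
    and M_carrier: "r < n \<Longrightarrow> M r \<in> carrier_mat (length ts) (length ts)"
    and M_col: "r < n \<Longrightarrow> j < length ts \<Longrightarrow>
      pmonom (tvar r + ts ! j) - lin_comb ts (\<lambda>i. M r $$ (i, j)) \<in> I"
begin

definition coords :: "(nat, 'k) mpoly \<Rightarrow> 'k vec" where
  "coords f = vec (length ts) (\<lambda>i. lookup (NF f) (ts ! i))"

lemma coords_carrier [simp]: "coords f \<in> carrier_vec (length ts)" "dim_vec (coords f) = length ts"
  by (simp_all add: coords_def)

lemma NF_eq_lin_comb: "f \<in> polys n \<Longrightarrow> NF f = lin_comb ts (\<lambda>i. coords f $ i)"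
  using lin_comb_lookup[OF distinct NF_keys, of f] by (simp add: coords_def lin_comb_def)

lemma coords_pmonom:
  assumes "j < length ts"
  shows "coords (pmonom (ts ! j)) = unit_vec (length ts) j"
proof -
  have "NF (pmonom (ts ! j)) = pmonom (ts ! j)" using assms by (intro NF_id) simp
  then show ?thesis using assms distinct
    by (intro eq_vecI) (auto simp: coords_def pmonom_def lookup_single when_def nth_eq_iff_index_eq)
qed

lemma coords_mult_pvar:
  assumes f: "f \<in> polys n" and r: "r < n"
  shows "coords (pvar r * f) = M r *\<^sub>v coords f"
proof (rule eq_vecI)
  fix i assume "i < dim_vec (M r *\<^sub>v coords f)"
  then have i: "i < length ts" using M_carrier[OF r] by simp
  have col: "NF (pvar r * pmonom (ts ! j)) = lin_comb ts (\<lambda>i. M r $$ (i, j))" if "j < length ts" for j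
    using that r B_terms M_col[OF r that] keys_lin_comb
    by (intro NF_unique) (auto simp: pvar_def pmonom_mult subset_iff)
  have "NF (pvar r * f) = NF (pvar r * NF f)" using f r by (intro NF_mult_NF[symmetric]) auto
  also have "pvar r * NF f = (\<Sum>j<length ts. pconst (coords f $ j) * (pvar r * pmonom (ts ! j)))"
    using f by (simp add: NF_eq_lin_comb lin_comb_def sum_distrib_left algebra_simps)
  also have "NF \<dots> = (\<Sum>j<length ts. pconst (coords f $ j) * lin_comb ts (\<lambda>i. M r $$ (i, j)))"
  proof -
    have car: "pvar r * pmonom (ts ! j) \<in> polys n" if "j < length ts" for j
      using that B_terms r by (auto simp: subset_iff)
    have "NF (\<Sum>j<length ts. pconst (coords f $ j) * (pvar r * pmonom (ts ! j)))
        = (\<Sum>j<length ts. pconst (coords f $ j) * NF (pvar r * pmonom (ts ! j)))"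
      by (subst NF_sum) (auto simp only: lessThan_iff intro!: mpoly_mult_closed[OF pconst_closed] car sum.cong NF_scale)
    then show ?thesis by (simp add: col)
  qed
  finally have "coords (pvar r * f) $ i = (\<Sum>j<length ts. coords f $ j * M r $$ (i, j))"
    using i by (simp add: coords_def lookup_sum lookup_pconst_mult lookup_lin_comb distinct)
  then show "coords (pvar r * f) $ i = (M r *\<^sub>v coords f) $ i"
    using i M_carrier[OF r] by (simp add: scalar_prod_def atLeast0LessThan mult.commute)
qed (use M_carrier[OF r] in auto)

lemma coords_mult_power:
  assumes f: "f \<in> polys n" and r: "r < n"
  shows "coords (pvar r ^ k * f) = M r ^\<^sub>m k *\<^sub>v coords f"
  using f
proof (induction k arbitrary: f)
  case 0
  then show ?case using M_carrier[OF r] by simp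
next
  case (Suc k)
  have "coords (pvar r ^ Suc k * f) = coords (pvar r ^ k * (pvar r * f))" by (simp add: algebra_simps)
  also have "\<dots> = M r ^\<^sub>m k *\<^sub>v (M r *\<^sub>v coords f)" using Suc r by (simp add: coords_mult_pvar)
  also have "\<dots> = M r ^\<^sub>m Suc k *\<^sub>v coords f"
    using M_carrier[OF r] by (simp add: assoc_mult_mat_vec[of _ "length ts" "length ts" _ "length ts"])
  finally show ?case .
qed

lemma coords_mult_pmonom:
  assumes f: "f \<in> polys n" and t: "t \<in> terms_in {..<n}"
  shows "coords (pmonom t * f) = term_mat n (length ts) M t *\<^sub>v coords f"
proof -
  let ?F = "\<lambda>rs. foldr (\<lambda>r N. (M r ^\<^sub>m lookup t r) * N) rs (1\<^sub>m (length ts))"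
  have C: "?F rs \<in> carrier_mat (length ts) (length ts)" if "set rs \<subseteq> {..<n}" for rs
    using that by (induction rs) (auto intro!: mult_carrier_mat pow_carrier_mat M_carrier)
  have "prod_list (map (\<lambda>r. pvar r ^ lookup t r) rs) * f \<in> polys n \<and>
    coords (prod_list (map (\<lambda>r. pvar r ^ lookup t r) rs) * f) = ?F rs *\<^sub>v coords f"
    if "set rs \<subseteq> {..<n}" for rs
    using that
  proof (induction rs)
    case (Cons r rs)
    have "M r ^\<^sub>m lookup t r * ?F rs *\<^sub>v coords f = M r ^\<^sub>m lookup t r *\<^sub>v (?F rs *\<^sub>v coords f)"
      using Cons.prems M_carrier C[of rs] by (intro assoc_mult_mat_vec[of _ "length ts" "length ts" _ "length ts"]) auto
    then show ?case using Cons by (simp add: mult.assoc coords_mult_power)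
  qed (use f in auto)
  from this[of "[0..<n]"] show ?thesis
    using t by (simp add: term_mat_def subset_iff flip: pmonom_eq_prod_list)
qed

text \<open>Both products describe multiplication by \<open>x\<^sub>r x\<^sub>s\<close>. So the coefficients of a border basis satisfy the
equations of the border basis scheme.\<close>

lemma M_commute:
  assumes "r < n" "s < n"
  shows "M r * M s = M s * M r"
proof -
  have col_eq: "col (M r * M s) j = coords (pvar r * (pvar s * pmonom (ts ! j)))"
    if "r < n" "s < n" "j < length ts" for r s j
  proof -
    have "col (M r * M s) j = M r *\<^sub>v (M s *\<^sub>v unit_vec (length ts) j)"
      using that M_carrier[of r] M_carrier[of s]
      by (auto simp: col_mult2[of _ "length ts" "length ts" _ "length ts"] mult_unit_vec)
    also have "unit_vec (length ts) j = coords (pmonom (ts ! j))" using that by (simp add: coords_pmonom)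
    finally show ?thesis using that B_terms by (simp add: coords_mult_pvar subset_iff)
  qed
  show ?thesis
  proof (rule mat_col_eqI)
    fix j assume "j < dim_col (M s * M r)"
    then have j: "j < length ts" using assms M_carrier[of r] by simp
    show "col (M r * M s) j = col (M s * M r) j"
      using col_eq[OF assms j] col_eq[OF assms(2,1) j] by (simp add: algebra_simps)
  qed (use assms M_carrier[of r] M_carrier[of s] in auto)
qed

end

section \<open>Border bases and rational points of the border basis scheme\<close>

text \<open>The value of the generic multiplication matrix at the point \<open>\<Gamma>\<close>.\<close>

definition point_mat :: "nat pterm list \<Rightarrow> nat pterm list \<Rightarrow> 'k::field mat \<Rightarrow> nat \<Rightarrow> 'k mat" where
  "point_mat ts bs \<Gamma> r = mat (length ts) (length ts) (\<lambda>(i, j).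
     if tvar r + ts ! j \<in> set ts then (if ts ! i = tvar r + ts ! j then 1 else 0)
     else \<Gamma> $$ (i, THE m. m < length bs \<and> bs ! m = tvar r + ts ! j))"

lemma point_mat_carrier [simp]: "point_mat ts bs \<Gamma> r \<in> carrier_mat (length ts) (length ts)"
  and point_mat_dims [simp]: "dim_row (point_mat ts bs \<Gamma> r) = length ts" "dim_col (point_mat ts bs \<Gamma> r) = length ts"
  by (simp_all add: point_mat_def)

definition df_point :: "nat pterm list \<Rightarrow> nat pterm list \<Rightarrow> 'k::field mat \<Rightarrow> bool" where
  "df_point ts bs \<Gamma> \<longleftrightarrow>
     (\<forall>i<length ts. \<forall>j<length bs. tdeg (bs ! j) < tdeg (ts ! i) \<longrightarrow> \<Gamma> $$ (i, j) = 0)"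

locale bordered_order_ideal =
  fixes n :: nat and ts bs :: "nat pterm list"
  assumes enum: "order_ideal_enum n ts bs"
begin

lemma distinct_ts: "distinct ts" and distinct_bs: "distinct bs"
  and sorted_ts: "sorted (map tdeg ts)"
  and ts_terms: "set ts \<subseteq> terms_in {..<n}" and ts_nonempty: "ts \<noteq> []"
  and set_bs: "set bs = border n (set ts)"
  using enum by (auto simp: order_ideal_enum_def order_ideal_def)

lemma ts_nth_terms [simp]: "i < length ts \<Longrightarrow> ts ! i \<in> terms_in {..<n}"
  using ts_terms by auto

lemma divisor_in_ts: "s \<in> terms_in {..<n} \<Longrightarrow> u \<in> terms_in {..<n} \<Longrightarrow> s + u \<in> set ts \<Longrightarrow> s \<in> set ts"
  using enum by (auto simp: order_ideal_enum_def order_ideal_def)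

lemma zero_in_ts: "0 \<in> set ts"
proof -
  have "0 + hd ts \<in> set ts" "hd ts \<in> terms_in {..<n}" using ts_nonempty ts_terms by auto
  then show ?thesis using divisor_in_ts[of 0 "hd ts"] by simp
qed

lemma ts_0: "ts ! 0 = 0"
proof -
  obtain i where i: "i < length ts" "ts ! i = 0" using zero_in_ts by (metis in_set_conv_nth)
  have "map tdeg ts ! 0 \<le> map tdeg ts ! i"
    using sorted_nth_mono[OF sorted_ts, of 0 i] i by simp
  then have "tdeg (ts ! 0) \<le> tdeg (ts ! i)"
    using i ts_nonempty by (simp del: tdeg_eq_0_iff)
  then show ?thesis using i by simp
qed

lemma tdeg_le_last: "t \<in> set ts \<Longrightarrow> tdeg t \<le> tdeg (last ts)"
proof -
  assume "t \<in> set ts"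
  then obtain i where i: "i < length ts" "t = ts ! i" by (metis in_set_conv_nth)
  have "map tdeg ts ! i \<le> map tdeg ts ! (length ts - 1)"
    using i by (intro sorted_nth_mono[OF sorted_ts]) auto
  then show ?thesis using i ts_nonempty by (simp add: last_conv_nth)
qed

lemma step_cases:
  assumes "r < n" "t \<in> set ts"
  obtains "tvar r + t \<in> set ts"
  | m where "m < length bs" "bs ! m = tvar r + t" "tvar r + t \<notin> set ts"
proof (cases "tvar r + t \<in> set ts")
  case False
  then have "tvar r + t \<in> set bs" using assms by (auto simp: set_bs border_def)
  then show ?thesis using that(2) False by (metis in_set_conv_nth)
qed

lemma border_elem:
  assumes "m < length bs"
  obtains r j where "r < n" "j < length ts" "bs ! m = tvar r + ts ! j" "tvar r + ts ! j \<notin> set ts"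
proof -
  have "bs ! m \<in> border n (set ts)" using nth_mem[OF assms] set_bs by simp
  then obtain r t where rt: "r < n" "t \<in> set ts" "bs ! m = tvar r + t" "bs ! m \<notin> set ts"
    unfolding border_def by blast
  moreover obtain j where "j < length ts" "t = ts ! j" using rt(2) by (metis in_set_conv_nth)
  ultimately show ?thesis using that[of r j] by simp
qed

lemma bs_nth_terms [simp]:
  assumes "m < length bs"
  shows "bs ! m \<in> terms_in {..<n}"
  using assms by (rule border_elem) simp

lemma the_border_index:
  "m < length bs \<Longrightarrow> bs ! m = t \<Longrightarrow> (THE m. m < length bs \<and> bs ! m = t) = m"
  using distinct_bs by (intro the_equality) (auto simp: nth_eq_iff_index_eq)

lemma lin_comb_closed [simp]: "lin_comb ts c \<in> polys n"
  using keys_lin_comb[of ts c] ts_terms by (auto simp: carrier_mpoly_ring)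

lemma I_point_eq:
  "I_point n ts bs \<Gamma> = Idl\<^bsub>aff_ring n\<^esub> {pmonom (bs ! j) - lin_comb ts (\<lambda>i. \<Gamma> $$ (i, j)) | j. j < length bs}"
  by (simp add: I_point_def lin_comb_def)

lemma I_point_ideal: "ideal (I_point n ts bs \<Gamma>) (aff_ring n)"
  unfolding I_point_eq by (rule ring.genideal_ideal[OF mpoly_ring_ring]) auto

lemma border_poly_in_I_point:
  "j < length bs \<Longrightarrow> pmonom (bs ! j) - lin_comb ts (\<lambda>i. \<Gamma> $$ (i, j)) \<in> I_point n ts bs \<Gamma>"
  unfolding I_point_eq by (rule subsetD[OF ring.genideal_self[OF mpoly_ring_ring]]) auto

lemma I_point_minimal:
  assumes "ideal J (aff_ring n)" "\<And>j. j < length bs \<Longrightarrow> pmonom (bs ! j) - lin_comb ts (\<lambda>i. \<Gamma> $$ (i, j)) \<in> J"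
  shows "I_point n ts bs \<Gamma> \<subseteq> J"
  unfolding I_point_eq by (rule ring.genideal_minimal[OF mpoly_ring_ring assms(1)]) (use assms(2) in auto)

lemma point_mat_col_inner:
  assumes "j < length ts" "i < length ts" "tvar r + ts ! i = ts ! j" "k < length ts"
  shows "point_mat ts bs \<Gamma> r $$ (k, i) = (if k = j then 1 else 0)"
  using assms distinct_ts by (auto simp: point_mat_def nth_eq_iff_index_eq)

lemma point_mat_col_border:
  assumes "m < length bs" "i < length ts" "tvar r + ts ! i = bs ! m" "tvar r + ts ! i \<notin> set ts" "k < length ts"
  shows "point_mat ts bs \<Gamma> r $$ (k, i) = \<Gamma> $$ (k, m)"
  using assms by (auto simp: point_mat_def the_border_index)

lemma point_mat_reduces:
  assumes "ideal J (aff_ring n)" "\<And>j. j < length bs \<Longrightarrow> pmonom (bs ! j) - lin_comb ts (\<lambda>i. \<Gamma> $$ (i, j)) \<in> J"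
    and "r < n" "j < length ts"
  shows "pmonom (tvar r + ts ! j) - lin_comb ts (\<lambda>i. point_mat ts bs \<Gamma> r $$ (i, j)) \<in> J"
proof -
  have "ts ! j \<in> set ts" using assms(4) by simp
  from assms(3) this show ?thesis
  proof (cases rule: step_cases)
    case 1
    then obtain k where k: "k < length ts" "tvar r + ts ! j = ts ! k" by (metis in_set_conv_nth)
    have "lin_comb ts (\<lambda>i. point_mat ts bs \<Gamma> r $$ (i, j)) = lin_comb ts (\<lambda>i. if i = k then 1 else 0)"
      using k assms(4) by (intro lin_comb_cong point_mat_col_inner)
    then show ?thesis using k mpoly_ideal_closed(2)[OF assms(1)] by (simp add: lin_comb_unit)
  next
    case (2 m)
    have "lin_comb ts (\<lambda>i. point_mat ts bs \<Gamma> r $$ (i, j)) = lin_comb ts (\<lambda>i. \<Gamma> $$ (i, m))"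
      using 2 assms(4) by (intro lin_comb_cong point_mat_col_border) auto
    then show ?thesis using assms(2)[of m] 2 by simp
  qed
qed

text \<open>If \<open>t = x\<^sub>r s\<close>, then \<open>s\<close> reduces to a combination of order ideal terms \<open>u\<close> by induction. Each \<open>x\<^sub>r u\<close> is in the order
ideal or in its border, and \<open>df_point\<close> ensures that a border term is replaced by terms of at most its
degree.\<close>

lemma reduce_modulo_I_point:
  assumes df: "df_point ts bs \<Gamma>" and t: "t \<in> terms_in {..<n}"
  shows "\<exists>p. keys p \<subseteq> {s \<in> set ts. tdeg s \<le> tdeg t} \<and> pmonom t - p \<in> I_point n ts bs \<Gamma>"
  using t
proof (induction "tdeg t" arbitrary: t)
  case 0
  then show ?case using zero_in_ts mpoly_ideal_closed(2)[OF I_point_ideal]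
    by (intro exI[of _ "pmonom 0"]) auto
next
  case (Suc d)
  let ?I = "I_point n ts bs \<Gamma>"
  note Ic = mpoly_ideal_closed[OF I_point_ideal[of \<Gamma>]]
  have "t \<noteq> 0" using Suc by auto
  then obtain r s where rs: "r < n" "s \<in> terms_in {..<n}" "t = tvar r + s"
    using term_decompose[OF Suc.prems] by (metis lessThan_iff)
  have "tdeg s = d" using rs Suc.hyps(2) by (simp add: tdeg_add)
  then obtain q where q: "keys q \<subseteq> {s \<in> set ts. tdeg s \<le> d}" "pmonom s - q \<in> ?I"
    using Suc.hyps(1) rs(2) by blast
  have "\<exists>p. keys p \<subseteq> {s \<in> set ts. tdeg s \<le> tdeg t} \<and> pmonom (tvar r + u) - p \<in> ?I"
    if "u \<in> keys q" for u
  proof -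
    have u: "u \<in> set ts" "tdeg u \<le> d" using that q by auto
    then have deg: "tdeg (tvar r + u) \<le> tdeg t" using Suc.hyps(2) by (simp add: tdeg_add)
    from rs(1) u(1) show ?thesis
    proof (cases rule: step_cases)
      case 1
      then show ?thesis using deg Ic(2) by (intro exI[of _ "pmonom (tvar r + u)"]) auto
    next
      case (2 m)
      have "keys (lin_comb ts (\<lambda>i. \<Gamma> $$ (i, m))) \<subseteq> {s \<in> set ts. tdeg s \<le> tdeg t}"
      proof
        fix v assume v: "v \<in> keys (lin_comb ts (\<lambda>i. \<Gamma> $$ (i, m)))"
        then have "v \<in> set ts" using keys_lin_comb by blast
        then obtain i where i: "i < length ts" "v = ts ! i" by (auto simp: in_set_conv_nth)
        then have "\<Gamma> $$ (i, m) \<noteq> 0" using v by (simp add: in_keys_iff lookup_lin_comb distinct_ts)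
        then have "tdeg v \<le> tdeg (bs ! m)" using df i 2(1) unfolding df_point_def by (metis not_le)
        then show "v \<in> {s \<in> set ts. tdeg s \<le> tdeg t}" using i 2 deg by auto
      qed
      then show ?thesis using border_poly_in_I_point[OF 2(1), of \<Gamma>] 2(2) by auto
    qed
  qed
  then have "\<forall>u\<in>keys q. \<exists>p. keys p \<subseteq> {s \<in> set ts. tdeg s \<le> tdeg t}
      \<and> pmonom (tvar r + u) - p \<in> ?I"
    by (rule ballI)
  from bchoice[OF this] obtain P where P: "\<forall>u\<in>keys q.
      keys (P u) \<subseteq> {s \<in> set ts. tdeg s \<le> tdeg t} \<and> pmonom (tvar r + u) - P u \<in> ?I"
    by (rule exE)
  let ?p = "\<Sum>u\<in>keys q. pconst (lookup q u) * P u"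
  have "keys ?p \<subseteq> {s \<in> set ts. tdeg s \<le> tdeg t}"
  proof (rule keys_sum_subset)
    fix u assume "u \<in> keys q"
    then show "keys (pconst (lookup q u) * P u) \<subseteq> {s \<in> set ts. tdeg s \<le> tdeg t}"
      using bspec[OF P, of u] keys_pconst_mult[of "lookup q u" "P u"] by blast
  qed
  moreover have "pmonom t - ?p \<in> ?I"
  proof -
    have "pvar r * q = (\<Sum>u\<in>keys q. pconst (lookup q u) * pmonom (tvar r + u))"
      by (subst (1) poly_expand[of q]) (simp add: sum_distrib_left pvar_def mult.left_commute flip: pmonom_mult)
    then have eq: "pmonom t - ?p = pvar r * (pmonom s - q) +
        (\<Sum>u\<in>keys q. pconst (lookup q u) * (pmonom (tvar r + u) - P u))"
      by (simp add: rs(3) pvar_def pmonom_mult sum_subtractf algebra_simps)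
    show ?thesis
      unfolding eq
    proof (rule Ic(3))
      show "pvar r * (pmonom s - q) \<in> ?I" using q(2) rs(1) by (intro Ic(7)) auto
      show "(\<Sum>u\<in>keys q. pconst (lookup q u) * (pmonom (tvar r + u) - P u)) \<in> ?I"
        using P by (intro mpoly_ideal_sum[OF I_point_ideal] Ic(7)) auto
    qed
  qed
  ultimately show ?case by blast
qed

end

locale commuting_point = bordered_order_ideal +
  fixes \<Gamma> :: "'k::field mat"
  assumes commute: "r < n \<Longrightarrow> s < n \<Longrightarrow>
    point_mat ts bs \<Gamma> r * point_mat ts bs \<Gamma> s = point_mat ts bs \<Gamma> s * point_mat ts bs \<Gamma> r"
begin

text \<open>The action of a term on the generator \<open>e\<^sub>1\<close> of the \<open>P\<close>-module \<open>K\<^sup>\<mu>\<close>; the generator has index \<open>0\<close>.\<close>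

definition term_vec :: "nat pterm \<Rightarrow> 'k vec" where
  "term_vec t = term_mat n (length ts) (point_mat ts bs \<Gamma>) t *\<^sub>v unit_vec (length ts) 0"

lemma term_vec_carrier [simp]: "term_vec t \<in> carrier_vec (length ts)" "dim_vec (term_vec t) = length ts"
  using term_mat_carrier[of n "point_mat ts bs \<Gamma>" "length ts" t] by (auto simp: term_vec_def)

lemma term_vec_tvar_add:
  assumes "r < n"
  shows "term_vec (tvar r + t) = point_mat ts bs \<Gamma> r *\<^sub>v term_vec t"
proof -
  have C: "term_mat n (length ts) (point_mat ts bs \<Gamma>) t \<in> carrier_mat (length ts) (length ts)"
    by (rule term_mat_carrier) simp
  have "term_vec (tvar r + t) =
      (point_mat ts bs \<Gamma> r * term_mat n (length ts) (point_mat ts bs \<Gamma>) t) *\<^sub>v unit_vec (length ts) 0"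
    unfolding term_vec_def by (subst term_mat_tvar_add) (use assms commute in auto)
  also have "\<dots> = point_mat ts bs \<Gamma> r *\<^sub>v term_vec t"
    unfolding term_vec_def using C by (intro assoc_mult_mat_vec[of _ "length ts" "length ts" _ "length ts"]) auto
  finally show ?thesis .
qed

text \<open>Every \<open>t\<^sub>j \<noteq> 1\<close> is a product \<open>x\<^sub>r t\<^sub>i\<close> within the order ideal, and column \<open>i\<close> of the matrix of \<open>x\<^sub>r\<close> is then \<open>e\<^sub>j\<close>.\<close>

lemma term_vec_ts:
  assumes "j < length ts"
  shows "term_vec (ts ! j) = unit_vec (length ts) j"
  using assms
proof (induction "tdeg (ts ! j)" arbitrary: j)
  case 0
  then have "ts ! j = ts ! 0" using ts_0 by simp
  then have "j = 0" using distinct_ts 0 ts_nonempty by (simp add: nth_eq_iff_index_eq)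
  then show ?case using ts_0 by (simp add: term_vec_def term_mat_0)
next
  case (Suc d)
  then have "ts ! j \<noteq> 0" by auto
  then obtain r s where rs: "r < n" "s \<in> terms_in {..<n}" "ts ! j = tvar r + s"
    using term_decompose[of "ts ! j"] Suc.prems by (metis lessThan_iff ts_nth_terms)
  then have "s + tvar r \<in> set ts" using Suc.prems by (metis add.commute nth_mem)
  then have "s \<in> set ts" using rs by (intro divisor_in_ts[of s "tvar r"]) auto
  then obtain i where i: "i < length ts" "s = ts ! i" by (metis in_set_conv_nth)
  have "d = tdeg (ts ! i)" using Suc.hyps(2) rs i by (simp add: tdeg_add)
  then have "term_vec (ts ! j) = point_mat ts bs \<Gamma> r *\<^sub>v unit_vec (length ts) i"
    using Suc.hyps(1)[OF _ i(1)] rs i by (simp add: term_vec_tvar_add)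
  also have "\<dots> = col (point_mat ts bs \<Gamma> r) i" using i by (intro mult_unit_vec[of _ "length ts"]) auto
  also have "\<dots> = unit_vec (length ts) j"
    using rs i Suc.prems by (intro eq_vecI) (auto simp: point_mat_col_inner[of j])
  finally show ?case .
qed

text \<open>The \<open>i\<close>-th coordinate of the action of \<open>f\<close> on \<open>e\<^sub>1\<close>.\<close>

definition point_functional :: "nat \<Rightarrow> (nat, 'k) mpoly \<Rightarrow> 'k" where
  "point_functional i f = (\<Sum>t\<in>keys f. lookup f t * term_vec t $ i)"

lemma point_functional_superset:
  "finite A \<Longrightarrow> keys f \<subseteq> A \<Longrightarrow>
    point_functional i f = (\<Sum>t\<in>A. lookup f t * term_vec t $ i)"
  unfolding point_functional_def by (intro sum.mono_neutral_left) (auto simp: in_keys_iff)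

lemma point_functional_0 [simp]: "point_functional i 0 = 0"
  by (simp add: point_functional_def)

lemma point_functional_add: "point_functional i (f + g) = point_functional i f + point_functional i g"
proof -
  let ?A = "keys f \<union> keys g"
  have "finite ?A" "keys (f + g) \<subseteq> ?A" by (simp_all add: keys_add)
  then show ?thesis
    using point_functional_superset[of ?A f i] point_functional_superset[of ?A g i]
      point_functional_superset[of ?A "f + g" i]
    by (simp add: lookup_add algebra_simps sum.distrib)
qed

lemma point_functional_scale: "point_functional i (pconst c * f) = c * point_functional i f"
  using point_functional_superset[of "keys f" "pconst c * f" i] keys_pconst_mult[of c f]
  by (simp add: lookup_pconst_mult point_functional_def sum_distrib_left mult.assoc)

lemma point_functional_diff: "point_functional i (f - g) = point_functional i f - point_functional i g"
  using point_functional_add[of i "f - g" g] by simp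

lemma point_functional_pmonom: "point_functional i (pmonom t) = term_vec t $ i"
  by (simp add: point_functional_def pmonom_def)

lemma point_functional_sum: "point_functional i (sum f A) = (\<Sum>j\<in>A. point_functional i (f j))"
  by (induction A rule: infinite_finite_induct) (auto simp: point_functional_add)

lemma point_functional_lin_comb:
  assumes "i < length ts"
  shows "point_functional i (lin_comb ts c) = c i"
proof -
  have "point_functional i (lin_comb ts c) = (\<Sum>j<length ts. c j * (if i = j then 1 else 0))"
    unfolding lin_comb_def using assms
    by (simp add: point_functional_sum point_functional_scale point_functional_pmonom term_vec_ts)
  also have "\<dots> = (\<Sum>j<length ts. if j = i then c j else 0)"
    by (intro sum.cong) auto
  finally have "point_functional i (lin_comb ts c) = (\<Sum>j<length ts. if j = i then c j else 0)" .
  then show ?thesis using assms by simp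
qed

lemma point_functional_mult_pvar:
  assumes "r < n" "i < length ts" "f \<in> polys n"
  shows "point_functional i (pvar r * f) =
    (\<Sum>j<length ts. point_mat ts bs \<Gamma> r $$ (i, j) * point_functional j f)"
  using assms(3)
proof (induction f rule: mpoly_induct)
  case (add p q)
  then show ?case by (simp add: distrib_left point_functional_add sum.distrib)
next
  case (monom c t)
  have "point_functional i (pvar r * (pconst c * pmonom t)) = c * term_vec (tvar r + t) $ i"
    by (simp add: pvar_def mult.left_commute pmonom_mult point_functional_scale point_functional_pmonom)
  also have "\<dots> = (\<Sum>j<length ts. point_mat ts bs \<Gamma> r $$ (i, j) * (c * term_vec t $ j))"
    using assms(1,2)
    by (simp only: term_vec_tvar_add) (simp add: scalar_prod_def atLeast0LessThan sum_distrib_left mult.left_commute)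
  finally show ?case by (simp add: point_functional_scale point_functional_pmonom)
qed simp

text \<open>This is the annihilator of \<open>e\<^sub>1\<close>.\<close>

lemma common_kernel_ideal:
  "ideal {f \<in> polys n. \<forall>i<length ts. point_functional i f = 0} (aff_ring n)"
    (is "ideal ?Z _")
proof (rule mpoly_idealI)
  have pvar: "pvar r * f \<in> ?Z" if "r < n" "f \<in> ?Z" for r f
    using that by (auto simp: point_functional_mult_pvar)
  have mon: "pmonom t * f \<in> ?Z" if "t \<in> terms_in {..<n}" "f \<in> ?Z" for t f
    using that(1)
  proof (induction "tdeg t" arbitrary: t)
    case 0
    then show ?case using that by simp
  next
    case (Suc d)
    then have "t \<noteq> 0" by auto
    then obtain r s where rs: "r < n" "s \<in> terms_in {..<n}" "t = tvar r + s"
      using term_decompose[OF Suc.prems] by (metis lessThan_iff)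
    then have "d = tdeg s" using Suc.hyps(2) by (simp add: tdeg_add)
    then have "pvar r * (pmonom s * f) \<in> ?Z" using Suc.hyps(1) rs by (intro pvar) auto
    then show ?case by (simp add: rs(3) pvar_def mult.assoc flip: pmonom_mult)
  qed
  fix p q assume q: "q \<in> ?Z"
  show "p * q \<in> ?Z" if p: "p \<in> polys n"
    using p
  proof (induction p rule: mpoly_induct)
    case (add p p')
    then show ?case by (simp add: distrib_right point_functional_add)
  next
    case (monom c t)
    have "pmonom t * q \<in> ?Z" using mon[OF monom.hyps q] .
    then show ?case by (simp add: mult.assoc point_functional_scale)
  qed simp
  assume p: "p \<in> ?Z"
  have "point_functional i (p + q) = 0" if "i < length ts" for i
  proof -
    have "point_functional i p = 0" "point_functional i q = 0"
      using that p q by blast+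
    then show ?thesis by (simp only: point_functional_add add_0)
  qed
  moreover have "p + q \<in> polys n" using p q by (intro mpoly_add_closed) blast+
  ultimately show "p + q \<in> ?Z" by blast
next
  show "0 \<in> ?Z" by simp
  show "?Z \<subseteq> polys n" by blast
qed

text \<open>The action of a border term \<open>b\<^sub>m = x\<^sub>r t\<^sub>j\<close> on \<open>e\<^sub>1\<close> is column \<open>j\<close> of the matrix of \<open>x\<^sub>r\<close>, which is column \<open>m\<close> of \<open>\<Gamma>\<close>.
This agrees with the action of \<open>\<Sum>\<^sub>i \<gamma>\<^sub>i\<^sub>m t\<^sub>i\<close>.\<close>

lemma I_point_in_kernel:
  assumes "f \<in> I_point n ts bs \<Gamma>" "i < length ts"
  shows "point_functional i f = 0"
proof -
  have "I_point n ts bs \<Gamma> \<subseteq> {f \<in> polys n. \<forall>i<length ts. point_functional i f = 0}"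
  proof (rule I_point_minimal[OF common_kernel_ideal])
    fix m assume m: "m < length bs"
    obtain r j where rj: "r < n" "j < length ts" "bs ! m = tvar r + ts ! j" "tvar r + ts ! j \<notin> set ts"
      using border_elem[OF m] .
    have "term_vec (bs ! m) = col (point_mat ts bs \<Gamma> r) j"
      using rj by (simp add: term_vec_tvar_add term_vec_ts mult_unit_vec[of _ "length ts"])
    then have "point_functional k (pmonom (bs ! m)) = \<Gamma> $$ (k, m)" if "k < length ts" for k
      using that rj point_mat_col_border[OF m rj(2), of r k]
      by (simp add: point_functional_pmonom)
    moreover have "point_functional k (lin_comb ts (\<lambda>i. \<Gamma> $$ (i, m))) = \<Gamma> $$ (k, m)" if "k < length ts" for k
      using that by (rule point_functional_lin_comb)
    ultimately show "pmonom (bs ! m) - lin_comb ts (\<lambda>i. \<Gamma> $$ (i, m))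
        \<in> {f \<in> polys n. \<forall>i<length ts. point_functional i f = 0}"
      using m by (simp add: point_functional_diff)
  qed
  then show ?thesis using assms by auto
qed

text \<open>Independence: the functionals vanish on \<open>I\<^sub>\<Gamma>\<close>, but they return the coefficients of a linear
combination of the \<open>t\<^sub>i\<close>.\<close>

theorem term_basis_I_point:
  assumes df: "df_point ts bs \<Gamma>"
  shows "term_basis n (set ts) (I_point n ts bs \<Gamma>) (\<le>)"
proof (rule term_basis.intro[OF I_point_ideal _ ts_terms])
  fix p assume p: "keys p \<subseteq> set ts" "p \<in> I_point n ts bs \<Gamma>"
  have "lookup p (ts ! i) = 0" if i: "i < length ts" for i
  proof -
    have "0 = point_functional i (lin_comb ts (\<lambda>i. lookup p (ts ! i)))"
      using I_point_in_kernel[OF p(2) i] lin_comb_lookup[OF distinct_ts p(1)] by simp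
    also have "\<dots> = lookup p (ts ! i)"
      using i by (rule point_functional_lin_comb)
    finally show ?thesis by simp
  qed
  then have "lin_comb ts (\<lambda>i. lookup p (ts ! i)) = 0" by (simp add: lin_comb_def)
  then show "p = 0" using lin_comb_lookup[OF distinct_ts p(1)] by simp
qed (use reduce_modulo_I_point[OF df] in auto)

end

context bordered_order_ideal
begin

lemma gen_mult_mat_carrier [simp]:
  "gen_mult_mat ts bs r \<in> carrier_mat (length ts) (length ts)"
  "dim_row (gen_mult_mat ts bs r) = length ts" "dim_col (gen_mult_mat ts bs r) = length ts"
  by (simp_all add: gen_mult_mat_def)

lemma gen_mult_mat_closed:
  assumes "r < n" "i < length ts" "j < length ts"
  shows "(gen_mult_mat ts bs r $$ (i, j) :: 'k::field cpoly) \<in> carrier (KC ts bs)"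
proof -
  from assms have "ts ! j \<in> set ts" by simp
  with assms(1) show ?thesis
  proof (cases rule: step_cases)
    case 1
    then show ?thesis using assms by (simp add: gen_mult_mat_def KC_def)
  next
    case (2 m)
    then have "(THE m. m < length bs \<and> bs ! m = tvar r + ts ! j) = m" by (intro the_border_index)
    then show ?thesis using assms 2 by (simp add: gen_mult_mat_def KC_def)
  qed
qed

lemma commutator_closed:
  assumes "r < n" "s < n"
  shows "elements_mat (gen_mult_mat ts bs r * gen_mult_mat ts bs s - gen_mult_mat ts bs s * gen_mult_mat ts bs r)
    \<subseteq> carrier (KC ts bs :: 'k::field cpoly ring)"
proof
  fix x :: "'k cpoly"
  assume "x \<in> elements_mat (gen_mult_mat ts bs r * gen_mult_mat ts bs s - gen_mult_mat ts bs s * gen_mult_mat ts bs r)"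
  then obtain i j where ij: "i < length ts" "j < length ts"
    and x: "x = (gen_mult_mat ts bs r * gen_mult_mat ts bs s - gen_mult_mat ts bs s * gen_mult_mat ts bs r) $$ (i, j)"
    by (auto dest!: elements_matD)
  have "x = (\<Sum>k<length ts. gen_mult_mat ts bs r $$ (i, k) * gen_mult_mat ts bs s $$ (k, j))
      - (\<Sum>k<length ts. gen_mult_mat ts bs s $$ (i, k) * gen_mult_mat ts bs r $$ (k, j))"
    using ij by (simp add: x scalar_prod_def atLeast0LessThan)
  also have "\<dots> \<in> carrier (KC ts bs)"
    unfolding KC_def
    by (intro mpoly_diff_closed mpoly_sum_closed mpoly_mult_closed gen_mult_mat_closed[unfolded KC_def])
      (use ij assms in auto)
  finally show "x \<in> carrier (KC ts bs)" .
qed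

lemma eval_gen_mult_mat:
  "map_mat (peval id (\<lambda>(i, j). \<Gamma> $$ (i, j))) (gen_mult_mat ts bs r) = point_mat ts bs \<Gamma> r"
  by (rule eq_matI) (simp_all add: gen_mult_mat_def point_mat_def)

lemma eval_commutator:
  fixes \<Gamma> :: "'k::field mat"
  shows "map_mat (peval id (\<lambda>(i, j). \<Gamma> $$ (i, j)))
    (gen_mult_mat ts bs r * gen_mult_mat ts bs s - gen_mult_mat ts bs s * gen_mult_mat ts bs r) =
    point_mat ts bs \<Gamma> r * point_mat ts bs \<Gamma> s - point_mat ts bs \<Gamma> s * point_mat ts bs \<Gamma> r"
proof -
  have eta: "(\<lambda>(i, j). \<Gamma> $$ (i, j)) = ($$) \<Gamma>" by auto
  interpret comm_ring_hom "peval id (($$) \<Gamma>)" by (rule peval_hom)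
  have "map_mat (peval id (($$) \<Gamma>)) (A - B) = map_mat (peval id (($$) \<Gamma>)) A - map_mat (peval id (($$) \<Gamma>)) B"
    if "A \<in> carrier_mat (length ts) (length ts)" "B \<in> carrier_mat (length ts) (length ts)" for A B
    using that by (intro eq_matI) (auto simp: hom_minus)
  then show ?thesis
    by (simp add: mult_carrier_mat[of _ "length ts" "length ts" _ "length ts"]
        mat_hom_mult[of _ "length ts" "length ts" _ "length ts"] eta eval_gen_mult_mat[of \<Gamma>, unfolded eta])
qed

lemma I_BB_ideal: "ideal (I_BB n ts bs) (KC ts bs)"
  unfolding I_BB_def KC_def
  by (rule ring.genideal_ideal[OF mpoly_ring_ring]) (use commutator_closed in \<open>auto simp: KC_def\<close>)

lemma I_df_ideal: "ideal (I_df ts bs) (KC ts bs)"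
  unfolding I_df_def KC_def by (rule ring.genideal_ideal[OF mpoly_ring_ring]) auto

lemma I_BBdf_ideal: "ideal (I_BBdf n ts bs) (KC ts bs)"
  unfolding I_BBdf_def
  by (rule ring.add_ideals[OF _ I_BB_ideal I_df_ideal]) (simp add: KC_def mpoly_ring_ring)

lemma rational_points_I_BBdf:
  fixes \<Gamma> :: "'k::field mat"
  shows "\<Gamma> \<in> rational_points ts bs (I_BBdf n ts bs) \<longleftrightarrow> \<Gamma> \<in> carrier_mat (length ts) (length bs) \<and>
    (\<forall>r<n. \<forall>s<n. point_mat ts bs \<Gamma> r * point_mat ts bs \<Gamma> s = point_mat ts bs \<Gamma> s * point_mat ts bs \<Gamma> r) \<and>
    df_point ts bs \<Gamma>"
proof -
  let ?e = "peval id (\<lambda>(i, j). \<Gamma> $$ (i, j)) :: 'k cpoly \<Rightarrow> 'k"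
  let ?C = "\<lambda>r s. gen_mult_mat ts bs r * gen_mult_mat ts bs s - gen_mult_mat ts bs s * gen_mult_mat ts bs r :: 'k cpoly mat"
  let ?N = "point_mat ts bs \<Gamma>"
  have each: "(\<forall>p\<in>elements_mat (?C r s). ?e p = 0) \<longleftrightarrow> ?N r * ?N s = ?N s * ?N r" for r s
  proof -
    have D: "?N r * ?N s - ?N s * ?N r \<in> carrier_mat (length ts) (length ts)"
      by (intro minus_carrier_mat mult_carrier_mat[of _ _ "length ts"]) auto
    have "(\<forall>p\<in>elements_mat (?C r s). ?e p = 0) \<longleftrightarrow> (\<forall>x\<in>elements_mat (map_mat ?e (?C r s)). x = 0)"
      by (simp only: elements_mat_map) blast
    also have "\<dots> \<longleftrightarrow> (\<forall>x\<in>elements_mat (?N r * ?N s - ?N s * ?N r). x = 0)"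
      by (simp only: eval_commutator)
    also have "\<dots> \<longleftrightarrow> (\<forall>i<length ts. \<forall>j<length ts. (?N r * ?N s - ?N s * ?N r) $$ (i, j) = 0)"
    proof (intro iffI allI impI ballI)
      fix i j assume "\<forall>x\<in>elements_mat (?N r * ?N s - ?N s * ?N r). x = 0" "i < length ts" "j < length ts"
      then show "(?N r * ?N s - ?N s * ?N r) $$ (i, j) = 0"
        using elements_matI[OF D, of i j] by blast
    next
      fix x assume *: "\<forall>i<length ts. \<forall>j<length ts. (?N r * ?N s - ?N s * ?N r) $$ (i, j) = 0"
        and "x \<in> elements_mat (?N r * ?N s - ?N s * ?N r)"
      from elements_matD[OF this(2)] obtain i j where "i < length ts" "j < length ts"
        "x = (?N r * ?N s - ?N s * ?N r) $$ (i, j)"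
        using D by (metis carrier_matD)
      then show "x = 0" using * by (simp only:)
    qed
    also have "\<dots> \<longleftrightarrow> ?N r * ?N s = ?N s * ?N r"
      by (auto simp: mat_eq_iff simp del: index_mult_mat(1))
    finally show ?thesis .
  qed
  have "(\<forall>p\<in>I_BB n ts bs. ?e p = 0) \<longleftrightarrow> (\<forall>p\<in>\<Union>r<n. \<Union>s<n. elements_mat (?C r s). ?e p = 0)"
    unfolding I_BB_def KC_def by (rule peval_vanishes_genideal) (use commutator_closed in \<open>auto simp: KC_def\<close>)
  also have "\<dots> \<longleftrightarrow> (\<forall>r<n. \<forall>s<n. \<forall>p\<in>elements_mat (?C r s). ?e p = 0)" by auto
  also have "\<dots> \<longleftrightarrow> (\<forall>r<n. \<forall>s<n. ?N r * ?N s = ?N s * ?N r)" by (simp only: each)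
  finally have BB: "(\<forall>p\<in>I_BB n ts bs. ?e p = 0) \<longleftrightarrow> (\<forall>r<n. \<forall>s<n. ?N r * ?N s = ?N s * ?N r)" .
  have "(\<forall>p\<in>I_df ts bs. ?e p = 0) \<longleftrightarrow>
     (\<forall>p\<in>{pvar (i, j) | i j. i < length ts \<and> j < length bs \<and> tdeg (ts ! i) > tdeg (bs ! j)}. ?e p = 0)"
    unfolding I_df_def KC_def by (rule peval_vanishes_genideal) auto
  also have "\<dots> \<longleftrightarrow> df_point ts bs \<Gamma>"
    unfolding df_point_def by fastforce
  finally have df: "(\<forall>p\<in>I_df ts bs. ?e p = 0) \<longleftrightarrow> df_point ts bs \<Gamma>" .
  have "(\<forall>p\<in>I_BBdf n ts bs. ?e p = 0) \<longleftrightarrow> (\<forall>p\<in>I_BB n ts bs. ?e p = 0) \<and> (\<forall>p\<in>I_df ts bs. ?e p = 0)"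
    unfolding I_BBdf_def KC_def
    by (rule peval_vanishes_sum_ideal) (use I_BB_ideal I_df_ideal in \<open>auto simp: KC_def\<close>)
  then show ?thesis unfolding rational_points_def using BB df by blast
qed

lemma I_point_term_basis:
  assumes "\<Gamma> \<in> rational_points ts bs (I_BBdf n ts bs :: 'k::field cpoly set)"
  shows "term_basis n (set ts) (I_point n ts bs \<Gamma>) (\<le>)"
proof -
  interpret commuting_point n ts bs \<Gamma>
    using assms rational_points_I_BBdf by unfold_locales auto
  show ?thesis using assms rational_points_I_BBdf by (intro term_basis_I_point) auto
qed

lemma border_normal_form:
  assumes "term_basis n (set ts) I rel" "j < length bs"
    and "pmonom (bs ! j) - lin_comb ts (\<lambda>i. \<Gamma> $$ (i, j)) \<in> I"
  shows "term_basis.NF (set ts) I rel (pmonom (bs ! j)) = lin_comb ts (\<lambda>i. \<Gamma> $$ (i, j))"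
  using assms(2,3) keys_lin_comb by (intro term_basis.NF_unique[OF assms(1)]) auto

text \<open>Column \<open>j\<close> of \<open>\<Gamma>\<close> is the normal form of \<open>b\<^sub>j\<close> modulo \<open>I\<^sub>\<Gamma>\<close>.\<close>

lemma I_point_inj: "inj_on (I_point n ts bs) (rational_points ts bs (I_BBdf n ts bs :: 'k::field cpoly set))"
proof (rule inj_onI)
  fix \<Gamma> \<Gamma>' :: "'k mat"
  assume *: "\<Gamma> \<in> rational_points ts bs (I_BBdf n ts bs)" "\<Gamma>' \<in> rational_points ts bs (I_BBdf n ts bs)"
    "I_point n ts bs \<Gamma> = I_point n ts bs \<Gamma>'"
  have dims: "\<Gamma> \<in> carrier_mat (length ts) (length bs)" "\<Gamma>' \<in> carrier_mat (length ts) (length bs)"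
    using * rational_points_I_BBdf by auto
  show "\<Gamma> = \<Gamma>'"
  proof (rule eq_matI)
    fix i j assume ij: "i < dim_row \<Gamma>'" "j < dim_col \<Gamma>'"
    then have "lin_comb ts (\<lambda>i. \<Gamma> $$ (i, j)) = lin_comb ts (\<lambda>i. \<Gamma>' $$ (i, j))"
      using border_normal_form[OF I_point_term_basis[OF *(1)] _ border_poly_in_I_point, of j]
        border_normal_form[OF I_point_term_basis[OF *(2)] _ border_poly_in_I_point, of j] dims *(3) by auto
    then show "\<Gamma> $$ (i, j) = \<Gamma>' $$ (i, j)"
      using lookup_lin_comb[OF distinct_ts, of i "\<lambda>i. \<Gamma> $$ (i, j)"]
        lookup_lin_comb[OF distinct_ts, of i "\<lambda>i. \<Gamma>' $$ (i, j)"] ij dims by simp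
  qed (use dims in auto)
qed

lemma mult_matrices_point:
  fixes \<Gamma> :: "'k::field mat"
  assumes "term_basis n (set ts) I rel"
    and "\<And>j. j < length bs \<Longrightarrow> pmonom (bs ! j) - lin_comb ts (\<lambda>i. \<Gamma> $$ (i, j)) \<in> I"
  shows "mult_matrices n ts I rel (point_mat ts bs \<Gamma>)"
  using assms(1) point_mat_reduces[OF term_basis.ideal[OF assms(1)] assms(2)] distinct_ts
  by (intro mult_matrices.intro mult_matrices_axioms.intro) auto

text \<open>Let the normal forms of the border terms modulo \<open>I\<close> be the columns of \<open>\<Gamma>\<close>. The resulting matrices
describe multiplication on \<open>P / I\<close>, so they commute. Then \<open>I\<^sub>\<Gamma> \<subseteq> I\<close>, and equality holds because the same
terms are a basis modulo both ideals.\<close>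

lemma I_point_surj:
  fixes I :: "(nat, 'k::field) mpoly set"
  assumes "term_basis n (set ts) I (\<le>)"
  shows "\<exists>\<Gamma>\<in>rational_points ts bs (I_BBdf n ts bs). I_point n ts bs \<Gamma> = I"
proof -
  interpret T: term_basis n "set ts" I "(\<le>)" by fact
  define \<Gamma> where "\<Gamma> = mat (length ts) (length bs) (\<lambda>(i, j). lookup (T.NF (pmonom (bs ! j))) (ts ! i))"
  have lc: "lin_comb ts (\<lambda>i. \<Gamma> $$ (i, j)) = T.NF (pmonom (bs ! j))" if "j < length bs" for j
  proof -
    have "lin_comb ts (\<lambda>i. \<Gamma> $$ (i, j)) = lin_comb ts (\<lambda>i. lookup (T.NF (pmonom (bs ! j))) (ts ! i))"
      using that by (intro lin_comb_cong) (simp add: \<Gamma>_def)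
    also have "\<dots> = T.NF (pmonom (bs ! j))"
      using that by (intro lin_comb_lookup distinct_ts T.NF_keys) simp
    finally show ?thesis .
  qed
  then have gens: "pmonom (bs ! j) - lin_comb ts (\<lambda>i. \<Gamma> $$ (i, j)) \<in> I" if "j < length bs" for j
    using that T.NF(2) by simp
  interpret M: mult_matrices n ts I "(\<le>)" "point_mat ts bs \<Gamma>"
    using T.term_basis_axioms gens by (rule mult_matrices_point)
  have "df_point ts bs \<Gamma>"
    unfolding df_point_def
  proof (intro allI impI)
    fix i j assume ij: "i < length ts" "j < length bs" "tdeg (bs ! j) < tdeg (ts ! i)"
    then have "ts ! i \<notin> keys (T.NF (pmonom (bs ! j)))"
      using T.NF(1)[of "pmonom (bs ! j)"] by (auto dest: subsetD)
    then show "\<Gamma> $$ (i, j) = 0" using ij by (simp add: \<Gamma>_def in_keys_iff)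
  qed
  moreover have "\<Gamma> \<in> carrier_mat (length ts) (length bs)" by (simp add: \<Gamma>_def)
  ultimately have \<Gamma>: "\<Gamma> \<in> rational_points ts bs (I_BBdf n ts bs)"
    using M.M_commute rational_points_I_BBdf by blast
  have sub: "I_point n ts bs \<Gamma> \<subseteq> I" using T.ideal gens by (rule I_point_minimal)
  interpret P: term_basis n "set ts" "I_point n ts bs \<Gamma>" "(\<le>)" using \<Gamma> by (rule I_point_term_basis)
  have "I \<subseteq> I_point n ts bs \<Gamma>"
  proof
    fix f assume f: "f \<in> I"
    then have fP: "f \<in> polys n" by (rule T.ideal_closed)
    have "f - P.NF f \<in> I" using P.NF(2)[OF fP] sub by auto
    then have "P.NF f \<in> I" using T.ideal_closed(4)[OF f, of "f - P.NF f"] by simp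
    then have "P.NF f = 0" using T.indep P.NF_keys[OF fP] by simp
    then show "f \<in> I_point n ts bs \<Gamma>" using P.NF_0_iff[OF fP] by simp
  qed
  then show ?thesis using \<Gamma> sub by blast
qed

end

section \<open>Images of rings under surjective homomorphisms\<close>

text \<open>This transports the ring axioms to structures whose elements are sets of representatives, such as the
associated graded ring or a ring of fractions.\<close>

lemma ring_of_surj_hom:
  assumes "cring R" "h \<in> Ring.ring_hom R S" "h ` carrier R = carrier S" "h \<zero>\<^bsub>R\<^esub> = \<zero>\<^bsub>S\<^esub>"
  shows "cring S"
proof -
  interpret R: cring R by fact
  have "ring (S\<lparr>carrier := h ` carrier R, zero := h \<zero>\<^bsub>R\<^esub>\<rparr>)"
    by (rule R.ring_hom_imp_img_ring[OF assms(2)])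
  then have "ring S" using assms(3,4) by simp
  then interpret S: ring S .
  show ?thesis
  proof (rule cring.intro[OF S.ring_axioms])
    show "comm_monoid S"
    proof (rule S.monoid_comm_monoidI)
      fix x y assume "x \<in> carrier S" "y \<in> carrier S"
      then obtain a b where "a \<in> carrier R" "b \<in> carrier R" "x = h a" "y = h b" unfolding assms(3)[symmetric] by blast
      then show "x \<otimes>\<^bsub>S\<^esub> y = y \<otimes>\<^bsub>S\<^esub> x"
        using ring_hom_mult[OF assms(2), of a b] ring_hom_mult[OF assms(2), of b a] R.m_comm[of a b] by simp
    qed
  qed
qed

lemma surj_hom_ideal_image:
  assumes h: "h \<in> Ring.ring_hom R S" and surj: "h ` carrier R = carrier S" and R: "ring R" and S: "ring S" and I: "ideal I R"
  shows "ideal (h ` I) S"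
proof -
  interpret R: ring R by fact
  interpret S: ring S by fact
  interpret I: ideal I R by fact
  interpret h: ring_hom_ring R S h using h R S by (intro ring_hom_ringI2)
  have Ic: "x \<in> carrier R" if "x \<in> I" for x using that I.Icarr by simp
  show ?thesis
  proof (rule idealI[OF S])
    show "subgroup (h ` I) (add_monoid S)"
    proof (rule S.add.subgroupI)
      show "h ` I \<subseteq> carrier S" using Ic by auto
      show "h ` I \<noteq> {}" using I.zero_closed by blast
      fix x assume "x \<in> h ` I"
      then obtain a where a: "a \<in> I" "x = h a" by blast
      then have "\<ominus>\<^bsub>S\<^esub> x = h (\<ominus>\<^bsub>R\<^esub> a)" using Ic by simp
      then show "\<ominus>\<^bsub>S\<^esub> x \<in> h ` I" using a I.a_inv_closed by blast
      fix y assume "y \<in> h ` I"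
      then obtain b where b: "b \<in> I" "y = h b" by blast
      have "x \<oplus>\<^bsub>S\<^esub> y = h (a \<oplus>\<^bsub>R\<^esub> b)" using a b Ic by simp
      then show "x \<oplus>\<^bsub>S\<^esub> y \<in> h ` I" using I.a_closed[OF a(1) b(1)] by blast
    qed
  next
    fix x a assume "a \<in> h ` I" "x \<in> carrier S"
    then obtain b y where b: "b \<in> I" "a = h b" "y \<in> carrier R" "x = h y" using surj by blast
    have "x \<otimes>\<^bsub>S\<^esub> a = h (y \<otimes>\<^bsub>R\<^esub> b)" "a \<otimes>\<^bsub>S\<^esub> x = h (b \<otimes>\<^bsub>R\<^esub> y)" using b Ic by simp_all
    then show "x \<otimes>\<^bsub>S\<^esub> a \<in> h ` I" "a \<otimes>\<^bsub>S\<^esub> x \<in> h ` I"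
      using I.I_l_closed[OF b(1,3)] I.I_r_closed[OF b(1,3)] by blast+
  qed
qed

section \<open>The associated graded ring\<close>

definition hcomp :: "nat \<Rightarrow> (nat, 'k::field) mpoly \<Rightarrow> (nat, 'k) mpoly" where
  "hcomp i f = (\<Sum>t\<in>{t \<in> keys f. tdeg t = i}. pconst (lookup f t) * pmonom t)"

lemma lookup_hcomp: "lookup (hcomp i f) t = (if tdeg t = i then lookup f t else 0)"
proof -
  have "lookup (hcomp i f) t =
      (\<Sum>s\<in>{s \<in> keys f. tdeg s = i}. if s = t then lookup f s else 0)"
    by (simp add: hcomp_def lookup_sum pconst_mult_pmonom lookup_single when_def)
  also have "\<dots> = (if tdeg t = i then lookup f t else 0)"
    by (subst sum.delta) (auto simp: in_keys_iff)
  finally show ?thesis .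
qed

lemma keys_hcomp: "keys (hcomp i f) = {t \<in> keys f. tdeg t = i}"
  by (auto simp: in_keys_iff lookup_hcomp split: if_splits)

lemma hcomp_closed [simp]: "f \<in> carrier (mpoly_ring X) \<Longrightarrow> hcomp i f \<in> carrier (mpoly_ring X)"
  by (auto simp: carrier_mpoly_ring keys_hcomp)

lemma hcomp_0 [simp]: "hcomp i 0 = 0"
  by (simp add: hcomp_def)

lemma hcomp_add: "hcomp i (f + g) = hcomp i f + hcomp i g"
  by (rule poly_mapping_eqI) (simp add: lookup_hcomp lookup_add)

lemma hcomp_sum: "hcomp i (sum f A) = (\<Sum>j\<in>A. hcomp i (f j))"
  by (induction A rule: infinite_finite_induct) (auto simp: hcomp_add)

lemma hcomp_homogeneous:
  "(\<And>t. t \<in> keys f \<Longrightarrow> tdeg t = j) \<Longrightarrow> hcomp i f = (if i = j then f else 0)"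
  by (rule poly_mapping_eqI) (auto simp: lookup_hcomp in_keys_iff)

lemma hcomp_hcomp: "hcomp i (hcomp j f) = (if i = j then hcomp j f else 0)"
  by (rule hcomp_homogeneous) (simp add: keys_hcomp)

lemma sum_hcomp:
  assumes "\<And>t. t \<in> keys f \<Longrightarrow> tdeg t \<le> d"
  shows "(\<Sum>i\<le>d. hcomp i f) = f"
  using assms by (intro poly_mapping_eqI) (auto simp: lookup_sum lookup_hcomp in_keys_iff)

lemma hcomp_mult: "hcomp k (f * g) = (\<Sum>i\<le>k. hcomp i f * hcomp (k - i) g)"
proof -
  define d where "d = k + Max (insert 0 (tdeg ` keys f)) + Max (insert 0 (tdeg ` keys g))"
  have "t \<in> keys f \<Longrightarrow> tdeg t \<le> d" for t
  proof -
    assume "t \<in> keys f"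
    then have "tdeg t \<le> Max (insert 0 (tdeg ` keys f))" by (intro Max_ge) auto
    then show ?thesis by (simp add: d_def)
  qed
  moreover have "t \<in> keys g \<Longrightarrow> tdeg t \<le> d" for t
  proof -
    assume "t \<in> keys g"
    then have "tdeg t \<le> Max (insert 0 (tdeg ` keys g))" by (intro Max_ge) auto
    then show ?thesis by (simp add: d_def)
  qed
  ultimately have "f * g = (\<Sum>i\<le>d. hcomp i f) * (\<Sum>j\<le>d. hcomp j g)"
    by (simp add: sum_hcomp)
  also have "\<dots> = (\<Sum>i\<le>d. \<Sum>j\<le>d. hcomp i f * hcomp j g)" by (rule sum_product)
  finally have prod: "hcomp k (f * g) = (\<Sum>i\<le>d. \<Sum>j\<le>d. hcomp k (hcomp i f * hcomp j g))"
    by (simp add: hcomp_sum)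
  have deg: "hcomp k (hcomp i f * hcomp j g) = (if k = i + j then hcomp i f * hcomp j g else 0)" for i j
  proof (rule hcomp_homogeneous)
    fix t assume "t \<in> keys (hcomp i f * hcomp j g)"
    then show "tdeg t = i + j"
      using keys_mult[of "hcomp i f" "hcomp j g"] by (auto simp: keys_hcomp tdeg_add)
  qed
  have "hcomp k (f * g) = (\<Sum>i\<le>d. \<Sum>j\<le>d. if k = i + j then hcomp i f * hcomp j g else 0)"
    unfolding prod by (simp only: deg)
  also have "\<dots> =
      (\<Sum>i\<le>d. if i \<le> k then hcomp i f * hcomp (k - i) g else 0)"
  proof (rule sum.cong)
    fix i
    have "(\<Sum>j\<le>d. if k = i + j then hcomp i f * hcomp j g else 0) =
        (\<Sum>j\<le>d. if j = k - i then (if i \<le> k then hcomp i f * hcomp (k - i) g else 0) else 0)"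
      by (rule sum.cong) auto
    also have "\<dots> = (if i \<le> k then hcomp i f * hcomp (k - i) g else 0)"
      by (subst sum.delta) (auto simp: d_def)
    finally show "(\<Sum>j\<le>d. if k = i + j then hcomp i f * hcomp j g else 0) =
        (if i \<le> k then hcomp i f * hcomp (k - i) g else 0)" .
  qed simp
  also have "\<dots> = (\<Sum>i\<le>k. hcomp i f * hcomp (k - i) g)"
    by (intro sum.mono_neutral_cong_right) (auto simp: d_def)
  finally show ?thesis .
qed

lemma lookup_mult_0: "lookup (f * g) 0 = lookup f 0 * lookup (g :: (nat, 'k::field) mpoly) 0"
proof -
  have "lookup (hcomp 0 (f * g)) 0 = lookup (hcomp 0 f * hcomp 0 g) 0"
    by (simp add: hcomp_mult)
  also have "\<dots> = lookup (pconst (lookup f 0) * pconst (lookup g 0) :: (nat, 'k) mpoly) 0"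
  proof -
    have "hcomp 0 h = pconst (lookup h 0)" for h :: "(nat, 'k) mpoly"
      by (rule poly_mapping_eqI) (auto simp: lookup_hcomp pconst_def lookup_single when_def)
    then show ?thesis by simp
  qed
  finally show ?thesis by (simp add: lookup_hcomp lookup_pconst_mult lookup_pconst_0)
qed

text \<open>The polynomials that represent elements of \<open>F\<^sub>i\<^sub>-\<^sub>1\<close>; for \<open>i = 0\<close> there is only the zero polynomial.\<close>

definition below :: "nat \<Rightarrow> nat \<Rightarrow> (nat, 'k::field) mpoly set" where
  "below n i = {f \<in> polys n. \<forall>t\<in>keys f. tdeg t < i}"

lemma belowD: "f \<in> below n i \<Longrightarrow> f \<in> polys n"
  by (simp add: below_def)

lemma below_0_mem [simp]: "0 \<in> below n i"
  by (simp add: below_def)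

lemma below_0: "below n 0 = {0}"
  by (auto simp: below_def)

lemma below_add: "f \<in> below n i \<Longrightarrow> g \<in> below n i \<Longrightarrow> f + g \<in> below n i"
  using keys_add[of f g] by (fastforce simp: below_def)

lemma below_uminus: "f \<in> below n i \<Longrightarrow> - f \<in> below n i"
  by (auto simp: below_def in_keys_iff)

lemma below_diff: "f \<in> below n i \<Longrightarrow> g \<in> below n i \<Longrightarrow> f - g \<in> below n i"
  using below_add[of f n i "- g"] below_uminus[of g] by simp

lemma below_sum: "(\<And>j. j \<in> A \<Longrightarrow> f j \<in> below n i) \<Longrightarrow> sum f A \<in> below n i"
  by (induction A rule: infinite_finite_induct) (auto simp: below_add)

lemma below_mult:
  assumes "f \<in> below n i" "g \<in> below n (Suc j)"
  shows "f * g \<in> below n (i + j)" "g * f \<in> below n (i + j)"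
proof -
  have "tdeg t < i + j" if t: "t \<in> keys (f * g)" for t
  proof -
    obtain s u where "t = s + u" "s \<in> keys f" "u \<in> keys g"
      using t keys_mult[of f g] by blast
    then have "tdeg s < i" "tdeg u < Suc j" using assms by (auto simp: below_def)
    then show ?thesis using \<open>t = s + u\<close> by (simp add: tdeg_add)
  qed
  then show "f * g \<in> below n (i + j)" using assms by (simp add: below_def)
  then show "g * f \<in> below n (i + j)" by (simp add: mult.commute)
qed

lemma hcomp_below: "f \<in> polys n \<Longrightarrow> hcomp i f \<in> below n (Suc i)"
  by (auto simp: below_def keys_hcomp)

lemma below_Suc_diff_hcomp: "f \<in> below n (Suc i) \<Longrightarrow> f - hcomp i f \<in> below n i"
  by (auto simp: below_def in_keys_iff lookup_minus lookup_hcomp less_Suc_eq split: if_splits)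

text \<open>A homogeneous polynomial of degree \<open>i\<close> belongs to this ideal if and only if it is zero or the leading
form of an element of \<open>I\<close>.\<close>

definition leading_forms :: "nat \<Rightarrow> (nat, 'k::field) mpoly set \<Rightarrow> (nat, 'k) mpoly set" where
  "leading_forms n I = {f \<in> polys n. \<forall>i. \<exists>b\<in>below n i. hcomp i f - b \<in> I}"

abbreviation gr_ring :: "nat \<Rightarrow> (nat, 'k::field) mpoly set \<Rightarrow> (nat \<Rightarrow> (nat, 'k) mpoly set set) ring" where
  "gr_ring n I \<equiv> assoc_graded_ring (coord_ring n I) (deg_filtration n I)"

text \<open>The class of \<open>p\<close> in \<open>F\<^sub>i / F\<^sub>i\<^sub>-\<^sub>1\<close>, a coset in the residue class ring.\<close>

definition layer :: "nat \<Rightarrow> (nat, 'k::field) mpoly set \<Rightarrow> nat \<Rightarrow> (nat, 'k) mpoly \<Rightarrow> (nat, 'k) mpoly set set" where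
  "layer n I i p = (\<lambda>b. residue n I (p + b)) ` below n i"

text \<open>The canonical surjection of \<open>P\<close>, graded by degree, onto the associated graded ring of \<open>P / I\<close>.\<close>

definition gr_map :: "nat \<Rightarrow> (nat, 'k::field) mpoly set \<Rightarrow> (nat, 'k) mpoly \<Rightarrow> nat \<Rightarrow> (nat, 'k) mpoly set set" where
  "gr_map n I f = (\<lambda>i. layer n I i (hcomp i f))"

context aff_ideal
begin

lemma filt_below_eq: "filt_below (coord_ring n I) (deg_filtration n I) i = residue n I ` below n i"
  by (cases i) (auto simp: below_0 residue_0 deg_filtration_def below_def less_Suc_eq_le)

lemma coset_eq_layer:
  assumes "p \<in> polys n"
  shows "filt_below (coord_ring n I) (deg_filtration n I) i +>\<^bsub>coord_ring n I\<^esub> residue n I p = layer n I i p"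
proof -
  have "residue n I b \<oplus>\<^bsub>coord_ring n I\<^esub> residue n I p = residue n I (p + b)" if "b \<in> below n i" for b
    using that assms by (simp add: residue_simps belowD add.commute)
  then show ?thesis
    by (auto simp: filt_below_eq a_r_coset_def' layer_def)
qed

lemma layer_0: "layer n I i 0 = filt_below (coord_ring n I) (deg_filtration n I) i"
  by (simp add: layer_def filt_below_eq)

lemma layer_eq_iff:
  assumes "p \<in> polys n" "q \<in> polys n"
  shows "layer n I i p = layer n I i q \<longleftrightarrow> (\<exists>b\<in>below n i. p - q - b \<in> I)"
proof
  assume "layer n I i p = layer n I i q"
  moreover have "residue n I p \<in> layer n I i p"
    unfolding layer_def by (rule image_eqI[of _ _ 0]) auto
  ultimately obtain b where b: "b \<in> below n i" "residue n I p = residue n I (q + b)"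
    by (auto simp: layer_def)
  then have "p - (q + b) \<in> I" using assms belowD[OF b(1)] by (subst (asm) residue_eq_iff) auto
  then show "\<exists>b\<in>below n i. p - q - b \<in> I" using b(1) by (intro bexI[of _ b]) (simp_all add: algebra_simps)
next
  assume "\<exists>b\<in>below n i. p - q - b \<in> I"
  then obtain b where b: "b \<in> below n i" "p - q - b \<in> I" by blast
  have eq: "residue n I (p + c) = residue n I (q + (b + c))" if "c \<in> below n i" for c
  proof -
    have "(p + c) - (q + (b + c)) = p - q - b" by simp
    then have "(p + c) - (q + (b + c)) \<in> I" using b(2) by (simp only:)
    then show ?thesis using assms belowD[OF b(1)] belowD[OF that] residue_eq_iff[of "p + c" "q + (b + c)"]
      by (simp only: mpoly_add_closed)
  qed
  have eq': "residue n I (q + c) = residue n I (p + (c - b))" if "c \<in> below n i" for c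
    using eq[of "c - b"] that b(1) by (simp add: below_diff)
  have "layer n I i p \<subseteq> layer n I i q"
    unfolding layer_def by (intro image_subsetI) (rule image_eqI, rule eq, assumption, rule below_add[OF b(1)])
  moreover have "layer n I i q \<subseteq> layer n I i p"
    unfolding layer_def by (intro image_subsetI) (rule image_eqI, rule eq', assumption, rule below_diff[OF _ b(1)])
  ultimately show "layer n I i p = layer n I i q" by (rule Set.equalityI)
qed

lemma layer_diff_below:
  assumes "p \<in> polys n" "q \<in> polys n" "p - q \<in> below n i"
  shows "layer n I i p = layer n I i q"
  using assms ideal_closed(2) by (subst layer_eq_iff) (auto intro!: bexI[of _ "p - q"])

lemma layer_add:
  assumes "p \<in> polys n" "q \<in> polys n"
  shows "layer n I i p <+>\<^bsub>coord_ring n I\<^esub> layer n I i q = layer n I i (p + q)"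
proof -
  have 1: "residue n I (p + b) \<oplus>\<^bsub>coord_ring n I\<^esub> residue n I (q + c) = residue n I ((p + q) + (b + c))"
    if "b \<in> below n i" "c \<in> below n i" for b c
  proof -
    have "(p + b) + (q + c) = (p + q) + (b + c)" by (simp add: algebra_simps)
    then show ?thesis
      using assms belowD[OF that(1)] belowD[OF that(2)] by (metis mpoly_add_closed residue_simps(1))
  qed
  have "x \<in> layer n I i (p + q)" if "x \<in> layer n I i p <+>\<^bsub>coord_ring n I\<^esub> layer n I i q" for x
    using that 1 below_add by (force simp: set_add_def' layer_def)
  moreover have "x \<in> layer n I i p <+>\<^bsub>coord_ring n I\<^esub> layer n I i q" if x: "x \<in> layer n I i (p + q)" for x
  proof -
    obtain b where b: "b \<in> below n i" "x = residue n I ((p + q) + b)" using x unfolding layer_def by blast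
    then have "x = residue n I (p + b) \<oplus>\<^bsub>coord_ring n I\<^esub> residue n I (q + 0)" using 1[of b 0] by simp
    then show ?thesis using b(1) below_0_mem unfolding set_add_def' layer_def by blast
  qed
  ultimately show ?thesis by blast
qed

lemma residue_finsum:
  assumes "finite A" "\<And>i. i \<in> A \<Longrightarrow> f i \<in> polys n"
  shows "finsum (coord_ring n I) (\<lambda>i. residue n I (f i)) A = residue n I (sum f A)"
  using assms
proof (induction A rule: finite_induct)
  interpret cring "coord_ring n I" by (rule coord_cring)
  {
    case empty
    show ?case by (simp add: residue_0)
  next
    case (insert x F)
    then show ?case
      by (subst finsum_insert) (auto simp: residue_closed residue_simps)
  }
qed

lemma gr_map_closed:
  assumes f: "f \<in> polys n"
  shows "gr_map n I f \<in> carrier (gr_ring n I)"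
proof -
  have "\<exists>x\<in>deg_filtration n I i. gr_map n I f i =
      filt_below (coord_ring n I) (deg_filtration n I) i +>\<^bsub>coord_ring n I\<^esub> x" for i
  proof (rule bexI[of _ "residue n I (hcomp i f)"])
    show "residue n I (hcomp i f) \<in> deg_filtration n I i"
      using f by (auto simp: deg_filtration_def keys_hcomp)
  qed (simp add: gr_map_def coset_eq_layer f)
  moreover have "{i. gr_map n I f i \<noteq> filt_below (coord_ring n I) (deg_filtration n I) i} \<subseteq> tdeg ` keys f"
  proof
    fix i assume "i \<in> {i. gr_map n I f i \<noteq> filt_below (coord_ring n I) (deg_filtration n I) i}"
    then have "hcomp i f \<noteq> 0" by (auto simp: gr_map_def layer_0)
    then have "keys (hcomp i f) \<noteq> {}" by simp
    then show "i \<in> tdeg ` keys f" by (auto simp: keys_hcomp)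
  qed
  then have "finite {i. gr_map n I f i \<noteq> filt_below (coord_ring n I) (deg_filtration n I) i}"
    by (rule finite_subset) simp
  ultimately show ?thesis by (simp add: assoc_graded_ring_def)
qed

lemma gr_map_surj: "gr_map n I ` polys n = carrier (gr_ring n I)"
proof
  show "gr_map n I ` polys n \<subseteq> carrier (gr_ring n I)" using gr_map_closed by auto
  show "carrier (gr_ring n I) \<subseteq> gr_map n I ` polys n"
  proof
    fix g assume g: "g \<in> carrier (gr_ring n I)"
    let ?S = "{i. g i \<noteq> filt_below (coord_ring n I) (deg_filtration n I) i}"
    have fin: "finite ?S" using g by (simp add: assoc_graded_ring_def)
    have "\<exists>p. p \<in> below n (Suc i) \<and> g i = layer n I i p" for i
    proof -
      from g obtain x where x: "x \<in> deg_filtration n I i"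
        "g i = filt_below (coord_ring n I) (deg_filtration n I) i +>\<^bsub>coord_ring n I\<^esub> x"
        by (auto simp: assoc_graded_ring_def)
      from x(1) obtain p where p: "p \<in> below n (Suc i)" "x = residue n I p"
        by (auto simp: deg_filtration_def below_def less_Suc_eq_le)
      then show ?thesis using x(2) coset_eq_layer[OF belowD[OF p(1)]] by auto
    qed
    then obtain p where p: "\<And>i. p i \<in> below n (Suc i)" "\<And>i. g i = layer n I i (p i)" by metis
    define f where "f = (\<Sum>i\<in>?S. hcomp i (p i))"
    have fP: "f \<in> polys n" unfolding f_def using p(1)[THEN belowD] by auto
    have "gr_map n I f = g"
    proof
      fix i
      have "hcomp i f = (if i \<in> ?S then hcomp i (p i) else 0)"
        unfolding f_def hcomp_sum hcomp_hcomp using fin by simp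
      moreover have "layer n I i (hcomp i (p i)) = layer n I i (p i)"
        using p(1)[of i, THEN belowD] below_Suc_diff_hcomp[OF p(1)] by (intro layer_diff_below[symmetric]) auto
      ultimately show "gr_map n I f i = g i" using p(2)[of i] by (auto simp: gr_map_def layer_0)
    qed
    then show "g \<in> gr_map n I ` polys n" using fP by blast
  qed
qed

text \<open>The product in the graded ring is a union over all representatives of the factors. Two choices of
representatives differ by elements of \<open>below\<close>, which changes the degree \<open>k\<close> component of the product only
by an element of \<open>below n k\<close>, so the union consists of a single coset.\<close>

lemma gr_map_mult:
  assumes f: "f \<in> polys n" and g: "g \<in> polys n"
  shows "gr_map n I (f * g) = gr_map n I f \<otimes>\<^bsub>gr_ring n I\<^esub> gr_map n I g"
proof
  fix k
  let ?H = "filt_below (coord_ring n I) (deg_filtration n I) k"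
  let ?prod = "\<lambda>x y. ?H +>\<^bsub>coord_ring n I\<^esub> finsum (coord_ring n I) (\<lambda>i. x i \<otimes>\<^bsub>coord_ring n I\<^esub> y (k - i)) {..k}"
  let ?X = "{?prod x y | x y. (\<forall>i. x i \<in> gr_map n I f i) \<and> (\<forall>i. y i \<in> gr_map n I g i)}"
  have "?prod x y = gr_map n I (f * g) k"
    if xy: "\<forall>i. x i \<in> gr_map n I f i" "\<forall>i. y i \<in> gr_map n I g i" for x y
  proof -
    have "\<forall>i. \<exists>b. b \<in> below n i \<and> x i = residue n I (hcomp i f + b)"
      using xy(1) by (auto simp: gr_map_def layer_def)
    then obtain b where b: "\<And>i. b i \<in> below n i" "\<And>i. x i = residue n I (hcomp i f + b i)" by metis
    have "\<forall>i. \<exists>c. c \<in> below n i \<and> y i = residue n I (hcomp i g + c)"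
      using xy(2) by (auto simp: gr_map_def layer_def)
    then obtain c where c: "\<And>i. c i \<in> below n i" "\<And>i. y i = residue n I (hcomp i g + c i)" by metis
    note P = b(1)[THEN belowD] c(1)[THEN belowD] f g
    let ?P = "\<lambda>i. (hcomp i f + b i) * (hcomp (k - i) g + c (k - i))"
    have "(\<lambda>i. x i \<otimes>\<^bsub>coord_ring n I\<^esub> y (k - i)) = (\<lambda>i. residue n I (?P i))"
      using P by (simp add: b(2) c(2) residue_simps)
    then have "finsum (coord_ring n I) (\<lambda>i. x i \<otimes>\<^bsub>coord_ring n I\<^esub> y (k - i)) {..k} = residue n I (\<Sum>i\<le>k. ?P i)"
      using P by (simp add: residue_finsum)
    then have "?prod x y = layer n I k (\<Sum>i\<le>k. ?P i)"
      using P by (simp add: coset_eq_layer)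
    also have "\<dots> = layer n I k (hcomp k (f * g))"
    proof (rule layer_diff_below)
      have "(\<Sum>i\<le>k. ?P i) - hcomp k (f * g) =
          (\<Sum>i\<le>k. b i * (hcomp (k - i) g + c (k - i)) + c (k - i) * hcomp i f)"
        by (simp add: hcomp_mult flip: sum_subtractf) (simp add: algebra_simps)
      also have "\<dots> \<in> below n k"
      proof (intro below_sum below_add)
        fix i assume "i \<in> {..k}"
        then have i: "i \<le> k" by simp
        have "c (k - i) \<in> below n (Suc (k - i))" using c(1)[of "k - i"] by (auto simp: below_def intro: less_SucI)
        then have "hcomp (k - i) g + c (k - i) \<in> below n (Suc (k - i))"
          using hcomp_below[OF g] by (intro below_add)
        then show "b i * (hcomp (k - i) g + c (k - i)) \<in> below n k"
          using below_mult(1)[OF b(1)[of i], of _ "k - i"] i by auto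
        show "c (k - i) * hcomp i f \<in> below n k"
          using below_mult(1)[OF c(1)[of "k - i"] hcomp_below[OF f, of i]] i by simp
      qed
      finally show "(\<Sum>i\<le>k. ?P i) - hcomp k (f * g) \<in> below n k" .
    qed (use P in auto)
    finally show ?thesis by (simp add: gr_map_def)
  qed
  then have "?X \<subseteq> {gr_map n I (f * g) k}" by blast
  moreover have "?X \<noteq> {}"
  proof -
    have "residue n I (hcomp i h) \<in> gr_map n I h i" for i h
      unfolding gr_map_def layer_def using below_0_mem by (force intro!: image_eqI[of _ _ 0])
    then have "\<exists>x y. ?prod (\<lambda>i. residue n I (hcomp i f)) (\<lambda>i. residue n I (hcomp i g)) = ?prod x y \<and>
        (\<forall>i. x i \<in> gr_map n I f i) \<and> (\<forall>i. y i \<in> gr_map n I g i)"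
      by (intro exI[of _ "\<lambda>i. residue n I (hcomp i f)"] exI[of _ "\<lambda>i. residue n I (hcomp i g)"]) auto
    then show ?thesis by blast
  qed
  ultimately have "?X = {gr_map n I (f * g) k}" by blast
  then have "\<Union>?X = gr_map n I (f * g) k" by simp
  then show "gr_map n I (f * g) k = (gr_map n I f \<otimes>\<^bsub>gr_ring n I\<^esub> gr_map n I g) k"
    by (simp add: assoc_graded_ring_def)
qed

lemma gr_map_hom: "gr_map n I \<in> Ring.ring_hom (aff_ring n) (gr_ring n I)"
proof (rule ring_hom_memI)
  fix f g :: "(nat, 'k) mpoly" assume fg: "f \<in> polys n" "g \<in> polys n"
  show "gr_map n I f \<in> carrier (gr_ring n I)" using fg by (simp add: gr_map_closed)
  show "gr_map n I (f \<otimes>\<^bsub>aff_ring n\<^esub> g) = gr_map n I f \<otimes>\<^bsub>gr_ring n I\<^esub> gr_map n I g"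
    using gr_map_mult[OF fg] by simp
  show "gr_map n I (f \<oplus>\<^bsub>aff_ring n\<^esub> g) = gr_map n I f \<oplus>\<^bsub>gr_ring n I\<^esub> gr_map n I g"
    using fg by (simp add: assoc_graded_ring_def gr_map_def hcomp_add layer_add)
next
  have "hcomp i 1 = (if i = 0 then 1 else 0 :: (nat, 'k) mpoly)" for i
    by (rule hcomp_homogeneous) simp
  then show "gr_map n I \<one>\<^bsub>aff_ring n\<^esub> = \<one>\<^bsub>gr_ring n I\<^esub>"
    using coset_eq_layer[of 1 0] by (auto simp: gr_map_def assoc_graded_ring_def layer_0 residue_1 fun_eq_iff)
qed

lemma gr_map_zero: "gr_map n I 0 = \<zero>\<^bsub>gr_ring n I\<^esub>"
  by (auto simp: gr_map_def assoc_graded_ring_def layer_0)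

lemma gr_cring: "cring (gr_ring n I)"
  by (rule ring_of_surj_hom[OF mpoly_ring_cring gr_map_hom gr_map_surj]) (simp add: gr_map_zero)

lemma gr_map_kernel:
  assumes "f \<in> polys n"
  shows "gr_map n I f = \<zero>\<^bsub>gr_ring n I\<^esub> \<longleftrightarrow> f \<in> leading_forms n I"
proof -
  have "gr_map n I f = \<zero>\<^bsub>gr_ring n I\<^esub> \<longleftrightarrow> (\<forall>i. layer n I i (hcomp i f) = layer n I i 0)"
    unfolding gr_map_zero[symmetric] by (auto simp: gr_map_def fun_eq_iff)
  also have "\<dots> \<longleftrightarrow> f \<in> leading_forms n I"
    using assms by (simp add: layer_eq_iff leading_forms_def)
  finally show ?thesis .
qed

lemma leading_forms_ideal: "ideal (leading_forms n I) (aff_ring n)"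
proof -
  have "ring_hom_ring (aff_ring n) (gr_ring n I) (gr_map n I)"
    using gr_map_hom gr_cring mpoly_ring_ring by (intro ring_hom_ringI2) (auto simp: cring_def)
  then have "ideal (a_kernel (aff_ring n) (gr_ring n I) (gr_map n I)) (aff_ring n)"
    by (rule ring_hom_ring.kernel_is_ideal)
  moreover have "a_kernel (aff_ring n) (gr_ring n I) (gr_map n I) = leading_forms n I"
    using gr_map_kernel by (auto simp: a_kernel_def' leading_forms_def)
  ultimately show ?thesis by simp
qed

end

text \<open>The normal form of \<open>t\<close> has no terms of degree larger than that of \<open>t\<close>, so this is the leading form of
\<open>t\<close> minus its normal form, or it is zero.\<close>

lemma leading_form_of_reduction:
  assumes "term_basis n B I (\<le>)" "t \<in> terms_in {..<n}"
  shows "pmonom t - hcomp (tdeg t) (term_basis.NF B I (\<le>) (pmonom t)) \<in> leading_forms n I"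
proof -
  interpret term_basis n B I "(\<le>)" by fact
  let ?p = "NF (pmonom t)" let ?q = "hcomp (tdeg t) ?p"
  have P: "?p \<in> polys n" using assms(2) by (simp add: NF_closed)
  have "?p \<in> below n (Suc (tdeg t))"
    using NF(1)[of "pmonom t"] assms(2) P by (auto simp: below_def less_Suc_eq_le)
  then have b: "?p - ?q \<in> below n (tdeg t)" by (rule below_Suc_diff_hcomp)
  have "\<exists>b\<in>below n i. hcomp i (pmonom t - ?q) - b \<in> I" for i
  proof (cases "i = tdeg t")
    case True
    have "hcomp i (pmonom t - ?q) = pmonom t - ?q"
      using True keys_diff[of "pmonom t" ?q] by (subst hcomp_homogeneous[of _ i]) (auto simp: keys_hcomp)
    then have "hcomp i (pmonom t - ?q) - (?p - ?q) = pmonom t - ?p" by (simp only:) simp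
    then show ?thesis using b True NF(2)[of "pmonom t"] assms(2) by (intro bexI[of _ "?p - ?q"]) (simp_all only: pmonom_closed)
  next
    case False
    then have "hcomp i (pmonom t - ?q) = 0"
      using keys_diff[of "pmonom t" ?q] by (subst hcomp_homogeneous[of _ "tdeg t"]) (auto simp: keys_hcomp)
    then show ?thesis using ideal_closed(2) by (intro bexI[of _ 0]) auto
  qed
  then show ?thesis using P assms(2) by (simp add: leading_forms_def)
qed

text \<open>For independence, let a homogeneous combination \<open>p\<close> of basis elements of degree \<open>i\<close> be congruent modulo \<open>I\<close>
to a polynomial \<open>b\<close> of smaller degree. Then \<open>p\<close> is the normal form of \<open>b\<close>, so it has itself only terms
of degree less than \<open>i\<close> and must vanish.\<close>

lemma term_basis_leading_forms:
  assumes "term_basis n B I (\<le>)"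
  shows "term_basis n B (leading_forms n I) (=)"
proof -
  interpret term_basis n B I "(\<le>)" by fact
  show ?thesis
  proof (rule term_basis.intro[OF _ finite_B B_terms])
    show "ideal (leading_forms n I) (aff_ring n)"
      by (rule aff_ideal.leading_forms_ideal) (rule aff_ideal.intro[OF ideal])
  next
    fix t :: "nat pterm" assume t: "t \<in> terms_in {..<n}"
    have "keys (hcomp (tdeg t) (NF (pmonom t))) \<subseteq> {s \<in> B. tdeg s = tdeg t}"
      using NF_keys[of "pmonom t"] t by (auto simp: keys_hcomp)
    then show "\<exists>p. keys p \<subseteq> {s \<in> B. tdeg s = tdeg t} \<and> pmonom t - p \<in> leading_forms n I"
      using leading_form_of_reduction[OF assms t] by blast
  next
    fix p assume p: "keys p \<subseteq> B" "p \<in> leading_forms n I"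
    have "hcomp i p = 0" for i
    proof -
      obtain b where b: "b \<in> below n i" "hcomp i p - b \<in> I" using p(2) by (auto simp: leading_forms_def)
      have bP: "b \<in> polys n" using b(1) by (rule belowD)
      have "NF (hcomp i p) = NF b"
        using b bP p(2) by (intro NF_eqI) (auto simp: leading_forms_def)
      moreover have "NF (hcomp i p) = hcomp i p" using p(1) by (intro NF_id) (auto simp: keys_hcomp)
      ultimately have "hcomp i p = NF b" by simp
      moreover have "keys (NF b) \<subseteq> {s. tdeg s < i}"
        using NF(1)[OF bP] b(1) by (fastforce simp: below_def)
      moreover have "keys (hcomp i p) \<subseteq> {s. tdeg s = i}" by (auto simp: keys_hcomp)
      ultimately have "keys (hcomp i p) = {}" by fastforce
      then show ?thesis by simp
    qed
    then have "lookup p t = 0" for t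
      using lookup_hcomp[of "tdeg t" p t] by simp
    then show "p = 0" by (intro poly_mapping_eqI) simp
  qed
qed

section \<open>Injective modules over local Artinian rings\<close>

lemma self_module_simps [simp]:
  "carrier (self_module A) = carrier A" "add (self_module A) = add A" "zero (self_module A) = zero A"
  "module.smult (self_module A) = monoid.mult A" "one (self_module A) = one A" "monoid.mult (self_module A) = monoid.mult A"
  by (simp_all add: self_module_def)

lemma (in cring) module_self: "Module.module R (self_module R)"
proof (rule moduleI)
  show "abelian_group (self_module R)"
    by (rule abelian_groupI) (auto intro: a_assoc a_comm add.l_inv_ex)
qed (auto simp: l_distr r_distr m_assoc intro: cring_axioms)

lemma module_homD:
  assumes "f \<in> module_hom A M N"
  shows "x \<in> carrier M \<Longrightarrow> f x \<in> carrier N"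
    "x \<in> carrier M \<Longrightarrow> y \<in> carrier M \<Longrightarrow> f (x \<oplus>\<^bsub>M\<^esub> y) = f x \<oplus>\<^bsub>N\<^esub> f y"
    "a \<in> carrier A \<Longrightarrow> x \<in> carrier M \<Longrightarrow> f (a \<odot>\<^bsub>M\<^esub> x) = a \<odot>\<^bsub>N\<^esub> f x"
  using assms by (auto simp: module_hom_def)

text \<open>The extension to \<open>J + A a\<close> has to map \<open>x + r a\<close> to \<open>\<phi> x + r z\<close>, and \<open>compat\<close> makes this well defined.\<close>

lemma extend_hom_by_element:
  fixes A (structure) and M :: "('a, 'b) module"
  assumes M: "Module.module A M" and J: "ideal J A"
    and \<phi>: "\<phi> \<in> module_hom A (self_module A\<lparr>carrier := J\<rparr>) M"
    and a: "a \<in> carrier A" and z: "z \<in> carrier M"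
    and compat: "\<And>u. u \<in> carrier A \<Longrightarrow> u \<otimes> a \<in> J \<Longrightarrow> \<phi> (u \<otimes> a) = u \<odot>\<^bsub>M\<^esub> z"
  obtains J' \<psi> where "ideal J' A" "J \<subseteq> J'" "a \<in> J'" "\<psi> \<in> module_hom A (self_module A\<lparr>carrier := J'\<rparr>) M"
    "\<And>x. x \<in> J \<Longrightarrow> \<psi> x = \<phi> x" "\<psi> a = z"
proof -
  interpret M: Module.module A M by fact
  interpret J: ideal J A by fact
  have \<phi>_closed: "\<phi> x \<in> carrier M" if "x \<in> J" for x
    using module_homD(1)[OF \<phi>] that by simp
  have \<phi>_add: "\<phi> (x \<oplus> y) = \<phi> x \<oplus>\<^bsub>M\<^esub> \<phi> y" if "x \<in> J" "y \<in> J" for x y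
    using module_homD(2)[OF \<phi>] that by simp
  have \<phi>_smult: "\<phi> (r \<otimes> x) = r \<odot>\<^bsub>M\<^esub> \<phi> x" if "r \<in> carrier A" "x \<in> J" for r x
    using module_homD(3)[OF \<phi>] that by simp
  define J' where "J' = J <+>\<^bsub>A\<^esub> PIdl\<^bsub>A\<^esub> a"
  have J'_ideal: "ideal J' A"
    unfolding J'_def using J a by (intro M.R.add_ideals M.R.cgenideal_ideal)
  have J'_iff: "w \<in> J' \<longleftrightarrow> (\<exists>x\<in>J. \<exists>r\<in>carrier A. w = x \<oplus> r \<otimes> a)" for w
    by (auto simp: J'_def set_add_def' cgenideal_def)
  have uniq: "\<phi> x \<oplus>\<^bsub>M\<^esub> r \<odot>\<^bsub>M\<^esub> z = \<phi> x' \<oplus>\<^bsub>M\<^esub> r' \<odot>\<^bsub>M\<^esub> z"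
    if "x \<in> J" "x' \<in> J" "r \<in> carrier A" "r' \<in> carrier A" "x \<oplus> r \<otimes> a = x' \<oplus> r' \<otimes> a" for x x' r r'
  proof -
    have xc: "x \<in> carrier A" "x' \<in> carrier A" using that J.Icarr by auto
    define u where "u = r \<ominus> r'"
    have u: "u \<in> carrier A" using that by (simp add: u_def)
    have "u \<otimes> a = r \<otimes> a \<ominus> r' \<otimes> a"
      using that(3,4) a unfolding u_def by (simp add: M.R.minus_eq M.R.l_distr M.R.l_minus)
    also have "r \<otimes> a = \<ominus> x \<oplus> (x \<oplus> r \<otimes> a)" using that(3) xc a by (simp add: M.R.r_neg1)
    also have "\<dots> \<ominus> r' \<otimes> a = \<ominus> x \<oplus> (x' \<oplus> r' \<otimes> a) \<ominus> r' \<otimes> a" using that(5) by simp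
    also have "\<dots> = x' \<ominus> x"
    proof -
      have "\<ominus> x \<oplus> (x' \<oplus> w) \<ominus> w = x' \<ominus> x" if "w \<in> carrier A" for w
        using that xc by (simp add: M.R.minus_eq M.R.a_assoc M.R.r_neg M.R.a_comm[of "\<ominus> x" x'])
      then show ?thesis using that(4) a by simp
    qed
    finally have ua: "u \<otimes> a = x' \<ominus> x" .
    then have uaJ: "u \<otimes> a \<in> J" using that J.a_closed J.a_inv_closed by (simp add: M.R.minus_eq)
    have "x' = u \<otimes> a \<oplus> x" unfolding ua using xc by (simp add: M.R.minus_eq M.R.a_assoc M.R.l_neg)
    then have "\<phi> x' = u \<odot>\<^bsub>M\<^esub> z \<oplus>\<^bsub>M\<^esub> \<phi> x" using \<phi>_add uaJ that compat[OF u uaJ] by simp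
    then have "\<phi> x' \<oplus>\<^bsub>M\<^esub> r' \<odot>\<^bsub>M\<^esub> z = \<phi> x \<oplus>\<^bsub>M\<^esub> (u \<odot>\<^bsub>M\<^esub> z \<oplus>\<^bsub>M\<^esub> r' \<odot>\<^bsub>M\<^esub> z)"
      using \<phi>_closed[OF that(1)] z u that(4) by (simp add: M.M.a_ac)
    also have "u \<odot>\<^bsub>M\<^esub> z \<oplus>\<^bsub>M\<^esub> r' \<odot>\<^bsub>M\<^esub> z = (u \<oplus> r') \<odot>\<^bsub>M\<^esub> z" using u that z by (simp add: M.smult_l_distr)
    also have "u \<oplus> r' = r" unfolding u_def using that by (simp add: M.R.minus_eq M.R.a_assoc M.R.l_neg)
    finally show ?thesis by simp
  qed
  define \<psi> where "\<psi> w = (SOME v. \<exists>x\<in>J. \<exists>r\<in>carrier A. w = x \<oplus> r \<otimes> a \<and> v = \<phi> x \<oplus>\<^bsub>M\<^esub> r \<odot>\<^bsub>M\<^esub> z)" for w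
  have \<psi>_eq: "\<psi> (x \<oplus> r \<otimes> a) = \<phi> x \<oplus>\<^bsub>M\<^esub> r \<odot>\<^bsub>M\<^esub> z" if "x \<in> J" "r \<in> carrier A" for x r
    unfolding \<psi>_def
  proof (rule some_equality)
    show "\<exists>y\<in>J. \<exists>q\<in>carrier A. x \<oplus> r \<otimes> a = y \<oplus> q \<otimes> a \<and>
        \<phi> x \<oplus>\<^bsub>M\<^esub> r \<odot>\<^bsub>M\<^esub> z = \<phi> y \<oplus>\<^bsub>M\<^esub> q \<odot>\<^bsub>M\<^esub> z"
      using that by (intro bexI[of _ x] bexI[of _ r]) simp_all
    fix v assume "\<exists>y\<in>J. \<exists>q\<in>carrier A. x \<oplus> r \<otimes> a = y \<oplus> q \<otimes> a \<and> v = \<phi> y \<oplus>\<^bsub>M\<^esub> q \<odot>\<^bsub>M\<^esub> z"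
    then obtain y q where "y \<in> J" "q \<in> carrier A" "x \<oplus> r \<otimes> a = y \<oplus> q \<otimes> a" "v = \<phi> y \<oplus>\<^bsub>M\<^esub> q \<odot>\<^bsub>M\<^esub> z"
      by (elim bexE conjE)
    then show "v = \<phi> x \<oplus>\<^bsub>M\<^esub> r \<odot>\<^bsub>M\<^esub> z" using uniq[of x y r q] that by simp
  qed
  show thesis
  proof (rule that[OF J'_ideal])
    show "J \<subseteq> J'"
    proof
      fix x assume "x \<in> J"
      then have "x = x \<oplus> \<zero> \<otimes> a" using a J.Icarr by simp
      then show "x \<in> J'" using \<open>x \<in> J\<close> J'_iff by blast
    qed
    have "a = \<zero> \<oplus> \<one> \<otimes> a" using a by simp
    then show "a \<in> J'" using J'_iff[of a] J.zero_closed M.R.one_closed by blast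
    show "\<psi> x = \<phi> x" if "x \<in> J" for x
      using \<psi>_eq[OF that M.R.zero_closed] that a z J.Icarr \<phi>_closed by simp
    have "\<phi> \<zero> = \<zero>\<^bsub>M\<^esub>"
      using compat[OF M.R.zero_closed] a z J.zero_closed by simp
    then show "\<psi> a = z" using \<psi>_eq[OF J.zero_closed M.R.one_closed] a z by simp
    show "\<psi> \<in> module_hom A (self_module A\<lparr>carrier := J'\<rparr>) M"
      unfolding module_hom_def
    proof (intro CollectI conjI ballI)
      show "\<psi> \<in> carrier (self_module A\<lparr>carrier := J'\<rparr>) \<rightarrow> carrier M"
      proof
        fix w assume "w \<in> carrier (self_module A\<lparr>carrier := J'\<rparr>)"
        then obtain x r where "x \<in> J" "r \<in> carrier A" "w = x \<oplus> r \<otimes> a" using J'_iff by auto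
        then show "\<psi> w \<in> carrier M" using \<psi>_eq \<phi>_closed z by simp
      qed
    next
      fix w v assume "w \<in> carrier (self_module A\<lparr>carrier := J'\<rparr>)" "v \<in> carrier (self_module A\<lparr>carrier := J'\<rparr>)"
      then obtain x r y q where w: "x \<in> J" "r \<in> carrier A" "w = x \<oplus> r \<otimes> a"
        and v: "y \<in> J" "q \<in> carrier A" "v = y \<oplus> q \<otimes> a" using J'_iff by auto
      have "w \<oplus> v = (x \<oplus> y) \<oplus> (r \<oplus> q) \<otimes> a" using w v a J.Icarr by (simp add: M.R.l_distr M.R.a_ac)
      then have "\<psi> (w \<oplus> v) = (\<phi> x \<oplus>\<^bsub>M\<^esub> \<phi> y) \<oplus>\<^bsub>M\<^esub> (r \<oplus> q) \<odot>\<^bsub>M\<^esub> z"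
        using \<psi>_eq[of "x \<oplus> y" "r \<oplus> q"] w v J.a_closed \<phi>_add by simp
      also have "\<dots> = \<psi> w \<oplus>\<^bsub>M\<^esub> \<psi> v"
        using w v z \<phi>_closed \<psi>_eq by (simp add: M.smult_l_distr M.M.a_ac)
      finally show "\<psi> (w \<oplus>\<^bsub>self_module A\<lparr>carrier := J'\<rparr>\<^esub> v) = \<psi> w \<oplus>\<^bsub>M\<^esub> \<psi> v" by simp
    next
      fix b w assume b: "b \<in> carrier A" and "w \<in> carrier (self_module A\<lparr>carrier := J'\<rparr>)"
      then obtain x r where w: "x \<in> J" "r \<in> carrier A" "w = x \<oplus> r \<otimes> a" using J'_iff by auto
      have "b \<otimes> w = b \<otimes> x \<oplus> (b \<otimes> r) \<otimes> a" using w b a J.Icarr by (simp add: M.R.r_distr M.R.m_assoc)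
      then have "\<psi> (b \<otimes> w) = b \<odot>\<^bsub>M\<^esub> \<phi> x \<oplus>\<^bsub>M\<^esub> (b \<otimes> r) \<odot>\<^bsub>M\<^esub> z"
        using \<psi>_eq[of "b \<otimes> x" "b \<otimes> r"] w b J.I_l_closed \<phi>_smult by simp
      also have "\<dots> = b \<odot>\<^bsub>M\<^esub> \<psi> w"
        using w b z \<phi>_closed \<psi>_eq by (simp add: M.smult_r_distr M.smult_assoc1)
      finally show "\<psi> (b \<odot>\<^bsub>self_module A\<lparr>carrier := J'\<rparr>\<^esub> w) = b \<odot>\<^bsub>M\<^esub> \<psi> w" by simp
    qed
  qed
qed

text \<open>A homomorphism that extends to the whole ring is given by the image \<open>e\<close> of \<open>1\<close>.\<close>

lemma extend_hom_to_injective: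
  fixes A (structure) and E :: "('a, 'b) module"
  assumes E: "injective_module A E" and J: "ideal J A"
    and \<phi>: "\<phi> \<in> module_hom A (self_module A\<lparr>carrier := J\<rparr>) E"
  obtains e where "e \<in> carrier E" "\<And>x. x \<in> J \<Longrightarrow> \<phi> x = x \<odot>\<^bsub>E\<^esub> e"
proof -
  interpret E: Module.module A E using E by (simp add: injective_module_def)
  interpret J: ideal J A by fact
  obtain h where h: "h \<in> module_hom A (self_module A) E" "\<And>x. x \<in> J \<Longrightarrow> h x = \<phi> x"
    using E J \<phi> unfolding injective_module_def by blast
  show thesis
  proof
    show "h \<one> \<in> carrier E" using module_homD(1)[OF h(1)] by simp
    fix x assume x: "x \<in> J"
    then have "h (x \<otimes> \<one>) = x \<odot>\<^bsub>E\<^esub> h \<one>" using module_homD(3)[OF h(1), of x \<one>] J.Icarr by simp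
    then show "\<phi> x = x \<odot>\<^bsub>E\<^esub> h \<one>" using h(2) x J.Icarr by simp
  qed
qed

text \<open>An Artinian local ring, given by its maximal ideal and generators of the successive quotients of a
  composition series \<open>0 \<subset> (a\<^sub>0) \<subseteq> (a\<^sub>0, a\<^sub>1) \<subseteq> \<dots> \<subseteq> A\<close>.\<close>

locale local_chain_ring = cring A for A (structure) +
  fixes \<mm> :: "'a set" and as :: "'a list"
  assumes \<mm>_ideal: "ideal \<mm> A"
    and nonunits: "a \<in> carrier A \<Longrightarrow> a \<notin> \<mm> \<Longrightarrow> a \<in> Units A"
    and as_closed: "set as \<subseteq> carrier A"
    and chain: "k < length as \<Longrightarrow> x \<in> \<mm> \<Longrightarrow> x \<otimes> as ! k \<in> Idl (set (take k as))"
    and one_in: "\<one> \<in> Idl (set as)"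
    and as_nonempty: "as \<noteq> []" and socle_nonzero: "hd as \<noteq> \<zero>"
begin

lemma \<mm>_closed: "x \<in> \<mm> \<Longrightarrow> x \<in> carrier A"
  using \<mm>_ideal ideal.Icarr by metis

lemma colon_in_maximal:
  assumes "ideal J A" "a \<in> carrier A" "a \<notin> J" "u \<in> carrier A" "u \<otimes> a \<in> J"
  shows "u \<in> \<mm>"
proof (rule ccontr)
  interpret J: ideal J A by fact
  assume "u \<notin> \<mm>"
  then have u: "u \<in> Units A" using nonunits assms by blast
  have "inv u \<otimes> (u \<otimes> a) \<in> J" by (rule J.I_l_closed[OF assms(5) Units_inv_closed[OF u]])
  moreover have "inv u \<otimes> (u \<otimes> a) = a"
    using m_assoc[OF Units_inv_closed[OF u] assms(4,2)] Units_l_inv[OF u] assms(2) by simp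
  ultimately show False using assms(3) by simp
qed

lemma hd_closed: "hd as \<in> carrier A"
  using as_closed as_nonempty by auto

lemma \<mm>_mult_hd: "x \<in> \<mm> \<Longrightarrow> x \<otimes> hd as = \<zero>"
proof -
  assume "x \<in> \<mm>"
  then have "x \<otimes> as ! 0 \<in> Idl {}" using chain[of 0 x] as_nonempty by simp
  moreover have "Idl {} \<subseteq> {\<zero>}" by (rule genideal_minimal[OF zeroideal]) simp
  ultimately show ?thesis using as_nonempty by (auto simp: hd_conv_nth)
qed

text \<open>Since \<open>s \<noteq> 0\<close>, the annihilator of \<open>s\<close> is contained in \<open>\<mm>\<close> and kills \<open>c\<close>. So \<open>u s \<mapsto> u c\<close> is a homomorphism on
the ideal generated by \<open>s\<close>, and it extends to the ring.\<close>

lemma socle_element_divisible: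
  fixes E :: "('a, 'c) module"
  assumes E: "injective_module A E" and c: "c \<in> carrier E" and ann: "\<And>x. x \<in> \<mm> \<Longrightarrow> x \<odot>\<^bsub>E\<^esub> c = \<zero>\<^bsub>E\<^esub>"
    and s: "s \<in> carrier A" "s \<noteq> \<zero>" 
  obtains e where "e \<in> carrier E" "c = s \<odot>\<^bsub>E\<^esub> e"
proof -
  interpret E: Module.module A E using E by (simp add: injective_module_def)
  have "(\<lambda>x. \<zero>\<^bsub>E\<^esub>) \<in> module_hom A (self_module A\<lparr>carrier := {\<zero>}\<rparr>) E"
    by (auto simp: module_hom_def)
  moreover have "\<zero>\<^bsub>E\<^esub> = u \<odot>\<^bsub>E\<^esub> c" if "u \<in> carrier A" "u \<otimes> s \<in> {\<zero>}" for u
    using ann[of u] colon_in_maximal[OF zeroideal s(1), of u] that s(2) by simp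
  ultimately obtain J \<psi> where "ideal J A" "s \<in> J" "\<psi> \<in> module_hom A (self_module A\<lparr>carrier := J\<rparr>) E" "\<psi> s = c"
    using extend_hom_by_element[OF E.module_axioms zeroideal _ s(1) c, of "\<lambda>x. \<zero>\<^bsub>E\<^esub>"] by metis
  then show thesis using extend_hom_to_injective[OF E, of J \<psi>] that by metis
qed

text \<open>The point of the proof is that a socle element of \<open>C\<close> lifts to a socle element of \<open>E\<close> (\<open>lift\<close>): it is a multiple
\<open>s c'\<close> of a fixed nonzero socle element \<open>s\<close> of \<open>A\<close>, and if \<open>e'\<close> is a preimage of \<open>c'\<close> then \<open>s e'\<close> is a preimage
that is killed by \<open>\<mm>\<close>. Now a homomorphism from an ideal to \<open>M\<close> is extended along the composition series of
\<open>A\<close>, by one generator \<open>a\<close> at a time. In \<open>E\<close> the homomorphism \<open>\<psi>\<close> obtained so far is multiplication by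
some \<open>e\<close>. As \<open>\<mm> a\<close> lies in the domain of \<open>\<psi>\<close>, the image of \<open>a e\<close> in \<open>C\<close> is a socle element. Subtracting from \<open>a e\<close> a
socle element \<open>e2\<close> with the same image yields an element of \<open>M\<close>, which is the value at \<open>a\<close>.\<close>

lemma kernel_of_injectives_is_injective:
  fixes M E C :: "('a, 'c) module"
  assumes M: "Module.module A M" and E: "injective_module A E" and C: "injective_module A C"
    and f: "f \<in> module_hom A M E" "inj_on f (carrier M)"
    and g: "g \<in> module_hom A E C" "g ` carrier E = carrier C"
    and exact: "{x \<in> carrier E. g x = \<zero>\<^bsub>C\<^esub>} = f ` carrier M"
  shows "injective_module A M"
  unfolding injective_module_def
proof (intro conjI allI impI)
  show "Module.module A M" by fact
  interpret M: Module.module A M by fact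
  interpret E: Module.module A E using E by (simp add: injective_module_def)
  interpret C: Module.module A C using C by (simp add: injective_module_def)
  note f_hom = module_homD[OF f(1)] and g_hom = module_homD[OF g(1)]
  have lift: "\<exists>e\<in>carrier E. g e = c \<and> (\<forall>x\<in>\<mm>. x \<odot>\<^bsub>E\<^esub> e = \<zero>\<^bsub>E\<^esub>)"
    if c: "c \<in> carrier C" "\<And>x. x \<in> \<mm> \<Longrightarrow> x \<odot>\<^bsub>C\<^esub> c = \<zero>\<^bsub>C\<^esub>" for c
  proof -
    obtain c' where c': "c' \<in> carrier C" "c = hd as \<odot>\<^bsub>C\<^esub> c'"
      using socle_element_divisible[OF C c hd_closed socle_nonzero] by metis
    then obtain e' where e': "e' \<in> carrier E" "c' = g e'" using g(2) by (metis imageE)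
    have "g (hd as \<odot>\<^bsub>E\<^esub> e') = c" using g_hom(3)[OF hd_closed e'(1)] c' e' by simp
    moreover have "x \<odot>\<^bsub>E\<^esub> (hd as \<odot>\<^bsub>E\<^esub> e') = \<zero>\<^bsub>E\<^esub>" if "x \<in> \<mm>" for x
      using E.smult_assoc1[OF \<mm>_closed[OF that] hd_closed e'(1)] \<mm>_mult_hd[OF that] e'(1) by simp
    ultimately show ?thesis using hd_closed e'(1) by blast
  qed
  fix J \<phi> assume J: "ideal J A" and \<phi>: "\<phi> \<in> module_hom A (self_module A\<lparr>carrier := J\<rparr>) M"
  have "\<exists>J' \<psi>. ideal J' A \<and> J \<subseteq> J' \<and> set (take k as) \<subseteq> J' \<and>
      \<psi> \<in> module_hom A (self_module A\<lparr>carrier := J'\<rparr>) M \<and> (\<forall>x\<in>J. \<psi> x = \<phi> x)" if "k \<le> length as" for k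
    using that
  proof (induction k)
    case 0
    then show ?case using J \<phi> by auto
  next
    case (Suc k)
    then obtain J' \<psi> where J': "ideal J' A" "J \<subseteq> J'" "set (take k as) \<subseteq> J'"
      and \<psi>: "\<psi> \<in> module_hom A (self_module A\<lparr>carrier := J'\<rparr>) M" "\<forall>x\<in>J. \<psi> x = \<phi> x" by auto
    interpret J': ideal J' A by fact
    let ?a = "as ! k"
    have a: "?a \<in> carrier A" using Suc.prems as_closed by auto
    have take: "set (take (Suc k) as) = insert ?a (set (take k as))"
      using Suc.prems by (simp add: take_Suc_conv_app_nth)
    note \<psi>_hom = module_homD[OF \<psi>(1), simplified]
    show ?case
    proof (cases "?a \<in> J'")
      case True
      then show ?thesis using J' \<psi> take by (intro exI[of _ J'] exI[of _ \<psi>]) auto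
    next
      case False
      have \<mm>a: "x \<otimes> ?a \<in> J'" if "x \<in> \<mm>" for x
        using chain[of k x] that Suc.prems genideal_minimal[OF J'(1,3)] by auto
      have "(\<lambda>x. f (\<psi> x)) \<in> module_hom A (self_module A\<lparr>carrier := J'\<rparr>) E"
        using \<psi>_hom f_hom by (auto simp: module_hom_def)
      then obtain e where e: "e \<in> carrier E" "\<And>x. x \<in> J' \<Longrightarrow> f (\<psi> x) = x \<odot>\<^bsub>E\<^esub> e"
        using extend_hom_to_injective[OF E J'(1)] by metis
      have ae: "?a \<odot>\<^bsub>E\<^esub> e \<in> carrier E" using a e by simp
      have "x \<odot>\<^bsub>C\<^esub> g (?a \<odot>\<^bsub>E\<^esub> e) = \<zero>\<^bsub>C\<^esub>" if x: "x \<in> \<mm>" for x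
      proof -
        have "x \<odot>\<^bsub>C\<^esub> g (?a \<odot>\<^bsub>E\<^esub> e) = g (x \<odot>\<^bsub>E\<^esub> (?a \<odot>\<^bsub>E\<^esub> e))" using g_hom(3)[OF \<mm>_closed[OF x] ae] by simp
        also have "x \<odot>\<^bsub>E\<^esub> (?a \<odot>\<^bsub>E\<^esub> e) = (x \<otimes> ?a) \<odot>\<^bsub>E\<^esub> e" using E.smult_assoc1[OF \<mm>_closed[OF x] a e(1)] by simp
        also have "\<dots> = f (\<psi> (x \<otimes> ?a))" using e(2)[OF \<mm>a[OF x]] by simp
        finally have "x \<odot>\<^bsub>C\<^esub> g (?a \<odot>\<^bsub>E\<^esub> e) = g (f (\<psi> (x \<otimes> ?a)))" .
        moreover have "f (\<psi> (x \<otimes> ?a)) \<in> {x \<in> carrier E. g x = \<zero>\<^bsub>C\<^esub>}"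
          unfolding exact using \<psi>_hom(1)[OF \<mm>a[OF x]] by (rule imageI)
        ultimately show ?thesis by simp
      qed
      then obtain e2 where e2: "e2 \<in> carrier E" "g e2 = g (?a \<odot>\<^bsub>E\<^esub> e)" "\<And>x. x \<in> \<mm> \<Longrightarrow> x \<odot>\<^bsub>E\<^esub> e2 = \<zero>\<^bsub>E\<^esub>"
        using lift[OF g_hom(1)[OF ae]] by blast
      let ?y = "?a \<odot>\<^bsub>E\<^esub> e \<ominus>\<^bsub>E\<^esub> e2"
      have y: "?y \<in> carrier E" using ae e2 by simp
      have split: "?a \<odot>\<^bsub>E\<^esub> e = ?y \<oplus>\<^bsub>E\<^esub> e2"
        using ae e2(1) by (simp add: E.M.minus_eq E.M.a_assoc E.M.l_neg)
      have "g ?y \<oplus>\<^bsub>C\<^esub> g e2 = g e2" using g_hom(2)[OF y e2(1)] split e2(2) by simp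
      then have "g ?y = \<zero>\<^bsub>C\<^esub>" using g_hom(1)[OF y] g_hom(1)[OF e2(1)] C.M.add.l_cancel_one' C.M.add.r_cancel_one' by metis
      then obtain z where z: "z \<in> carrier M" "?y = f z" using exact y by blast
      \<comment> \<open>The correction by \<open>e2\<close> does not disturb this because \<open>u\<close> lies in \<open>\<mm>\<close> and kills \<open>e2\<close>.\<close>
      have compat: "\<psi> (u \<otimes> ?a) = u \<odot>\<^bsub>M\<^esub> z" if u: "u \<in> carrier A" "u \<otimes> ?a \<in> J'" for u
      proof (rule inj_onD[OF f(2)])
        have "u \<in> \<mm>" using colon_in_maximal[OF J'(1) a False u] .
        have "f (\<psi> (u \<otimes> ?a)) = (u \<otimes> ?a) \<odot>\<^bsub>E\<^esub> e" using e(2)[OF u(2)] .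
        also have "\<dots> = u \<odot>\<^bsub>E\<^esub> (?y \<oplus>\<^bsub>E\<^esub> e2)" using E.smult_assoc1[OF u(1) a e(1)] split by simp
        also have "\<dots> = u \<odot>\<^bsub>E\<^esub> ?y \<oplus>\<^bsub>E\<^esub> \<zero>\<^bsub>E\<^esub>"
          using E.smult_r_distr[OF u(1) y e2(1)] e2(3)[OF \<open>u \<in> \<mm>\<close>] by simp
        also have "\<dots> = f (u \<odot>\<^bsub>M\<^esub> z)" using f_hom(3)[OF u(1) z(1)] z y u(1) by simp
        finally show "f (\<psi> (u \<otimes> ?a)) = f (u \<odot>\<^bsub>M\<^esub> z)" .
      qed (use \<psi>_hom(1) u z in auto)
      obtain J'' \<psi>' where "ideal J'' A" "J' \<subseteq> J''" "?a \<in> J''"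
        "\<psi>' \<in> module_hom A (self_module A\<lparr>carrier := J''\<rparr>) M" "\<And>x. x \<in> J' \<Longrightarrow> \<psi>' x = \<psi> x"
        using extend_hom_by_element[OF M J'(1) \<psi>(1) a z(1) compat] by metis
      then show ?thesis using J' \<psi>(2) take by (intro exI[of _ J''] exI[of _ \<psi>']) auto
    qed
  qed
  from this[of "length as"] obtain J' \<psi> where J': "ideal J' A" "J \<subseteq> J'" "set as \<subseteq> J'"
    and \<psi>: "\<psi> \<in> module_hom A (self_module A\<lparr>carrier := J'\<rparr>) M" "\<forall>x\<in>J. \<psi> x = \<phi> x" by auto
  have "\<one> \<in> J'" using one_in genideal_minimal[OF J'(1,3)] by auto
  then have "J' = carrier A" using ideal.one_imp_carrier[OF J'(1)] by simp
  then have "self_module A\<lparr>carrier := J'\<rparr> = self_module A" by (simp add: self_module_def)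
  then show "\<exists>g\<in>module_hom A (self_module A) M. \<forall>x\<in>J. g x = \<phi> x" using \<psi> by auto
qed

text \<open>Going up an injective resolution, the cosyzygy is injective by induction, so the module is the kernel
of a surjection between injective modules.\<close>

theorem finite_injective_dimension_imp_injective:
  fixes M :: "('a, 'c) module"
  assumes "finite_injective_dimension A M"
  shows "injective_module A M"
  using assms
proof (induction rule: finite_injective_dimension.induct)
  case (cosyzygy M E C f g)
  then show ?case by (intro kernel_of_injectives_is_injective[of M E C f g])
qed

text \<open>In a self-injective local ring, the socle is contained in every nonzero ideal.\<close>

lemma socle_one_dimensional:
  assumes "injective_module A (self_module A)" "s \<in> carrier A" "s \<noteq> \<zero>"
    and "s' \<in> carrier A" "\<And>x. x \<in> \<mm> \<Longrightarrow> x \<otimes> s' = \<zero>"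
  obtains y where "y \<in> carrier A" "s' = s \<otimes> y"
  using socle_element_divisible[OF assms(1), of s' s] assms(2-) by auto

end

section \<open>Linear functionals on the polynomial ring\<close>

interpretation poly_vs: vector_space "\<lambda>c p. pconst c * p :: (nat, 'k::field) mpoly"
  by unfold_locales (simp_all add: distrib_left distrib_right pconst_add pconst_mult mult.assoc)

interpretation poly_functional: vector_space_pair "\<lambda>c p. pconst c * p :: (nat, 'k::field) mpoly" "(*) :: 'k \<Rightarrow> 'k \<Rightarrow> 'k"
  by unfold_locales (simp_all add: algebra_simps)

lemma extend_functional:
  fixes W :: "(nat, 'k::field) mpoly set"
  assumes W: "\<And>p q. p \<in> W \<Longrightarrow> q \<in> W \<Longrightarrow> p + q \<in> W" "\<And>c p. p \<in> W \<Longrightarrow> pconst c * p \<in> W"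
    and \<psi>: "\<And>p q. p \<in> W \<Longrightarrow> q \<in> W \<Longrightarrow> \<psi> (p + q) = \<psi> p + \<psi> q"
    "\<And>c p. p \<in> W \<Longrightarrow> \<psi> (pconst c * p) = c * \<psi> p" and "0 \<in> W"
  obtains L :: "(nat, 'k) mpoly \<Rightarrow> 'k" where
    "\<And>p q. L (p + q) = L p + L q" "\<And>c p. L (pconst c * p) = c * L p" "\<And>p. p \<in> W \<Longrightarrow> L p = \<psi> p"
proof -
  obtain S where S: "S \<subseteq> W" "poly_vs.independent S" "W \<subseteq> poly_vs.span S"
    by (rule poly_vs.maximal_independent_subset)
  obtain L where L: "Vector_Spaces.linear (\<lambda>c p. pconst c * p) (*) L" "\<forall>x\<in>S. L x = \<psi> x"
    using poly_functional.linear_independent_extend[OF S(2), of \<psi>] by blast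
  interpret L: Vector_Spaces.linear "\<lambda>c p. pconst c * p" "(*)" L by fact
  have \<psi>0: "\<psi> 0 = 0" using \<psi>(2)[OF \<open>0 \<in> W\<close>, of 0] by simp
  have "p \<in> W \<and> L p = \<psi> p" if "p \<in> poly_vs.span S" for p
    using that
  proof (induction rule: poly_vs.span_induct_alt)
    case base
    then show ?case using \<open>0 \<in> W\<close> \<psi>0 L.zero by simp
  next
    case (step c x y)
    then have "x \<in> W" "L x = \<psi> x" using S L by auto
    then show ?case using step W \<psi> L.add L.scale by simp
  qed
  then show thesis using that[of L] L.add L.scale S(3) by blast
qed

section \<open>Graded quotients of the polynomial ring\<close>

text \<open>A presentation \<open>\<Phi>\<close> of \<open>A\<close> as the quotient of \<open>P\<close> by a homogeneous ideal modulo which the order ideal is a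
basis. The ring itself is arbitrary, because this applies both to the associated graded ring and
to its localization.\<close>

locale graded_quotient = O: bordered_order_ideal n ts bs + T: term_basis n "set ts" I "(=)" + A: cring A
  for n :: nat and ts bs :: "nat pterm list" and I :: "(nat, 'k::field) mpoly set"
    and A :: "('a, 'm) ring_scheme" (structure) +
  fixes \<Phi> :: "(nat, 'k) mpoly \<Rightarrow> 'a"
  assumes hom: "\<Phi> \<in> Ring.ring_hom (aff_ring n) A"
    and surj: "\<Phi> ` polys n = carrier A"
    and kernel: "f \<in> polys n \<Longrightarrow> \<Phi> f = \<zero> \<longleftrightarrow> f \<in> I"
begin

lemma \<Phi>_closed [simp]: "f \<in> polys n \<Longrightarrow> \<Phi> f \<in> carrier A"
  using surj by blast

lemma \<Phi>_simps:
  "f \<in> polys n \<Longrightarrow> g \<in> polys n \<Longrightarrow> \<Phi> (f + g) = \<Phi> f \<oplus> \<Phi> g"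
  "f \<in> polys n \<Longrightarrow> g \<in> polys n \<Longrightarrow> \<Phi> (f * g) = \<Phi> f \<otimes> \<Phi> g"
  "\<Phi> 1 = \<one>"
  using ring_hom_add[OF hom, of f g] ring_hom_mult[OF hom, of f g] ring_hom_one[OF hom] by simp_all

lemma \<Phi>_ring_hom: "ring_hom_ring (aff_ring n) A \<Phi>"
  using hom mpoly_ring_ring A.ring_axioms by (intro ring_hom_ringI2)

lemma \<Phi>_0: "\<Phi> 0 = \<zero>"
  using kernel[of 0] T.ideal_closed(2) by simp

lemma \<Phi>_eqI:
  assumes "f \<in> polys n" "g \<in> polys n" "f - g \<in> I"
  shows "\<Phi> f = \<Phi> g"
proof -
  have "\<Phi> f = \<Phi> ((f - g) + g)" by simp
  also have "\<dots> = \<Phi> (f - g) \<oplus> \<Phi> g" using assms(1,2) by (intro \<Phi>_simps mpoly_diff_closed)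
  also have "\<Phi> (f - g) = \<zero>" using kernel[of "f - g"] assms by simp
  finally show ?thesis using assms(2) by simp
qed

lemma \<Phi>_eqD:
  assumes "f \<in> polys n" "g \<in> polys n" "\<Phi> f = \<Phi> g"
  shows "f - g \<in> I"
proof -
  have "\<Phi> (f - g) \<oplus> \<Phi> g = \<Phi> ((f - g) + g)" using assms(1,2) by (intro \<Phi>_simps(1)[symmetric] mpoly_diff_closed)
  also have "\<dots> = \<Phi> g" using assms(3) by simp
  finally have "\<Phi> (f - g) = \<zero>" using A.add.r_cancel_one[of "\<Phi> g" "\<Phi> (f - g)"] assms(1,2) by simp
  then show ?thesis using kernel[of "f - g"] assms(1,2) by simp
qed

lemma \<Phi>_preimage: "x \<in> carrier A \<Longrightarrow> \<exists>f\<in>polys n. x = \<Phi> f"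
  using surj by blast

lemma preimage_ideal:
  assumes "ideal J A"
  shows "ideal {f \<in> polys n. \<Phi> f \<in> J} (aff_ring n)"
  using ring_hom_ring.ideal_vimage[OF \<Phi>_ring_hom assms] .

lemma \<Phi>_in_ideal:
  assumes J: "ideal J A" and p: "keys p \<subseteq> terms_in {..<n}"
    and terms: "\<And>t. t \<in> keys p \<Longrightarrow> \<Phi> (pmonom t) \<in> J"
  shows "\<Phi> p \<in> J"
proof -
  note P = mpoly_ideal_closed[OF preimage_ideal[OF J]]
  have "(\<Sum>t\<in>keys p. pconst (lookup p t) * pmonom t)
      \<in> {f \<in> polys n. \<Phi> f \<in> J}"
    by (intro mpoly_ideal_sum[OF preimage_ideal[OF J]] P(7)) (use p terms in auto)
  then show ?thesis by (simp flip: poly_expand)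
qed

abbreviation top_deg :: nat where
  "top_deg \<equiv> tdeg (last ts)"

lemma last_in_ts: "last ts \<in> set ts"
  using O.ts_nonempty by simp

lemma high_degree_in_I:
  assumes "f \<in> polys n" "\<And>t. t \<in> keys f \<Longrightarrow> top_deg < tdeg t"
  shows "f \<in> I"
proof -
  have "keys (T.NF f) = {}"
    using T.NF(1)[OF assms(1)] assms(2) O.tdeg_le_last by fastforce
  then show ?thesis using T.NF_0_iff[OF assms(1)] by simp
qed

text \<open>Reduction preserves degrees, and \<open>1\<close> is the only term of degree \<open>0\<close>.\<close>

lemma lookup_NF_0:
  assumes f: "f \<in> polys n"
  shows "lookup (T.NF f) 0 = lookup f 0"
proof -
  define c where "c = pconst (lookup f 0) * pmonom (0 :: nat pterm)"
  have c: "c \<in> polys n" by (simp add: c_def)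
  have keys_c: "keys c \<subseteq> set ts"
    using keys_pconst_mult[of "lookup f 0" "pmonom (0 :: nat pterm)"] O.zero_in_ts
    unfolding c_def keys_pmonom by blast
  have fc: "f - c \<in> polys n" using f c by simp
  have 0: "0 \<notin> keys (f - c)"
    by (simp add: c_def in_keys_iff lookup_minus lookup_pconst_0)
  have "0 \<notin> keys (T.NF (f - c))"
  proof
    assume "0 \<in> keys (T.NF (f - c))"
    then obtain t where "t \<in> keys (f - c)" "tdeg (0 :: nat pterm) = tdeg t"
      using T.NF(1)[OF fc] by blast
    then show False using 0 by (metis tdeg_0 tdeg_eq_0_iff)
  qed
  moreover have "T.NF f = T.NF c + T.NF (f - c)" using T.NF_add[OF c fc] by simp
  ultimately have "lookup (T.NF f) 0 = lookup c 0"
    using T.NF_id[OF keys_c] by (simp add: lookup_add in_keys_iff)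
  then show ?thesis by (simp add: c_def lookup_pconst_0)
qed

lemma I_no_constant: "f \<in> I \<Longrightarrow> lookup f 0 = 0"
  using lookup_NF_0[of f] T.NF_0_iff[of f] T.ideal_closed(1) by (metis lookup_zero)

definition aug :: "(nat, 'k) mpoly set" where
  "aug = {f \<in> polys n. lookup f 0 = 0}"

lemma aug_ideal: "ideal aug (aff_ring n)"
  by (rule mpoly_idealI) (auto simp: aug_def lookup_add lookup_mult_0)

definition \<mm> :: "'a set" where
  "\<mm> = \<Phi> ` aug"

lemma \<mm>_ideal: "ideal \<mm> A"
  unfolding \<mm>_def by (rule surj_hom_ideal_image[OF hom surj mpoly_ring_ring A.ring_axioms aug_ideal])

lemma augD: "f \<in> aug \<Longrightarrow> f \<in> polys n"
  by (simp add: aug_def)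

lemma aug_keys: "f \<in> aug \<Longrightarrow> t \<in> keys f \<Longrightarrow> 1 \<le> tdeg t"
  by (cases "t = 0") (auto simp: aug_def in_keys_iff Suc_le_eq intro: gr0I)

lemma \<Phi>_in_\<mm>_iff:
  assumes f: "f \<in> polys n"
  shows "\<Phi> f \<in> \<mm> \<longleftrightarrow> f \<in> aug"
proof
  assume "\<Phi> f \<in> \<mm>"
  then obtain g where g: "g \<in> aug" "\<Phi> f = \<Phi> g" by (auto simp: \<mm>_def)
  then have "lookup (f - g) 0 = 0" using \<Phi>_eqD[OF f augD] I_no_constant by blast
  then show "f \<in> aug" using g(1) f by (simp add: aug_def lookup_minus)
qed (auto simp: \<mm>_def)

lemma aug_power_keys: "f \<in> aug \<Longrightarrow> t \<in> keys (f ^ k) \<Longrightarrow> k \<le> tdeg t"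
proof (induction k arbitrary: t)
  case (Suc k)
  have "t \<in> keys (f * f ^ k)" using Suc.prems(2) by simp
  then obtain s u where "t = s + u" "s \<in> keys f" "u \<in> keys (f ^ k)"
    using keys_mult[of f "f ^ k"] by blast
  then show ?case using Suc.IH[of u] Suc.prems(1) aug_keys[of f s] by (simp add: tdeg_add)
qed simp

text \<open>Let \<open>c\<close> be the constant term of \<open>f\<close>. Then \<open>g = 1 - f / c\<close> has no constant term, so its powers end up in degrees
where everything is zero, and the geometric series of \<open>g\<close> is an inverse of \<open>f / c\<close>.\<close>

lemma nonunits:
  assumes "x \<in> carrier A" "x \<notin> \<mm>"
  shows "x \<in> Units A"
proof -
  obtain f where f: "f \<in> polys n" "x = \<Phi> f" using \<Phi>_preimage[OF assms(1)] by blast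
  define c where "c = lookup f 0"
  have c: "c \<noteq> 0" using assms(2) f by (auto simp: \<Phi>_in_\<mm>_iff aug_def c_def)
  define g where "g = 1 - pconst (1 / c) * f"
  have g: "g \<in> aug" using f c by (simp add: g_def aug_def lookup_minus lookup_pconst_mult c_def)
  let ?N = "Suc top_deg"
  define h where "h = pconst (1 / c) * (\<Sum>i<?N. g ^ i)"
  have h: "h \<in> polys n" using augD[OF g] by (simp add: h_def)
  have "f * h = (1 - g) * (\<Sum>i<?N. g ^ i)" by (simp add: h_def g_def)
  also have "\<dots> = 1 - g ^ ?N" by (rule one_diff_power_eq[symmetric])
  finally have "1 - f * h = g ^ ?N" by simp
  also have "g ^ ?N \<in> I"
    using aug_power_keys[OF g, of _ ?N] augD[OF g] by (intro high_degree_in_I mpoly_power_closed) (auto simp: Suc_le_eq)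
  finally have "\<Phi> 1 = \<Phi> (f * h)" using f h by (intro \<Phi>_eqI) auto
  then have "x \<otimes> \<Phi> h = \<one>" using f h by (simp add: \<Phi>_simps)
  then show ?thesis using f h A.m_comm[of x "\<Phi> h"] unfolding Units_def by auto
qed

lemma NF_image: "f \<in> polys n \<Longrightarrow> \<Phi> (T.NF f) = \<Phi> f"
  using T.NF(2)[of f] T.NF_closed[of f] \<Phi>_eqI[of f "T.NF f"] by simp

lemma order_term_notin_I: "t \<in> set ts \<Longrightarrow> pmonom t \<notin> I"
proof
  assume "t \<in> set ts" "pmonom t \<in> I"
  then have "pmonom t = (0 :: (nat, 'k) mpoly)" by (intro T.indep) auto
  then have "keys (pmonom t :: (nat, 'k) mpoly) = {}" by simp
  then show False unfolding keys_pmonom by simp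
qed

text \<open>In the order of descending degree, the product of \<open>t\<^sub>k\<close> with an element of \<open>\<mm>\<close> is a combination of terms of
larger degree, all of which come earlier in the list.\<close>

sublocale local_chain_ring A \<mm> "map (\<lambda>t. \<Phi> (pmonom t)) (rev ts)"
proof (intro local_chain_ring.intro local_chain_ring_axioms.intro)
  show "cring A" by (rule A.cring_axioms)
  show "ideal \<mm> A" by (rule \<mm>_ideal)
  show "\<And>a. a \<in> carrier A \<Longrightarrow> a \<notin> \<mm> \<Longrightarrow> a \<in> Units A" by (rule nonunits)
  show closed: "set (map (\<lambda>t. \<Phi> (pmonom t)) (rev ts)) \<subseteq> carrier A"
    using O.ts_terms by (auto simp: subset_iff)
  show "map (\<lambda>t. \<Phi> (pmonom t)) (rev ts) \<noteq> []" using O.ts_nonempty by simp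
  show "hd (map (\<lambda>t. \<Phi> (pmonom t)) (rev ts)) \<noteq> \<zero>"
    using O.ts_nonempty kernel[of "pmonom (last ts)"] order_term_notin_I[OF last_in_ts] O.ts_terms last_in_ts
    by (simp add: hd_map hd_rev subset_iff)
  have "\<one> = \<Phi> (pmonom 0)" by (simp add: \<Phi>_simps)
  then have "\<one> \<in> (\<lambda>t. \<Phi> (pmonom t)) ` set ts" using O.zero_in_ts by (intro image_eqI[of _ _ 0])
  then have "\<one> \<in> set (map (\<lambda>t. \<Phi> (pmonom t)) (rev ts))" by simp
  then show "\<one> \<in> Idl (set (map (\<lambda>t. \<Phi> (pmonom t)) (rev ts)))"
    using A.genideal_self[OF closed] by blast
  fix k x assume k: "k < length (map (\<lambda>t. \<Phi> (pmonom t)) (rev ts))" and x: "x \<in> \<mm>"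
  let ?as = "map (\<lambda>t. \<Phi> (pmonom t)) (rev ts)"
  \<comment> \<open>The \<open>k\<close>-th element of the reversed list.\<close>
  let ?t = "ts ! (length ts - Suc k)"
  have k': "k < length ts" using k by simp
  obtain g where g: "g \<in> aug" "x = \<Phi> g" using x by (auto simp: \<mm>_def)
  have t: "pmonom ?t \<in> polys n" using k' by simp
  have gt: "g * pmonom ?t \<in> polys n" using augD[OF g(1)] t by (rule mpoly_mult_closed)
  have gens: "set (take k ?as) \<subseteq> carrier A" using closed set_take_subset[of k ?as] by blast
  have "\<Phi> (T.NF (g * pmonom ?t)) \<in> Idl (set (take k ?as))"
  proof (rule \<Phi>_in_ideal)
    show "ideal (Idl (set (take k ?as))) A" using gens by (rule A.genideal_ideal)
    show "keys (T.NF (g * pmonom ?t)) \<subseteq> terms_in {..<n}"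
      using T.NF_closed[OF gt] by (simp add: carrier_mpoly_ring)
    fix s assume "s \<in> keys (T.NF (g * pmonom ?t))"
    then obtain u where u: "s \<in> set ts" "u \<in> keys (g * pmonom ?t)" "tdeg s = tdeg u"
      using T.NF(1)[OF gt] by blast
    obtain v where "v \<in> keys g" "u = v + ?t"
      using u(2) keys_mult[of g "pmonom ?t"] by auto
    then have deg: "tdeg ?t < tdeg s" using aug_keys[OF g(1), of v] u(3) by (simp add: tdeg_add)
    obtain i where i: "i < length ts" "s = ts ! i" using u(1) by (metis in_set_conv_nth)
    have "length ts - Suc k < i"
    proof (rule ccontr)
      assume "\<not> length ts - Suc k < i"
      then have "map tdeg ts ! i \<le> map tdeg ts ! (length ts - Suc k)"
        using k' by (intro sorted_nth_mono[OF O.sorted_ts]) auto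
      then show False using deg i k' by simp
    qed
    then have j: "length ts - Suc i < k" "length ts - Suc i < length ts" using i(1) k' by auto
    have "take k ?as ! (length ts - Suc i) = \<Phi> (pmonom s)"
      using j i by (simp add: rev_nth)
    moreover have "length ts - Suc i < length (take k ?as)" using j by simp
    ultimately have "\<Phi> (pmonom s) \<in> set (take k ?as)" by (metis nth_mem)
    then show "\<Phi> (pmonom s) \<in> Idl (set (take k ?as))" using A.genideal_self[OF gens] by blast
  qed
  then show "x \<otimes> ?as ! k \<in> Idl (set (take k ?as))"
    using NF_image[OF gt] g k' t augD[OF g(1)] by (simp add: \<Phi>_simps rev_nth)
qed

lemma maximalideal_iff: "maximalideal J A \<longleftrightarrow> J = \<mm>"
proof -
  have one: "\<one> \<notin> \<mm>" using \<Phi>_in_\<mm>_iff[of 1] by (simp add: \<Phi>_simps aug_def)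
  have unit: "J = carrier A" if "ideal J A" "x \<in> J" "x \<notin> \<mm>" for J x
  proof -
    interpret J: ideal J A by fact
    have u: "x \<in> Units A" using nonunits[OF J.Icarr[OF that(2)] that(3)] .
    have "inv x \<otimes> x \<in> J" by (rule J.I_l_closed[OF that(2) A.Units_inv_closed[OF u]])
    then show ?thesis using A.Units_l_inv[OF u] J.one_imp_carrier by simp
  qed
  have max: "maximalideal \<mm> A"
  proof (rule maximalidealI[OF \<mm>_ideal])
    show "carrier A \<noteq> \<mm>" using one by auto
    show "J = \<mm> \<or> J = carrier A" if "ideal J A" "\<mm> \<subseteq> J" "J \<subseteq> carrier A" for J
      using unit[OF that(1)] that(2) by blast
  qed
  moreover have "J = \<mm>" if "maximalideal J A"
  proof -
    interpret J: maximalideal J A by fact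
    have "J \<subseteq> \<mm>" using unit[OF J.is_ideal] J.I_notcarr by blast
    moreover have "\<mm> \<subseteq> carrier A" using ideal.Icarr[OF \<mm>_ideal] by blast
    ultimately show ?thesis using J.I_maximal[OF \<mm>_ideal] one by auto
  qed
  ultimately show ?thesis by blast
qed

text \<open>An ideal is generated by a vector space basis of its preimage in the finite-dimensional space of
combinations of order ideal terms.\<close>

lemma noetherian: "noetherian_ring A"
proof (rule A.noetherian_ringI)
  fix J assume J: "ideal J A"
  let ?W = "{p. keys p \<subseteq> set ts \<and> \<Phi> p \<in> J}"
  obtain S where S: "S \<subseteq> ?W" "poly_vs.independent S" "?W \<subseteq> poly_vs.span S"
    by (rule poly_vs.maximal_independent_subset)
  have "?W \<subseteq> poly_vs.span (pmonom ` set ts)"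
  proof
    fix p assume "p \<in> ?W"
    then have "p = (\<Sum>t\<in>set ts. pconst (lookup p t) * pmonom t)"
      by (intro poly_expand_superset) auto
    also have "\<dots> \<in> poly_vs.span (pmonom ` set ts)"
      by (intro poly_vs.span_sum poly_vs.span_scale poly_vs.span_base) auto
    finally show "p \<in> poly_vs.span (pmonom ` set ts)" .
  qed
  then have fin: "finite S"
    using poly_vs.independent_span_bound[of "pmonom ` set ts" S] S by auto
  have S_poly: "p \<in> polys n" if "p \<in> S" for p
    using that S(1) by (intro T.keys_B_closed) blast
  then have S_closed: "\<Phi> ` S \<subseteq> carrier A" by auto
  note Idl = A.genideal_ideal[OF S_closed]
  note P = mpoly_ideal_closed[OF preimage_ideal[OF Idl]]
  have span: "p \<in> {f \<in> polys n. \<Phi> f \<in> Idl (\<Phi> ` S)}" if "p \<in> poly_vs.span S" for p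
    using that
  proof (induction rule: poly_vs.span_induct_alt)
    case base
    then show ?case by (rule P(2))
  next
    case (step c x y)
    have "x \<in> {f \<in> polys n. \<Phi> f \<in> Idl (\<Phi> ` S)}"
      using step(1) S_poly A.genideal_self[OF S_closed] by blast
    then show ?case using step(2) by (intro P(3) P(7)) auto
  qed
  have "J \<subseteq> Idl (\<Phi> ` S)"
  proof
    fix x assume x: "x \<in> J"
    then obtain f where f: "f \<in> polys n" "x = \<Phi> f"
      using \<Phi>_preimage ideal.Icarr[OF J] by blast
    then have "T.NF f \<in> ?W" using x NF_image T.NF_keys by simp
    then have "\<Phi> (T.NF f) \<in> Idl (\<Phi> ` S)" using span[of "T.NF f"] S(3) by blast
    then show "x \<in> Idl (\<Phi> ` S)" using f NF_image by simp
  qed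
  moreover have "Idl (\<Phi> ` S) \<subseteq> J" using S(1) by (intro A.genideal_minimal[OF J]) auto
  ultimately show "\<exists>G\<subseteq>carrier A. finite G \<and> J = Idl G"
    using S_closed fin by (intro exI[of _ "\<Phi> ` S"]) auto
qed

end

section \<open>Localization at units\<close>

text \<open>Inverting units changes a ring only up to isomorphism: \<open>loc\<close> below is bijective.\<close>

locale unit_fractions = cring R for R (structure) +
  fixes S :: "'a set"
  assumes units: "S \<subseteq> Units R" and one_S: "\<one> \<in> S" and mult_S: "s \<in> S \<Longrightarrow> t \<in> S \<Longrightarrow> s \<otimes> t \<in> S"
begin

lemma S_closed: "s \<in> S \<Longrightarrow> s \<in> carrier R"
  using units Units_closed by blast

lemma mem_fraction_iff:
  assumes "r \<in> carrier R" "s \<in> S"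
  shows "(r', s') \<in> fraction R S r s \<longleftrightarrow> r' \<in> carrier R \<and> s' \<in> S \<and> r \<otimes> s' = r' \<otimes> s"
  unfolding fraction_def using assms one_S S_closed units Units_l_cancel by (auto intro!: bexI[of _ \<one>])

lemma fraction_cancel:
  assumes "a \<in> carrier R" "s \<in> S"
  shows "fraction R S (a \<otimes> s) s = fraction R S a \<one>"
proof (rule Set.set_eqI)
  fix x :: "'a \<times> 'a"
  obtain r' s' where x: "x = (r', s')" by (cases x)
  have "(a \<otimes> s) \<otimes> s' = r' \<otimes> s \<longleftrightarrow> a \<otimes> s' = r' \<otimes> \<one>" if "r' \<in> carrier R" "s' \<in> S"
  proof -
    have "(a \<otimes> s) \<otimes> s' = s \<otimes> (a \<otimes> s')" "r' \<otimes> s = s \<otimes> r'"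
      using assms that S_closed by (simp_all add: m_ac)
    then show ?thesis using Units_l_cancel[of s "a \<otimes> s'" r'] assms that units S_closed by auto
  qed
  then show "x \<in> fraction R S (a \<otimes> s) s \<longleftrightarrow> x \<in> fraction R S a \<one>"
    unfolding x using assms S_closed one_S by (subst (1 2) mem_fraction_iff) auto
qed

lemma mem_fraction_one:
  assumes "a \<in> carrier R"
  shows "x \<in> fraction R S a \<one> \<longleftrightarrow> (\<exists>s\<in>S. x = (a \<otimes> s, s))"
  using assms one_S S_closed by (cases x) (auto simp: mem_fraction_iff)

abbreviation fractions where "fractions \<equiv> ring_of_fractions R S"

definition loc :: "'a \<Rightarrow> ('a \<times> 'a) set" where
  "loc a = fraction R S a \<one>"

text \<open>Sums and products of fractions are unions over all representatives; the representatives of \<open>loc a\<close> are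
the pairs \<open>(a s, s)\<close>.\<close>

lemma union_over_fractions:
  assumes ab: "a \<in> carrier R" "b \<in> carrier R"
    and F: "\<And>s t. s \<in> S \<Longrightarrow> t \<in> S \<Longrightarrow> F (a \<otimes> s) s (b \<otimes> t) t = Z"
  shows "(\<Union>(r, s)\<in>loc a. \<Union>(r', s')\<in>loc b. F r s r' s') = Z"
proof -
  have "loc a = (\<lambda>s. (a \<otimes> s, s)) ` S" "loc b = (\<lambda>s. (b \<otimes> s, s)) ` S"
    using mem_fraction_one ab by (auto simp: loc_def)
  then have "(\<Union>(r, s)\<in>loc a. \<Union>(r', s')\<in>loc b. F r s r' s') = (\<Union>s\<in>S. \<Union>t\<in>S. F (a \<otimes> s) s (b \<otimes> t) t)"
    by simp
  also have "\<dots> = (\<Union>s\<in>S. \<Union>t\<in>S. Z)" using F by simp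
  also have "\<dots> = Z" using one_S by auto
  finally show ?thesis .
qed

lemma loc_hom: "loc \<in> Ring.ring_hom R fractions"
proof (rule ring_hom_memI)
  fix a b assume ab: "a \<in> carrier R" "b \<in> carrier R"
  show "loc a \<in> carrier fractions" using ab one_S by (auto simp: ring_of_fractions_def loc_def)
  have "fraction R S ((a \<otimes> s) \<otimes> (b \<otimes> t)) (s \<otimes> t) = loc (a \<otimes> b)" if "s \<in> S" "t \<in> S" for s t
  proof -
    have "(a \<otimes> s) \<otimes> (b \<otimes> t) = (a \<otimes> b) \<otimes> (s \<otimes> t)" using ab that S_closed by (simp add: m_ac)
    then show ?thesis using fraction_cancel[of "a \<otimes> b" "s \<otimes> t"] ab mult_S[OF that] by (simp add: loc_def)
  qed
  then show "loc (a \<otimes> b) = loc a \<otimes>\<^bsub>fractions\<^esub> loc b"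
    using union_over_fractions[OF ab, of "\<lambda>r s r' s'. fraction R S (r \<otimes> r') (s \<otimes> s')"]
    by (simp add: ring_of_fractions_def)
  have "fraction R S ((a \<otimes> s) \<otimes> t \<oplus> (b \<otimes> t) \<otimes> s) (s \<otimes> t) = loc (a \<oplus> b)" if "s \<in> S" "t \<in> S" for s t
  proof -
    have "(a \<otimes> s) \<otimes> t \<oplus> (b \<otimes> t) \<otimes> s = (a \<oplus> b) \<otimes> (s \<otimes> t)"
      using ab that S_closed by (simp add: l_distr m_assoc m_comm[of t s])
    then show ?thesis using fraction_cancel[of "a \<oplus> b" "s \<otimes> t"] ab mult_S[OF that] by (simp add: loc_def)
  qed
  then show "loc (a \<oplus> b) = loc a \<oplus>\<^bsub>fractions\<^esub> loc b"
    using union_over_fractions[OF ab, of "\<lambda>r s r' s'. fraction R S (r \<otimes> s' \<oplus> r' \<otimes> s) (s \<otimes> s')"]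
    by (simp add: ring_of_fractions_def)
next
  show "loc \<one> = \<one>\<^bsub>fractions\<^esub>" by (simp add: ring_of_fractions_def loc_def)
qed

lemma loc_surj: "loc ` carrier R = carrier fractions"
proof
  show "loc ` carrier R \<subseteq> carrier fractions" using ring_hom_closed[OF loc_hom] by auto
  show "carrier fractions \<subseteq> loc ` carrier R"
  proof
    fix X assume "X \<in> carrier fractions"
    then obtain r s where rs: "r \<in> carrier R" "s \<in> S" "X = fraction R S r s"
      by (auto simp: ring_of_fractions_def)
    then have u: "s \<in> Units R" using units by blast
    have "r = (r \<otimes> inv s) \<otimes> s" using rs(1) u Units_l_inv[OF u] by (subst m_assoc) (auto simp del: Units_l_inv)
    then have "X = loc (r \<otimes> inv s)"
      using fraction_cancel[of "r \<otimes> inv s" s] rs u by (simp add: loc_def)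
    then show "X \<in> loc ` carrier R" using rs(1) u by blast
  qed
qed

lemma loc_zero: "loc \<zero> = \<zero>\<^bsub>fractions\<^esub>"
  by (simp add: ring_of_fractions_def loc_def)

lemma loc_inj:
  assumes "a \<in> carrier R" "b \<in> carrier R" "loc a = loc b"
  shows "a = b"
proof -
  have "(a, \<one>) \<in> loc a" using mem_fraction_one[OF assms(1), of "(a, \<one>)"] assms(1) one_S
    by (auto simp: loc_def intro!: bexI[of _ \<one>])
  then show ?thesis using mem_fraction_one[OF assms(2), of "(a, \<one>)"] assms by (auto simp: loc_def)
qed

lemma fractions_cring: "cring fractions"
  using ring_of_surj_hom[OF is_cring loc_hom loc_surj loc_zero] .

end

section \<open>The Gorenstein property of graded quotients\<close>

context graded_quotient
begin

definition top_coeff :: "(nat, 'k) mpoly \<Rightarrow> 'k" where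
  "top_coeff f = lookup (T.NF f) (last ts)"

lemma top_coeff_add:
  "f \<in> polys n \<Longrightarrow> g \<in> polys n \<Longrightarrow> top_coeff (f + g) = top_coeff f + top_coeff g"
  by (simp add: top_coeff_def T.NF_add lookup_add)

lemma top_coeff_scale: "f \<in> polys n \<Longrightarrow> top_coeff (pconst c * f) = c * top_coeff f"
  by (simp add: top_coeff_def T.NF_scale lookup_pconst_mult)

lemma top_coeff_sum:
  "(\<And>i. i \<in> S \<Longrightarrow> f i \<in> polys n) \<Longrightarrow> top_coeff (sum f S) = (\<Sum>i\<in>S. top_coeff (f i))"
  by (simp add: top_coeff_def T.NF_sum lookup_sum)

lemma top_coeff_cong:
  "f \<in> polys n \<Longrightarrow> g \<in> polys n \<Longrightarrow> f - g \<in> I \<Longrightarrow> top_coeff f = top_coeff g"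
  using T.NF_eqI by (simp add: top_coeff_def)

lemma top_coeff_I: "f \<in> I \<Longrightarrow> top_coeff f = 0"
  using T.NF_0_iff[of f] T.ideal_closed(1) by (simp add: top_coeff_def)

lemma top_coeff_last: "top_coeff (pmonom (last ts)) = 1"
proof -
  have "T.NF (pmonom (last ts)) = pmonom (last ts)" using last_in_ts by (intro T.NF_id) auto
  then show ?thesis by (simp add: top_coeff_def pmonom_def)
qed

text \<open>The matrix of the bilinear form \<open>(f, g) \<mapsto> top_coeff (f g)\<close> on \<open>A\<close> with respect to the order ideal.\<close>

definition gram :: "'k mat" where
  "gram = mat (length ts) (length ts) (\<lambda>(i, j). top_coeff (pmonom (ts ! i) * pmonom (ts ! j)))"

lemma gram_carrier [simp]: "gram \<in> carrier_mat (length ts) (length ts)"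
  and gram_dims [simp]: "dim_row gram = length ts" "dim_col gram = length ts"
  by (simp_all add: gram_def)

lemma gram_mult_vec:
  assumes "i < length ts" "v \<in> carrier_vec (length ts)"
  shows "(gram *\<^sub>v v) $ i = top_coeff (pmonom (ts ! i) * lin_comb ts (\<lambda>j. v $ j))"
proof -
  have P: "pmonom (ts ! i) * pmonom (ts ! j) \<in> polys n" if "j < length ts" for j
    by (rule mpoly_mult_closed) (use assms that in auto)
  have "pmonom (ts ! i) * lin_comb ts (\<lambda>j. v $ j) =
      (\<Sum>j<length ts. pconst (v $ j) * (pmonom (ts ! i) * pmonom (ts ! j)))"
    by (simp add: lin_comb_def sum_distrib_left mult.left_commute)
  also have "top_coeff \<dots> = (\<Sum>j<length ts. top_coeff (pconst (v $ j) * (pmonom (ts ! i) * pmonom (ts ! j))))"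
    by (rule top_coeff_sum) (auto intro!: mpoly_mult_closed[OF pconst_closed] P)
  also have "\<dots> = (\<Sum>j<length ts. v $ j * gram $$ (i, j))"
    using assms by (intro sum.cong) (simp_all add: top_coeff_scale[OF P] gram_def)
  also have "\<dots> = (gram *\<^sub>v v) $ i"
    using assms by (simp add: scalar_prod_def atLeast0LessThan mult.commute)
  finally show ?thesis by simp
qed

lemma top_coeff_mult_eq_0:
  assumes a: "a \<in> polys n" and f: "f \<in> polys n"
    and 0: "\<And>i. i < length ts \<Longrightarrow> top_coeff (pmonom (ts ! i) * a) = 0"
  shows "top_coeff (f * a) = 0"
proof -
  have P: "pmonom (ts ! i) * a \<in> polys n" if "i < length ts" for i
    by (rule mpoly_mult_closed) (use a that in auto)
  have "top_coeff (f * a) = top_coeff (T.NF f * a)"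
    using T.NF_mult_NF[OF a f] by (simp add: top_coeff_def mult.commute)
  also have "T.NF f * a = (\<Sum>i<length ts. pconst (lookup (T.NF f) (ts ! i)) * (pmonom (ts ! i) * a))"
    using lin_comb_lookup[OF O.distinct_ts T.NF_keys[OF f]]
    by (metis (no_types, lifting) lin_comb_def mult.assoc sum.cong sum_distrib_right)
  also have "top_coeff \<dots> = (\<Sum>i<length ts. top_coeff (pconst (lookup (T.NF f) (ts ! i)) * (pmonom (ts ! i) * a)))"
    by (rule top_coeff_sum) (auto intro!: mpoly_mult_closed[OF pconst_closed] P)
  also have "\<dots> = 0" by (intro sum.neutral) (simp add: top_coeff_scale[OF P] 0)
  finally show ?thesis .
qed

text \<open>The coordinates of \<open>d\<close> form a vector in the kernel of the Gram matrix.\<close>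

lemma gram_nondegenerate:
  assumes det: "det gram \<noteq> 0" and d: "d \<in> polys n"
    and 0: "\<And>r. r \<in> polys n \<Longrightarrow> top_coeff (r * d) = 0"
  shows "d \<in> I"
proof -
  define v where "v = vec (length ts) (\<lambda>i. lookup (T.NF d) (ts ! i))"
  have v: "v \<in> carrier_vec (length ts)" by (simp add: v_def)
  have lc: "lin_comb ts (\<lambda>j. v $ j) = T.NF d"
    using lin_comb_lookup[OF O.distinct_ts T.NF_keys[OF d]] by (simp add: v_def lin_comb_def)
  have "gram *\<^sub>v v = 0\<^sub>v (length ts)"
  proof (rule eq_vecI)
    fix i assume i: "i < dim_vec (0\<^sub>v (length ts) :: 'k vec)"
    have P: "pmonom (ts ! i) \<in> polys n" using i by simp
    have "(gram *\<^sub>v v) $ i = top_coeff (pmonom (ts ! i) * T.NF d)" using gram_mult_vec[of i v] i v lc by simp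
    also have "\<dots> = top_coeff (pmonom (ts ! i) * d)" using T.NF_mult_NF[OF P d] by (simp add: top_coeff_def)
    finally show "(gram *\<^sub>v v) $ i = 0\<^sub>v (length ts) $ i" using i 0[OF P] by simp
  qed simp
  then have "v = 0\<^sub>v (length ts)" using det det_0_iff_vec_prod_zero_field[OF gram_carrier] v by blast
  then have "T.NF d = 0" using lc by (simp add: lin_comb_def)
  then show ?thesis using T.NF_0_iff[OF d] by simp
qed

text \<open>Let \<open>\<phi> : J \<rightarrow> A\<close> be given. The functional \<open>top_coeff \<circ> \<phi>\<close> on \<open>J\<close> extends to a linear functional on \<open>A\<close>, which is
represented by some \<open>b\<close> because the form is nondegenerate. For \<open>x \<in> J\<close> and all \<open>r\<close> it follows that
\<open>top_coeff (r \<phi>(x)) = top_coeff (\<phi>(r x)) = top_coeff (r x b)\<close>, hence \<open>\<phi>(x) = x b\<close> by nondegeneracy again.\<close>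

lemma injective_of_nondegenerate:
  assumes det: "det gram \<noteq> 0"
  shows "injective_module A (self_module A)"
  unfolding injective_module_def
proof (intro conjI allI impI)
  show "Module.module A (self_module A)" by (rule A.module_self)
  fix J \<phi> assume J: "ideal J A" and \<phi>: "\<phi> \<in> module_hom A (self_module A\<lparr>carrier := J\<rparr>) (self_module A)"
  interpret J: ideal J A by fact
  note \<phi>_hom = module_homD[OF \<phi>, simplified]
  let ?W = "{p \<in> polys n. \<Phi> p \<in> J}"
  note W = mpoly_ideal_closed[OF preimage_ideal[OF J]]
  \<comment> \<open>\<open>top_coeff\<close> is defined on polynomials, so representatives are needed.\<close>
  define pre where "pre x = (SOME f. f \<in> polys n \<and> x = \<Phi> f)" for x
  have pre: "pre x \<in> polys n" "\<Phi> (pre x) = x" if "x \<in> carrier A" for x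
  proof -
    have "\<exists>f. f \<in> polys n \<and> x = \<Phi> f" using \<Phi>_preimage[OF that] by blast
    from someI_ex[OF this] show "pre x \<in> polys n" "\<Phi> (pre x) = x" by (auto simp: pre_def)
  qed
  have top_pre: "top_coeff (pre (\<Phi> f)) = top_coeff f" if "f \<in> polys n" for f
    using that pre[of "\<Phi> f"] by (intro top_coeff_cong \<Phi>_eqD) auto
  define \<psi> where "\<psi> p = top_coeff (pre (\<phi> (\<Phi> p)))" for p
  have \<phi>c: "\<phi> (\<Phi> p) \<in> carrier A" if "p \<in> ?W" for p using \<phi>_hom(1)[of "\<Phi> p"] that by simp
  have \<psi>_mult: "\<psi> (r * p) = top_coeff (r * pre (\<phi> (\<Phi> p)))" if r: "r \<in> polys n" and p: "p \<in> ?W" for r p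
  proof -
    have q: "pre (\<phi> (\<Phi> p)) \<in> polys n" "\<Phi> (pre (\<phi> (\<Phi> p))) = \<phi> (\<Phi> p)"
      using pre \<phi>c[OF p] by auto
    have "\<phi> (\<Phi> (r * p)) = \<Phi> (r * pre (\<phi> (\<Phi> p)))" using r p q \<phi>_hom(3)[of "\<Phi> r" "\<Phi> p"] by (simp add: \<Phi>_simps)
    then show ?thesis using top_pre[of "r * pre (\<phi> (\<Phi> p))"] r q by (simp add: \<psi>_def)
  qed
  have \<psi>_add: "\<psi> (p + q) = \<psi> p + \<psi> q" if p: "p \<in> ?W" and q: "q \<in> ?W" for p q
  proof -
    have P: "pre (\<phi> (\<Phi> p)) \<in> polys n" "pre (\<phi> (\<Phi> q)) \<in> polys n"
      using pre \<phi>c p q by auto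
    have "\<phi> (\<Phi> (p + q)) = \<Phi> (pre (\<phi> (\<Phi> p)) + pre (\<phi> (\<Phi> q)))"
      using p q P pre \<phi>c \<phi>_hom(2)[of "\<Phi> p" "\<Phi> q"] by (simp add: \<Phi>_simps)
    then show ?thesis using top_pre[of "pre (\<phi> (\<Phi> p)) + pre (\<phi> (\<Phi> q))"] P by (simp add: \<psi>_def top_coeff_add)
  qed
  have \<psi>_scale: "\<psi> (pconst c * p) = c * \<psi> p" if p: "p \<in> ?W" for c p
    using \<psi>_mult[OF pconst_closed p] pre(1)[OF \<phi>c[OF p]] by (simp add: top_coeff_scale) (simp add: \<psi>_def)
  obtain L where L: "\<And>p q. L (p + q) = L p + L q" "\<And>c p. L (pconst c * p) = c * L p" "\<And>p. p \<in> ?W \<Longrightarrow> L p = \<psi> p"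
    using extend_functional[of ?W \<psi>, OF W(3) W(7)[OF _ pconst_closed] \<psi>_add \<psi>_scale W(2)] by blast
  \<comment> \<open>The coefficients \<open>\<beta>\<close> of the element \<open>b\<close> with \<open>L f = top_coeff (f b)\<close> solve \<open>gram \<beta> = w\<close>.\<close>
  define w where "w = vec (length ts) (\<lambda>i. L (pmonom (ts ! i)))"
  define \<beta> where "\<beta> = (1 / det gram) \<cdot>\<^sub>v (adj_mat gram *\<^sub>v w)"
  have w: "w \<in> carrier_vec (length ts)" by (simp add: w_def)
  note adj = adj_mat[OF gram_carrier]
  have \<beta>: "\<beta> \<in> carrier_vec (length ts)" using w adj(1) by (simp add: \<beta>_def)
  have "gram *\<^sub>v \<beta> = (1 / det gram) \<cdot>\<^sub>v (gram *\<^sub>v (adj_mat gram *\<^sub>v w))"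
    unfolding \<beta>_def using w adj(1) by (intro mult_mat_vec[of _ "length ts" "length ts"]) auto
  also have "gram *\<^sub>v (adj_mat gram *\<^sub>v w) = (gram * adj_mat gram) *\<^sub>v w"
    using w adj(1) by (intro assoc_mult_mat_vec[symmetric]) auto
  also have "\<dots> = det gram \<cdot>\<^sub>v w"
    using w adj(2) by (intro eq_vecI) auto
  finally have gram_\<beta>: "gram *\<^sub>v \<beta> = w" using det w by (simp add: smult_smult_assoc)
  define b where "b = lin_comb ts (\<lambda>j. \<beta> $ j)"
  have b: "b \<in> polys n" by (simp add: b_def)
  have b_top: "top_coeff (pmonom (ts ! i) * b) = L (pmonom (ts ! i))" if "i < length ts" for i
    using gram_mult_vec[OF that \<beta>] gram_\<beta> that by (simp add: b_def w_def)
  have L_b: "top_coeff (q * b) = \<psi> q" if q: "q \<in> ?W" for q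
  proof -
    have qP: "q \<in> polys n" using q by simp
    have P: "pmonom (ts ! i) * b \<in> polys n" if "i < length ts" for i
      by (rule mpoly_mult_closed) (use b that in auto)
    have L_sum: "L (sum h S) = (\<Sum>i\<in>S. L (h i))" if "finite S" for h and S :: "nat set"
      using that L(2)[of 0 0] by (induction S rule: finite_induct) (simp_all add: L(1))
    have NFq: "T.NF q = (\<Sum>i<length ts. pconst (lookup (T.NF q) (ts ! i)) * pmonom (ts ! i))"
      using lin_comb_lookup[OF O.distinct_ts T.NF_keys[OF qP]] by (simp add: lin_comb_def)
    have "top_coeff (q * b) = top_coeff (T.NF q * b)"
      using T.NF_mult_NF[OF b qP] by (simp add: top_coeff_def mult.commute)
    also have "T.NF q * b = (\<Sum>i<length ts. pconst (lookup (T.NF q) (ts ! i)) * (pmonom (ts ! i) * b))"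
      by (subst NFq) (simp add: sum_distrib_right mult.assoc)
    also have "top_coeff \<dots> = (\<Sum>i<length ts. lookup (T.NF q) (ts ! i) * L (pmonom (ts ! i)))"
      by (subst top_coeff_sum) (auto intro!: mpoly_mult_closed[OF pconst_closed] P sum.cong simp: top_coeff_scale[OF P] b_top)
    also have "\<dots> = L (T.NF q)"
      by (subst (2) NFq) (simp add: L_sum L(2))
    also have "\<dots> = L q"
    proof -
      have d: "q - T.NF q \<in> I" using T.NF(2)[OF qP] .
      then have "\<Phi> (q - T.NF q) = \<zero>" using kernel T.ideal_closed(1) by simp
      then have dW: "q - T.NF q \<in> ?W" using T.ideal_closed(1)[OF d] J.zero_closed by simp
      have "\<phi> \<zero> = \<zero>" using \<phi>_hom(3)[of \<zero> \<zero>] \<phi>_hom(1)[of \<zero>] J.zero_closed by simp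
      then have "\<psi> (q - T.NF q) = top_coeff (pre (\<Phi> 0))" using \<open>\<Phi> (q - T.NF q) = \<zero>\<close> \<Phi>_0 by (simp add: \<psi>_def)
      also have "\<dots> = 0" using top_pre[of 0] top_coeff_I[OF T.ideal_closed(2)] by simp
      finally have "L (q - T.NF q) = 0" using L(3)[OF dW] by simp
      then show ?thesis using L(1)[of "q - T.NF q" "T.NF q"] by simp
    qed
    finally show ?thesis using L(3)[OF q] by simp
  qed
  have rep: "\<phi> x = x \<otimes> \<Phi> b" if x: "x \<in> J" for x
  proof -
    obtain q where q: "q \<in> polys n" "x = \<Phi> q" using \<Phi>_preimage[OF J.Icarr[OF x]] by blast
    then have qW: "q \<in> ?W" using x by simp
    have P: "pre (\<phi> x) \<in> polys n" "\<Phi> (pre (\<phi> x)) = \<phi> x" using pre \<phi>_hom(1)[OF x] by auto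
    have "pre (\<phi> x) - q * b \<in> I"
    proof (rule gram_nondegenerate[OF det])
      show "pre (\<phi> x) - q * b \<in> polys n" using P q b by simp
      fix r :: "(nat, 'k) mpoly" assume r: "r \<in> polys n"
      have "r * q \<in> ?W" using W(7)[OF qW r] .
      then have *: "top_coeff ((r * q) * b) = top_coeff (r * pre (\<phi> x))"
        using L_b[of "r * q"] \<psi>_mult[OF r qW] q(2) by simp
      have "r * (pre (\<phi> x) - q * b) + (r * q) * b = r * pre (\<phi> x)" by (simp add: algebra_simps)
      moreover have "top_coeff (r * (pre (\<phi> x) - q * b) + (r * q) * b)
          = top_coeff (r * (pre (\<phi> x) - q * b)) + top_coeff ((r * q) * b)"
        using r P q b by (intro top_coeff_add mpoly_mult_closed mpoly_diff_closed)
      ultimately show "top_coeff (r * (pre (\<phi> x) - q * b)) = 0" using * by simp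
    qed
    then have "\<Phi> (pre (\<phi> x)) = \<Phi> (q * b)" using P q b by (intro \<Phi>_eqI) auto
    then show ?thesis using P q b by (simp add: \<Phi>_simps)
  qed
  have "(\<lambda>x. x \<otimes> \<Phi> b) \<in> module_hom A (self_module A) (self_module A)"
    using b by (auto simp: module_hom_def A.l_distr A.m_assoc)
  then show "\<exists>g\<in>module_hom A (self_module A) (self_module A). \<forall>x\<in>J. g x = \<phi> x"
    using rep by (intro bexI[of _ "\<lambda>x. x \<otimes> \<Phi> b"]) auto
qed

lemma aug_mult_socle:
  assumes g: "g \<in> aug" and a: "a \<in> polys n"
    and 0: "\<And>t. t \<in> terms_in {..<n} \<Longrightarrow> t \<noteq> 0 \<Longrightarrow> pmonom t * a \<in> I"
  shows "g * a \<in> I"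
proof -
  have "g * a = (\<Sum>t\<in>keys g. pconst (lookup g t) * (pmonom t * a))"
    by (subst (1) poly_expand[of g]) (simp add: sum_distrib_right mult.assoc)
  also have "\<dots> \<in> I"
  proof (rule mpoly_ideal_sum[OF T.ideal])
    fix t assume "t \<in> keys g"
    then have "pmonom t * a \<in> I" using aug_keys[OF g, of t] augD[OF g] by (intro 0) (auto simp: carrier_mpoly_ring)
    then show "pconst (lookup g t) * (pmonom t * a) \<in> I" by (rule T.ideal_closed(7)) (rule pconst_closed)
  qed
  finally show ?thesis .
qed

lemma high_term_mult:
  assumes "t \<in> terms_in {..<n}" "a \<in> polys n" "top_deg < tdeg t"
  shows "pmonom t * a \<in> I"
proof -
  have "pmonom t \<in> I" using assms by (intro high_degree_in_I) auto
  then show ?thesis using assms(2) by (rule T.ideal_closed(6))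
qed

text \<open>Multiply \<open>a\<close> by a term of the largest degree for which the product is not in \<open>I\<close>.\<close>

lemma socle_term:
  assumes a: "a \<in> polys n" "a \<notin> I"
  obtains t where "t \<in> terms_in {..<n}" "pmonom t * a \<notin> I"
    "\<And>u. u \<in> terms_in {..<n} \<Longrightarrow> u \<noteq> 0 \<Longrightarrow> pmonom u * (pmonom t * a) \<in> I"
proof -
  let ?D = "{d. \<exists>t\<in>terms_in {..<n}. tdeg t = d \<and> pmonom t * a \<notin> I}"
  have "tdeg 0 \<in> ?D" using a by (intro CollectI bexI[of _ 0]) auto
  then have ne: "?D \<noteq> {}" by blast
  have fin: "finite ?D"
    using high_term_mult[OF _ a(1)] by (intro finite_subset[of ?D "{..top_deg}"]) (auto simp: not_less[symmetric])
  from Max_in[OF fin ne] obtain t where t: "t \<in> terms_in {..<n}" "tdeg t = Max ?D" "pmonom t * a \<notin> I" by blast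
  show thesis
  proof (rule that[OF t(1,3)])
    fix u :: "nat pterm" assume u: "u \<in> terms_in {..<n}" "u \<noteq> 0"
    have "tdeg (u + t) \<notin> ?D"
      using Max_ge[OF fin, of "tdeg (u + t)"] u t(2) by (auto simp: tdeg_add simp flip: neq0_conv)
    then have "pmonom (u + t) * a \<in> I" using u t(1) by auto
    then show "pmonom u * (pmonom t * a) \<in> I" by (simp add: mult.assoc flip: pmonom_mult)
  qed
qed

text \<open>The terms of maximal degree lie in the socle, so by one-dimensionality they are multiples of one
another, which is possible only if there is just one of them. A nonzero \<open>a\<close> in the radical of the
form has a nonzero multiple in the socle, of which \<open>t\<^sub>\<mu>\<close> is a multiple in turn; but then \<open>t\<^sub>\<mu>\<close> would lie in the
radical as well, although \<open>top_coeff\<close> is \<open>1\<close> at \<open>t\<^sub>\<mu>\<close>.\<close>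

lemma nondegenerate_of_injective:
  assumes inj: "injective_module A (self_module A)"
  shows "top_count ts = 1" "det gram \<noteq> 0"
proof -
  have last: "last ts \<in> terms_in {..<n}" using last_in_ts O.ts_terms by blast
  \<comment> \<open>The statement on the socle, in terms of representatives.\<close>
  have socle: "\<exists>h\<in>polys n. p' - p * h \<in> I"
    if p: "p \<in> polys n" "p \<notin> I" and p': "p' \<in> polys n"
      and 0: "\<And>u. u \<in> terms_in {..<n} \<Longrightarrow> u \<noteq> 0 \<Longrightarrow> pmonom u * p' \<in> I" for p p'
  proof -
    have "x \<otimes> \<Phi> p' = \<zero>" if x: "x \<in> \<mm>" for x
    proof -
      obtain g where g: "g \<in> aug" "x = \<Phi> g" using x by (auto simp: \<mm>_def)
      have "g * p' \<in> I" using g(1) p' 0 by (rule aug_mult_socle)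
      then show ?thesis using kernel[of "g * p'"] augD[OF g(1)] p' g(2) by (simp add: \<Phi>_simps)
    qed
    moreover have "\<Phi> p \<noteq> \<zero>" using kernel p by simp
    ultimately obtain y where "y \<in> carrier A" "\<Phi> p' = \<Phi> p \<otimes> y"
      using socle_one_dimensional[OF inj, of "\<Phi> p" "\<Phi> p'"] p(1) p' by auto
    moreover then obtain h where "h \<in> polys n" "y = \<Phi> h" using \<Phi>_preimage by blast
    ultimately show ?thesis
      using \<Phi>_eqD[of p' "p * h"] p(1) p' by (auto simp: \<Phi>_simps)
  qed
  have top_socle: "pmonom u * pmonom t \<in> I"
    if "t \<in> set ts" "tdeg t = top_deg" "u \<in> terms_in {..<n}" "u \<noteq> 0" for t u :: "nat pterm"
  proof -
    have "0 < tdeg u" using that(4) tdeg_eq_0_iff[of u] by linarith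
    then show ?thesis
      unfolding pmonom_mult using that O.ts_terms by (intro high_degree_in_I) (auto simp: tdeg_add)
  qed
  have "t = last ts" if t: "t \<in> set ts" "tdeg t = top_deg" for t
  proof (rule ccontr)
    assume "t \<noteq> last ts"
    have tP: "pmonom t \<in> polys n" using t(1) O.ts_terms by auto
    have lP: "pmonom (last ts) \<in> polys n" using last by simp
    obtain h where h: "h \<in> polys n" "pmonom t - pmonom (last ts) * h \<in> I"
      using socle[OF lP order_term_notin_I[OF last_in_ts] tP top_socle[OF t]] by blast
    \<comment> \<open>Only the constant term of \<open>h\<close> contributes to \<open>t\<^sub>\<mu> h\<close>, so \<open>t\<close> and \<open>t\<^sub>\<mu>\<close> are proportional modulo \<open>I\<close>.\<close>
    define c where "c = lookup h 0"
    have "h - pconst c \<in> aug" using h(1) by (simp add: aug_def lookup_minus c_def lookup_pconst_0)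
    then have "(h - pconst c) * pmonom (last ts) \<in> I"
      using lP top_socle[OF last_in_ts refl] by (rule aug_mult_socle)
    then have "(pmonom t - pmonom (last ts) * h) + (h - pconst c) * pmonom (last ts) \<in> I"
      using h(2) by (intro T.ideal_closed(3))
    moreover have "(pmonom t - pmonom (last ts) * h) + (h - pconst c) * pmonom (last ts) =
        pmonom t - pconst c * pmonom (last ts)" by (simp add: algebra_simps)
    ultimately have "pmonom t - pconst c * pmonom (last ts) \<in> I" by (simp only:)
    moreover have "keys (pmonom t - pconst c * pmonom (last ts)) \<subseteq> set ts"
      using keys_diff[of "pmonom t" "pconst c * pmonom (last ts)"] keys_pconst_mult[of c "pmonom (last ts)"] t(1) last_in_ts
      by auto
    ultimately have "pmonom t - pconst c * pmonom (last ts) = 0" by (intro T.indep)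
    then have "lookup (pmonom t - pconst c * pmonom (last ts)) t = 0" by (simp only: lookup_zero)
    then show False using \<open>t \<noteq> last ts\<close> by (simp add: lookup_minus lookup_pconst_mult) (simp add: pmonom_def lookup_single)
  qed
  then have top_unique: "\<And>t. t \<in> set ts \<Longrightarrow> tdeg t = top_deg \<Longrightarrow> t = last ts" .
  have "i = length ts - 1" if i: "i < length ts" "tdeg (ts ! i) = tdeg (last ts)" for i
  proof -
    have "ts ! i = last ts" using i by (intro top_unique) auto
    also have "last ts = ts ! (length ts - 1)" using O.ts_nonempty by (rule last_conv_nth)
    finally show ?thesis using nth_eq_iff_index_eq[OF O.distinct_ts i(1), of "length ts - 1"] i(1) by simp
  qed
  then have "{i. i < length ts \<and> tdeg (ts ! i) = tdeg (last ts)} = {length ts - 1}"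
    using O.ts_nonempty by (auto simp: last_conv_nth)
  then show "top_count ts = 1" by (simp add: top_count_def)
  show "det gram \<noteq> 0"
  proof
    assume "det gram = 0"
    then obtain v where v: "v \<in> carrier_vec (length ts)" "v \<noteq> 0\<^sub>v (length ts)" "gram *\<^sub>v v = 0\<^sub>v (length ts)"
      using det_0_iff_vec_prod_zero_field[OF gram_carrier] by blast
    define a where "a = lin_comb ts (\<lambda>j. v $ j)"
    have a: "a \<in> polys n" by (simp add: a_def)
    have "a \<notin> I"
    proof
      assume "a \<in> I"
      then have "a = 0" using keys_lin_comb unfolding a_def by (intro T.indep)
      then have "v $ i = 0" if "i < length ts" for i
        using lookup_lin_comb[OF O.distinct_ts that, of "\<lambda>j. v $ j"] by (simp add: a_def)
      then have "v = 0\<^sub>v (length ts)" using v(1) by (intro eq_vecI) auto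
      then show False using v(2) by simp
    qed
    then obtain t where t: "t \<in> terms_in {..<n}" "pmonom t * a \<notin> I"
      "\<And>u. u \<in> terms_in {..<n} \<Longrightarrow> u \<noteq> 0 \<Longrightarrow> pmonom u * (pmonom t * a) \<in> I"
      using socle_term[OF a] by blast
    have ta: "pmonom t * a \<in> polys n" using t(1) a by simp
    have lP: "pmonom (last ts) \<in> polys n" using last by simp
    obtain h where h: "h \<in> polys n" "pmonom (last ts) - (pmonom t * a) * h \<in> I"
      using socle[OF ta t(2) lP top_socle[OF last_in_ts refl]] by blast
    have "1 = top_coeff ((pmonom t * a) * h)"
      using top_coeff_cong[OF lP _ h(2)] ta h(1) by (simp add: top_coeff_last)
    also have "(pmonom t * a) * h = (h * pmonom t) * a" by (simp add: algebra_simps)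
    also have "top_coeff \<dots> = 0"
    proof (rule top_coeff_mult_eq_0[OF a])
      show "h * pmonom t \<in> polys n" using h(1) t(1) by simp
      show "top_coeff (pmonom (ts ! i) * a) = 0" if "i < length ts" for i
        using gram_mult_vec[OF that v(1)] v(3) that by (simp add: a_def)
    qed
    finally show False by simp
  qed
qed

text \<open>As the localization has the same presentation by \<open>I\<close>, it has the same Gram matrix.\<close>

lemma localized: "graded_quotient n ts bs I (ring_of_fractions A (carrier A - \<mm>))
    (unit_fractions.loc A (carrier A - \<mm>) \<circ> \<Phi>)"
proof -
  interpret U: unit_fractions A "carrier A - \<mm>"
  proof
    show "carrier A - \<mm> \<subseteq> Units A" using nonunits by blast
    have one: "\<one> \<notin> \<mm>" using \<Phi>_in_\<mm>_iff[of 1] by (simp add: \<Phi>_simps aug_def)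
    then show "\<one> \<in> carrier A - \<mm>" by simp
    fix s t assume st: "s \<in> carrier A - \<mm>" "t \<in> carrier A - \<mm>"
    then obtain p q where "p \<in> polys n" "s = \<Phi> p" "q \<in> polys n" "t = \<Phi> q"
      using \<Phi>_preimage by blast
    then show "s \<otimes> t \<in> carrier A - \<mm>"
      using st \<Phi>_in_\<mm>_iff[of p] \<Phi>_in_\<mm>_iff[of q] \<Phi>_in_\<mm>_iff[of "p * q"]
      by (auto simp: \<Phi>_simps aug_def lookup_mult_0)
  qed
  show ?thesis
  proof (intro graded_quotient.intro graded_quotient_axioms.intro)
    show "bordered_order_ideal n ts bs" by (rule O.bordered_order_ideal_axioms)
    show "term_basis n (set ts) I (=)" by (rule T.term_basis_axioms)
    show "cring U.fractions" by (rule U.fractions_cring)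
    show "U.loc \<circ> \<Phi> \<in> Ring.ring_hom (aff_ring n) U.fractions"
      by (rule ring_hom_trans[OF hom U.loc_hom])
    show "(U.loc \<circ> \<Phi>) ` polys n = carrier U.fractions"
      using surj U.loc_surj by (metis image_comp)
    fix f :: "(nat, 'k) mpoly" assume f: "f \<in> polys n"
    have "(U.loc \<circ> \<Phi>) f = \<zero>\<^bsub>U.fractions\<^esub> \<longleftrightarrow> \<Phi> f = \<zero>"
    proof
      assume "(U.loc \<circ> \<Phi>) f = \<zero>\<^bsub>U.fractions\<^esub>"
      then have "U.loc (\<Phi> f) = U.loc \<zero>" using U.loc_zero by (simp only: o_apply)
      then show "\<Phi> f = \<zero>" by (rule U.loc_inj[OF \<Phi>_closed[OF f] A.zero_closed])
    next
      assume "\<Phi> f = \<zero>"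
      then show "(U.loc \<circ> \<Phi>) f = \<zero>\<^bsub>U.fractions\<^esub>" using U.loc_zero by (simp only: o_apply)
    qed
    then show "(U.loc \<circ> \<Phi>) f = \<zero>\<^bsub>U.fractions\<^esub> \<longleftrightarrow> f \<in> I" using kernel[OF f] by simp
  qed
qed

lemma finite_injective_dimension_iff:
  "finite_injective_dimension A (self_module A) \<longleftrightarrow> top_count ts = 1 \<and> det gram \<noteq> 0"
proof
  assume "finite_injective_dimension A (self_module A)"
  then have "injective_module A (self_module A)" by (rule finite_injective_dimension_imp_injective)
  then show "top_count ts = 1 \<and> det gram \<noteq> 0" using nondegenerate_of_injective by blast
next
  assume "top_count ts = 1 \<and> det gram \<noteq> 0"
  then have "injective_module A (self_module A)" using injective_of_nondegenerate by blast
  then show "finite_injective_dimension A (self_module A)" by (rule finite_injective_dimension.injective)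
qed

theorem gorenstein_iff: "gorenstein_ring A \<longleftrightarrow> top_count ts = 1 \<and> det gram \<noteq> 0"
proof -
  interpret L: graded_quotient n ts bs I "ring_of_fractions A (carrier A - \<mm>)"
    "unit_fractions.loc A (carrier A - \<mm>) \<circ> \<Phi>" by (rule localized)
  have "L.gram = gram" by (simp add: L.gram_def gram_def L.top_coeff_def top_coeff_def)
  then show ?thesis
    unfolding gorenstein_ring_def using A.is_cring noetherian L.finite_injective_dimension_iff
    by (simp add: maximalideal_iff)
qed

end

section \<open>The Hilbert function\<close>

context bordered_order_ideal
begin

lemma hilbert_fun_0: "hilbert_fun ts 0 = 1"
proof -
  have "j = 0" if "j < length ts" "ts ! j = 0" for j
    using that nth_eq_iff_index_eq[OF distinct_ts that(1), of 0] ts_0 ts_nonempty by simp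
  then have "{j. j < length ts \<and> tdeg (ts ! j) = 0} = {0}"
    using ts_0 ts_nonempty by auto
  then show ?thesis by (simp add: hilbert_fun_def)
qed

lemma top_count_eq: "top_count ts = hilbert_fun ts (tdeg (last ts))"
  by (simp add: top_count_def hilbert_fun_def)

lemma max_degree_eq: "Max {i. hilbert_fun ts i > 0} = tdeg (last ts)"
proof (rule Max_eqI)
  have le: "i \<le> tdeg (last ts)" if "hilbert_fun ts i > 0" for i
  proof -
    obtain j where "j < length ts" "tdeg (ts ! j) = i"
      using \<open>hilbert_fun ts i > 0\<close> unfolding hilbert_fun_def card_gt_0_iff by blast
    then show ?thesis using tdeg_le_last[of "ts ! j"] by auto
  qed
  then show "i \<le> tdeg (last ts)" if "i \<in> {i. hilbert_fun ts i > 0}" for i using that by simp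
  show "finite {i. hilbert_fun ts i > 0}"
  proof (rule finite_subset)
    show "{i. hilbert_fun ts i > 0} \<subseteq> {..tdeg (last ts)}"
      unfolding subset_iff mem_Collect_eq atMost_iff by (intro allI impI) (rule le)
  qed simp
  have "length ts - 1 \<in> {j. j < length ts \<and> tdeg (ts ! j) = tdeg (last ts)}"
    using ts_nonempty by (simp add: last_conv_nth)
  then have "{j. j < length ts \<and> tdeg (ts ! j) = tdeg (last ts)} \<noteq> {}" by (metis empty_iff)
  moreover have "finite {j. j < length ts \<and> tdeg (ts ! j) = tdeg (last ts)}" by simp
  ultimately show "tdeg (last ts) \<in> {i. hilbert_fun ts i > 0}"
    unfolding hilbert_fun_def mem_Collect_eq card_gt_0_iff by (rule conjI)
qed

lemma hf_symmetric_iff: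
  "hf_symmetric ts \<longleftrightarrow> (\<forall>i\<in>{1..tdeg (last ts)}. hilbert_fun ts i = hilbert_fun ts (tdeg (last ts) - i))"
  by (simp add: hf_symmetric_def Let_def max_degree_eq)

text \<open>For \<open>i = \<rho>\<close>, symmetry compares the maximal degree with degree \<open>0\<close>, which contains only the term \<open>1\<close>.\<close>

lemma top_count_of_symmetric: "hf_symmetric ts \<Longrightarrow> top_count ts = 1"
proof (cases "tdeg (last ts) = 0")
  case False
  then have "tdeg (last ts) \<in> {1..tdeg (last ts)}" by (simp del: tdeg_eq_0_iff)
  moreover assume "hf_symmetric ts"
  ultimately have "hilbert_fun ts (tdeg (last ts)) = hilbert_fun ts (tdeg (last ts) - tdeg (last ts))"
    unfolding hf_symmetric_iff by blast
  then show ?thesis by (simp add: top_count_eq hilbert_fun_0)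
qed (simp add: top_count_eq hilbert_fun_0)

end

context graded_quotient
begin

lemma gram_homogeneous:
  assumes "i < length ts" "j < length ts" "gram $$ (i, j) \<noteq> 0"
  shows "tdeg (ts ! i) + tdeg (ts ! j) = tdeg (last ts)"
proof -
  have "last ts \<in> keys (T.NF (pmonom (ts ! i + ts ! j)))"
    using assms by (simp add: gram_def top_coeff_def pmonom_mult in_keys_iff)
  moreover have "pmonom (ts ! i + ts ! j) \<in> polys n" using assms(1,2) by simp
  ultimately have "\<exists>t\<in>keys (pmonom (ts ! i + ts ! j) :: (nat, 'k) mpoly). tdeg (last ts) = tdeg t"
    using T.NF(1) by blast
  then show ?thesis by (simp add: tdeg_add)
qed

text \<open>By homogeneity of the form, a permutation with a nonzero summand in the Leibniz formula for the
determinant maps the terms of degree \<open>d\<close> to terms of degree \<open>\<rho> - d\<close>.\<close>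

lemma symmetric_of_nondegenerate:
  assumes "det gram \<noteq> 0"
  shows "hf_symmetric ts"
proof -
  have "(\<Sum>p\<in>{p. p permutes {0..<length ts}}. signof p * (\<Prod>i = 0..<length ts. gram $$ (i, p i))) \<noteq> 0"
    using assms by (simp add: det_def)
  then obtain p where "p \<in> {p. p permutes {0..<length ts}}"
    "signof p * (\<Prod>i = 0..<length ts. gram $$ (i, p i)) \<noteq> 0"
    by (rule sum.not_neutral_contains_not_neutral)
  then have p: "p permutes {0..<length ts}" "(\<Prod>i = 0..<length ts. gram $$ (i, p i)) \<noteq> 0" by auto
  have deg: "tdeg (ts ! i) + tdeg (ts ! p i) = tdeg (last ts)" "p i < length ts" if "i < length ts" for i
  proof -
    show pi: "p i < length ts" using permutes_in_image[OF p(1), of i] that by simp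
    have "gram $$ (i, p i) \<noteq> 0" using p(2) that by (simp add: prod_zero_iff)
    then show "tdeg (ts ! i) + tdeg (ts ! p i) = tdeg (last ts)" by (rule gram_homogeneous[OF that pi])
  qed
  have le: "hilbert_fun ts d \<le> hilbert_fun ts (tdeg (last ts) - d)" for d
    unfolding hilbert_fun_def
  proof (rule card_inj_on_le)
    show "inj_on p {j. j < length ts \<and> tdeg (ts ! j) = d}" using permutes_inj[OF p(1)] by (rule inj_on_subset) simp
    show "p ` {j. j < length ts \<and> tdeg (ts ! j) = d} \<subseteq> {j. j < length ts \<and> tdeg (ts ! j) = tdeg (last ts) - d}"
    proof
      fix k assume "k \<in> p ` {j. j < length ts \<and> tdeg (ts ! j) = d}"
      then obtain j where "j < length ts" "tdeg (ts ! j) = d" "k = p j" by blast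
      then show "k \<in> {j. j < length ts \<and> tdeg (ts ! j) = tdeg (last ts) - d}" using deg[of j] by simp
    qed
  qed simp
  show ?thesis
    unfolding O.hf_symmetric_iff
  proof
    fix d assume "d \<in> {1..tdeg (last ts)}"
    then show "hilbert_fun ts d = hilbert_fun ts (tdeg (last ts) - d)"
      using le[of d] le[of "tdeg (last ts) - d"] by simp
  qed
qed

end

section \<open>The determinantal ideal\<close>

text \<open>Needed because the ideals live in \<open>K[C]\<close>, a proper subring of the polynomial type.\<close>

definition closed_mat :: "'x set \<Rightarrow> nat \<Rightarrow> ('x, 'k::comm_ring_1) mpoly mat \<Rightarrow> bool" where
  "closed_mat X m M \<longleftrightarrow> M \<in> carrier_mat m m \<and> (\<forall>i<m. \<forall>j<m. M $$ (i, j) \<in> carrier (mpoly_ring X))"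

lemma closed_mat_mult:
  assumes "closed_mat X m M" "closed_mat X m N"
  shows "closed_mat X m (M * N)"
proof -
  have "(M * N) $$ (i, j) \<in> carrier (mpoly_ring X)" if "i < m" "j < m" for i j
  proof -
    have "(M * N) $$ (i, j) = (\<Sum>k<m. M $$ (i, k) * N $$ (k, j))"
      using assms that by (auto simp: closed_mat_def scalar_prod_def atLeast0LessThan)
    also have "\<dots> \<in> carrier (mpoly_ring X)"
      using assms that by (intro mpoly_sum_closed mpoly_mult_closed) (auto simp: closed_mat_def)
    finally show ?thesis .
  qed
  then show ?thesis using assms by (auto simp: closed_mat_def)
qed

lemma closed_mat_one: "closed_mat X m (1\<^sub>m m)"
  by (auto simp: closed_mat_def)

lemma closed_mat_pow:
  assumes "closed_mat X m M"
  shows "closed_mat X m (M ^\<^sub>m k)"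
proof (induction k)
  case 0
  then show ?case using assms closed_mat_one by (auto simp: closed_mat_def)
next
  case (Suc k)
  then show ?case using assms by (simp add: closed_mat_mult)
qed

lemma closed_mat_term_mat:
  assumes "\<And>r. r < n \<Longrightarrow> closed_mat X m (M r)"
  shows "closed_mat X m (term_mat n m M t)"
proof -
  have "closed_mat X m (foldr (\<lambda>r N. (M r ^\<^sub>m lookup t r) * N) rs (1\<^sub>m m))"
    if "set rs \<subseteq> {..<n}" for rs
    using that
  proof (induction rs)
    case (Cons r rs)
    then show ?case by (auto intro!: closed_mat_mult closed_mat_pow assms)
  qed (simp add: closed_mat_one)
  from this[of "[0..<n]"] show ?thesis by (simp add: term_mat_def subset_iff)
qed

lemma closed_mat_det:
  assumes "closed_mat X m M"
  shows "det M \<in> carrier (mpoly_ring X)"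
proof -
  have M: "M \<in> carrier_mat m m" using assms by (simp add: closed_mat_def)
  have entry: "M $$ (i, p i) \<in> carrier (mpoly_ring X)" if "p permutes {0..<m}" "i \<in> {0..<m}" for p i
    using assms that permutes_in_image[OF that(1), of i] by (auto simp: closed_mat_def)
  have sgn: "(signof p :: ('x, 'k::comm_ring_1) mpoly) \<in> carrier (mpoly_ring X)" for p :: "nat \<Rightarrow> nat" and X :: "'x set"
    by (simp add: sign_def)
  show ?thesis
    unfolding det_def'[OF M] by (intro mpoly_sum_closed mpoly_mult_closed mpoly_prod_closed entry sgn) auto
qed

lemma map_mat_term_mat:
  assumes h: "comm_ring_hom h" and M: "\<And>r. r < n \<Longrightarrow> M r \<in> carrier_mat m m"
  shows "map_mat h (term_mat n m M t) = term_mat n m (\<lambda>r. map_mat h (M r)) t"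
proof -
  interpret comm_ring_hom h by fact
  have "foldr (\<lambda>r N. (M r ^\<^sub>m lookup t r) * N) rs (1\<^sub>m m) \<in> carrier_mat m m \<and>
     map_mat h (foldr (\<lambda>r N. (M r ^\<^sub>m lookup t r) * N) rs (1\<^sub>m m)) =
     foldr (\<lambda>r N. (map_mat h (M r) ^\<^sub>m lookup t r) * N) rs (1\<^sub>m m)"
    if "set rs \<subseteq> {..<n}" for rs
    using that
  proof (induction rs)
    case (Cons r rs)
    then have r: "M r \<in> carrier_mat m m" using M by auto
    then show ?case
      using Cons mat_hom_mult[OF pow_carrier_mat[OF r], of _ m] mult_carrier_mat[OF pow_carrier_mat[OF r], of _ m]
      by (simp add: mat_hom_pow[OF r])
  qed (simp add: mat_hom_one)
  from this[of "[0..<n]"] show ?thesis by (simp add: term_mat_def subset_iff)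
qed

lemma submatrix_full:
  assumes "M \<in> carrier_mat m k"
  shows "submatrix M {..<m} {..<k} = M"
proof -
  have pick: "pick {..<l} i = i" if "i < l" for l i
    using pick_reduce_set[of i l UNIV] that by (simp add: pick_UNIV lessThan_def)
  have "{i. i < l \<and> i < l} = {..<l}" for l :: nat by auto
  then show ?thesis using assms pick by (intro eq_matI) (auto simp: submatrix_def)
qed

lemma maximal_minors_square:
  assumes "M \<in> carrier_mat m m"
  shows "maximal_minors M = {det M}"
proof -
  have "S \<subseteq> {..<m} \<and> card S = m \<longleftrightarrow> S = {..<m}" for S
    using card_subset_eq[of "{..<m}" S] by auto
  then have "maximal_minors M = {det (submatrix M I J) | I J. I = {..<m} \<and> J = {..<m}}"
    unfolding maximal_minors_def using assms by (metis carrier_matD min.idem)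
  then show ?thesis using submatrix_full[OF assms] by simp
qed

context bordered_order_ideal
begin

lemma hom_mult_mat_index:
  assumes "r < n" "i < length ts" "j < length ts"
  shows "tvar r + ts ! j \<in> set ts \<Longrightarrow>
      (hom_mult_mat ts bs r $$ (i, j) :: 'k::field cpoly) = (if ts ! i = tvar r + ts ! j then 1 else 0)"
    and "m < length bs \<Longrightarrow> bs ! m = tvar r + ts ! j \<Longrightarrow> tvar r + ts ! j \<notin> set ts \<Longrightarrow>
      (hom_mult_mat ts bs r $$ (i, j) :: 'k::field cpoly) =
        (if tdeg (ts ! i) \<noteq> tdeg (bs ! m) then 0 else pvar (i, m))"
  using assms by (auto simp: hom_mult_mat_def gen_mult_mat_def the_border_index)

lemma hom_mult_mat_closed:
  assumes "r < n"
  shows "closed_mat ({..<length ts} \<times> {..<length bs}) (length ts) (hom_mult_mat ts bs r :: 'k::field cpoly mat)"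
proof -
  have "(hom_mult_mat ts bs r $$ (i, j) :: 'k cpoly) \<in> carrier (mpoly_ring ({..<length ts} \<times> {..<length bs}))"
    if ij: "i < length ts" "j < length ts" for i j
  proof -
    have "ts ! j \<in> set ts" using ij by simp
    with assms show ?thesis
    proof (cases rule: step_cases)
      case 1
      then show ?thesis using hom_mult_mat_index(1)[OF assms ij, where 'k = 'k] by simp
    next
      case (2 m)
      then show ?thesis using hom_mult_mat_index(2)[OF assms ij 2, where 'k = 'k] ij by simp
    qed
  qed
  then show ?thesis by (simp add: closed_mat_def hom_mult_mat_def)
qed

definition hom_point :: "'k::field mat \<Rightarrow> 'k mat" where
  "hom_point \<Gamma> = mat (length ts) (length bs)
     (\<lambda>(i, j). if tdeg (ts ! i) \<noteq> tdeg (bs ! j) then 0 else \<Gamma> $$ (i, j))"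

lemma eval_hom_mult_mat:
  fixes \<Gamma> :: "'k::field mat"
  assumes "r < n"
  shows "map_mat (peval id (\<lambda>(i, j). \<Gamma> $$ (i, j))) (hom_mult_mat ts bs r) = point_mat ts bs (hom_point \<Gamma>) r"
proof (rule eq_matI)
  fix i j assume "i < dim_row (point_mat ts bs (hom_point \<Gamma>) r)" "j < dim_col (point_mat ts bs (hom_point \<Gamma>) r)"
  then have ij: "i < length ts" "j < length ts" by simp_all
  have dims: "(hom_mult_mat ts bs r :: 'k cpoly mat) \<in> carrier_mat (length ts) (length ts)"
    by (simp add: hom_mult_mat_def)
  have "ts ! j \<in> set ts" using ij by simp
  with assms show "map_mat (peval id (\<lambda>(i, j). \<Gamma> $$ (i, j))) (hom_mult_mat ts bs r) $$ (i, j)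
      = point_mat ts bs (hom_point \<Gamma>) r $$ (i, j)"
  proof (cases rule: step_cases)
    case 1
    then show ?thesis using hom_mult_mat_index(1)[OF assms ij, where 'k = 'k] ij dims by (simp add: point_mat_def)
  next
    case (2 m)
    then show ?thesis
      using hom_mult_mat_index(2)[OF assms ij 2, where 'k = 'k] point_mat_col_border[OF 2(1) ij(2) _ _ ij(1), of r "hom_point \<Gamma>"] ij dims
      by (simp add: hom_point_def)
  qed
qed (simp_all add: hom_mult_mat_def)

lemma M_hom_closed:
  "closed_mat ({..<length ts} \<times> {..<length bs}) (length ts) (M_hom n ts bs t :: 'k::field cpoly mat)"
  unfolding M_hom_def by (rule closed_mat_term_mat) (rule hom_mult_mat_closed)

text \<open>For \<open>\<Delta> = 1\<close> the column taken from the transpose is the last one, whose index is \<open>length ts - 1\<close>.\<close>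

lemma V_mat_index:
  assumes "i < length ts" "j < length ts" "top_count ts = 1"
  shows "(V_mat n ts bs 0 :: 'k::field cpoly mat) $$ (i, j) = M_hom n ts bs (ts ! j) $$ (length ts - 1, i)"
proof -
  have "(M_hom n ts bs (ts ! j) :: 'k cpoly mat) \<in> carrier_mat (length ts) (length ts)"
    using M_hom_closed[of "ts ! j", where 'k = 'k] by (simp add: closed_mat_def)
  moreover have "length ts - 1 < length ts" using ts_nonempty by simp
  ultimately show ?thesis
    using assms by (auto simp: V_mat_def mat_of_cols_index)
qed

lemma V_mat_closed:
  assumes "top_count ts = 1"
  shows "closed_mat ({..<length ts} \<times> {..<length bs}) (length ts) (V_mat n ts bs 0 :: 'k::field cpoly mat)"
proof -
  have "length ts - 1 < length ts" using ts_nonempty by simp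
  then show ?thesis
    using M_hom_closed[where 'k = 'k] V_mat_index[OF _ _ assms, where 'k = 'k]
    unfolding closed_mat_def by (auto simp: V_mat_def)
qed

lemma V_col_eq:
  assumes "top_count ts = 1"
  shows "(V_col n ts bs :: 'k::field cpoly mat) = V_mat n ts bs 0"
proof -
  have C: "(V_mat n ts bs 0 :: 'k cpoly mat) \<in> carrier_mat (length ts) (length ts)"
    using V_mat_closed[OF assms, where 'k = 'k] by (simp add: closed_mat_def)
  have "(V_col n ts bs :: 'k cpoly mat) = V_mat n ts bs 0 @\<^sub>r 0\<^sub>m 0 (length ts)"
    using assms by (simp add: V_col_def)
  also have "\<dots> = V_mat n ts bs 0"
    using C by (intro eq_matI) (auto simp: append_rows_def)
  finally show ?thesis .
qed

lemma maximal_minors_V_col: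
  assumes "top_count ts = 1"
  shows "maximal_minors (V_col n ts bs :: 'k::field cpoly mat) = {det (V_mat n ts bs 0)}"
  using V_mat_closed[OF assms] maximal_minors_square
  unfolding V_col_eq[OF assms] closed_mat_def by blast

lemma J_minors_ideal:
  assumes "top_count ts = 1"
  shows "ideal (J_minors n ts bs :: 'k::field cpoly set) (KC ts bs)"
  unfolding J_minors_def maximal_minors_V_col[OF assms] KC_def
  by (rule ring.genideal_ideal[OF mpoly_ring_ring]) (use closed_mat_det[OF V_mat_closed[OF assms]] in simp)

lemma I_NonSGor_ideal: "ideal (I_NonSGor n ts bs :: 'k::field cpoly set) (KC ts bs)"
proof -
  have R: "ring (KC ts bs :: 'k cpoly ring)" by (simp add: KC_def mpoly_ring_ring)
  show ?thesis
  proof (cases "hf_symmetric ts")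
    case True
    have "ideal (I_BBdf n ts bs <+>\<^bsub>KC ts bs\<^esub> J_minors n ts bs :: 'k cpoly set) (KC ts bs)"
      by (rule ring.add_ideals[OF R I_BBdf_ideal J_minors_ideal[OF top_count_of_symmetric[OF True]]])
    then show ?thesis using True by (simp add: I_NonSGor_def)
  next
    case False
    have "ideal (I_BBdf n ts bs :: 'k cpoly set) (KC ts bs)" by (rule I_BBdf_ideal)
    then show ?thesis using False by (simp add: I_NonSGor_def)
  qed
qed

lemma I_BBdf_subset: "(I_BBdf n ts bs :: 'k::field cpoly set) \<subseteq> I_NonSGor n ts bs"
proof (cases "hf_symmetric ts")
  case True
  have J: "ideal (J_minors n ts bs :: 'k cpoly set) (mpoly_ring ({..<length ts} \<times> {..<length bs}))"
    using J_minors_ideal[OF top_count_of_symmetric[OF True]] by (simp add: KC_def)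
  show ?thesis
  proof
    fix p :: "'k cpoly" assume "p \<in> I_BBdf n ts bs"
    moreover have "p = p + 0" "0 \<in> (J_minors n ts bs :: 'k cpoly set)" using mpoly_ideal_closed(2)[OF J] by simp_all
    ultimately have "p \<in> I_BBdf n ts bs <+>\<^bsub>KC ts bs\<^esub> J_minors n ts bs"
      unfolding set_add_def' KC_def mpoly_ring_simps by blast
    then show "p \<in> I_NonSGor n ts bs" using True by (simp add: I_NonSGor_def)
  qed
qed (simp add: I_NonSGor_def)

lemma rational_points_I_NonSGor:
  fixes \<Gamma> :: "'k::field mat"
  shows "\<Gamma> \<in> rational_points ts bs (I_NonSGor n ts bs) \<longleftrightarrow> \<Gamma> \<in> rational_points ts bs (I_BBdf n ts bs) \<and>
    (hf_symmetric ts \<longrightarrow> peval id (\<lambda>(i, j). \<Gamma> $$ (i, j)) (det (V_mat n ts bs 0)) = 0)"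
proof (cases "hf_symmetric ts")
  case True
  note top = top_count_of_symmetric[OF True]
  let ?e = "peval id (\<lambda>(i, j). \<Gamma> $$ (i, j)) :: 'k cpoly \<Rightarrow> 'k"
  have "I_NonSGor n ts bs = I_BBdf n ts bs <+>\<^bsub>KC ts bs\<^esub> (J_minors n ts bs :: 'k cpoly set)"
    using True by (simp add: I_NonSGor_def)
  then have "(\<forall>p\<in>I_NonSGor n ts bs. ?e p = 0) \<longleftrightarrow> (\<forall>p\<in>I_BBdf n ts bs. ?e p = 0) \<and> (\<forall>p\<in>J_minors n ts bs. ?e p = 0)"
    using peval_vanishes_sum_ideal[OF I_BBdf_ideal[unfolded KC_def] J_minors_ideal[OF top, unfolded KC_def]]
    by (simp only: KC_def)
  also have "(\<forall>p\<in>J_minors n ts bs. ?e p = 0) \<longleftrightarrow> (\<forall>p\<in>{det (V_mat n ts bs 0)}. ?e p = 0)"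
    unfolding J_minors_def maximal_minors_V_col[OF top] KC_def
    by (rule peval_vanishes_genideal) (use closed_mat_det[OF V_mat_closed[OF top]] in simp)
  finally show ?thesis using True unfolding rational_points_def by blast
qed (simp add: I_NonSGor_def)

section \<open>Strict Gorenstein schemes with a degree filtered border basis\<close>

lemma gr_graded_quotient:
  fixes I :: "(nat, 'k::field) mpoly set"
  assumes "term_basis n (set ts) I (\<le>)"
  shows "graded_quotient n ts bs (leading_forms n I) (gr_ring n I) (gr_map n I)"
proof -
  interpret F: aff_ideal n I using term_basis.ideal[OF assms] by (rule aff_ideal.intro)
  show ?thesis
  proof (intro graded_quotient.intro graded_quotient_axioms.intro)
    show "bordered_order_ideal n ts bs" by (rule bordered_order_ideal_axioms)
    show "term_basis n (set ts) (leading_forms n I) (=)" using assms by (rule term_basis_leading_forms)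
    show "cring (gr_ring n I)" by (rule F.gr_cring)
    show "gr_map n I \<in> Ring.ring_hom (aff_ring n) (gr_ring n I)" by (rule F.gr_map_hom)
    show "gr_map n I ` polys n = carrier (gr_ring n I)" by (rule F.gr_map_surj)
  qed (rule F.gr_map_kernel)
qed

text \<open>No term in the border polynomial of \<open>b\<^sub>j\<close> has a larger degree than \<open>b\<^sub>j\<close>, so its leading form is the border
polynomial of \<open>hom_point \<Gamma>\<close>, whose matrices therefore describe multiplication in the graded ring.
The last row of the matrix of
\<open>t\<^sub>j\<close> consists of the coefficients of \<open>t\<^sub>\<mu>\<close> in the products \<open>t\<^sub>j t\<^sub>i\<close>.\<close>

lemma gram_eq_eval_V_mat:
  fixes \<Gamma> :: "'k::field mat"
  assumes \<Gamma>: "\<Gamma> \<in> rational_points ts bs (I_BBdf n ts bs)" and top: "top_count ts = 1"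
  shows "graded_quotient.gram ts (leading_forms n (I_point n ts bs \<Gamma>)) =
    map_mat (peval id (\<lambda>(i, j). \<Gamma> $$ (i, j))) (V_mat n ts bs 0)"
proof -
  let ?I = "I_point n ts bs \<Gamma>" and ?e = "peval id (\<lambda>(i, j). \<Gamma> $$ (i, j))"
  have tb: "term_basis n (set ts) ?I (\<le>)" using \<Gamma> by (rule I_point_term_basis)
  interpret G: graded_quotient n ts bs "leading_forms n ?I" "gr_ring n ?I" "gr_map n ?I"
    using tb by (rule gr_graded_quotient)
  have gens: "pmonom (bs ! j) - lin_comb ts (\<lambda>i. hom_point \<Gamma> $$ (i, j)) \<in> leading_forms n ?I"
    if j: "j < length bs" for j
  proof -
    have "hcomp (tdeg (bs ! j)) (lin_comb ts (\<lambda>i. \<Gamma> $$ (i, j))) = lin_comb ts (\<lambda>i. hom_point \<Gamma> $$ (i, j))"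
    proof (rule poly_mapping_eqI)
      fix t
      show "lookup (hcomp (tdeg (bs ! j)) (lin_comb ts (\<lambda>i. \<Gamma> $$ (i, j)))) t =
          lookup (lin_comb ts (\<lambda>i. hom_point \<Gamma> $$ (i, j))) t"
      proof (cases "t \<in> set ts")
        case True
        then obtain i where "i < length ts" "t = ts ! i" by (metis in_set_conv_nth)
        then show ?thesis using j by (simp add: lookup_hcomp lookup_lin_comb distinct_ts hom_point_def)
      next
        case False
        then have "lookup (lin_comb ts c) t = 0" for c :: "nat \<Rightarrow> 'k"
          using keys_lin_comb[of ts c] by (auto simp: in_keys_iff)
        then show ?thesis by (simp add: lookup_hcomp)
      qed
    qed
    then show ?thesis
      using leading_form_of_reduction[OF tb bs_nth_terms[OF j]]
        border_normal_form[OF tb j border_poly_in_I_point[OF j]] by simp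
  qed
  interpret M: mult_matrices n ts "leading_forms n ?I" "(=)" "point_mat ts bs (hom_point \<Gamma>)"
    using G.T.term_basis_axioms gens by (rule mult_matrices_point)
  have last: "length ts - 1 < length ts" "last ts = ts ! (length ts - 1)"
    using ts_nonempty by (simp_all add: last_conv_nth)
  have "G.gram $$ (i, j) = map_mat ?e (V_mat n ts bs 0) $$ (i, j)" if ij: "i < length ts" "j < length ts" for i j
  proof -
    let ?T = "term_mat n (length ts) (point_mat ts bs (hom_point \<Gamma>)) (ts ! j)"
    have T: "?T \<in> carrier_mat (length ts) (length ts)" by (rule term_mat_carrier) simp
    have Mh: "(M_hom n ts bs (ts ! j) :: 'k cpoly mat) \<in> carrier_mat (length ts) (length ts)"
      using M_hom_closed[of "ts ! j", where 'k = 'k] by (simp add: closed_mat_def)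
    have hm: "(hom_mult_mat ts bs r :: 'k cpoly mat) \<in> carrier_mat (length ts) (length ts)" for r
      by (simp add: hom_mult_mat_def)
    have "map_mat ?e (M_hom n ts bs (ts ! j)) = term_mat n (length ts) (\<lambda>r. map_mat ?e (hom_mult_mat ts bs r)) (ts ! j)"
      unfolding M_hom_def by (rule map_mat_term_mat[OF peval_hom hm])
    also have "\<dots> = ?T"
      unfolding term_mat_def by (intro foldr_cong refl) (simp only: eval_hom_mult_mat set_upt atLeastLessThan_iff)
    finally have eval_M: "map_mat ?e (M_hom n ts bs (ts ! j)) = ?T" .
    have "G.gram $$ (i, j) = G.top_coeff (pmonom (ts ! j) * pmonom (ts ! i))"
      using ij by (simp add: G.gram_def mult.commute)
    also have "\<dots> = M.coords (pmonom (ts ! j) * pmonom (ts ! i)) $ (length ts - 1)"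
      using last by (simp add: G.top_coeff_def M.coords_def)
    also have "M.coords (pmonom (ts ! j) * pmonom (ts ! i)) = ?T *\<^sub>v unit_vec (length ts) i"
      using ij by (simp add: M.coords_mult_pmonom M.coords_pmonom)
    also have "\<dots> = col ?T i" using T ij(1) by (rule mult_unit_vec)
    also have "col ?T i $ (length ts - 1) = ?T $$ (length ts - 1, i)" using T ij(1) last(1) by simp
    also have "\<dots> = ?e (M_hom n ts bs (ts ! j) $$ (length ts - 1, i))"
      unfolding eval_M[symmetric] using Mh ij(1) last(1) by simp
    also have "\<dots> = map_mat ?e (V_mat n ts bs 0) $$ (i, j)"
    proof -
      have "dim_row (V_mat n ts bs 0 :: 'k cpoly mat) = length ts" "dim_col (V_mat n ts bs 0 :: 'k cpoly mat) = length ts"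
        using V_mat_closed[OF top, where 'k = 'k] by (auto simp: closed_mat_def)
      then show ?thesis using V_mat_index[OF ij top, where 'k = 'k] ij by simp
    qed
    finally show ?thesis .
  qed
  then show ?thesis
    using V_mat_closed[OF top, where 'k = 'k] by (intro eq_matI) (auto simp: closed_mat_def)
qed

text \<open>A nonzero determinant forces symmetry, and symmetry forces \<open>\<Delta> = 1\<close>; so the condition on \<open>\<Delta>\<close> in
\<open>gorenstein_iff\<close> can be replaced by symmetry.\<close>

theorem strict_gorenstein_iff:
  fixes \<Gamma> :: "'k::field mat"
  assumes \<Gamma>: "\<Gamma> \<in> rational_points ts bs (I_BBdf n ts bs)"
  shows "strict_gorenstein n (I_point n ts bs \<Gamma>) \<longleftrightarrow>
    hf_symmetric ts \<and> peval id (\<lambda>(i, j). \<Gamma> $$ (i, j)) (det (V_mat n ts bs 0)) \<noteq> 0"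
proof -
  let ?I = "I_point n ts bs \<Gamma>" and ?e = "peval id (\<lambda>(i, j). \<Gamma> $$ (i, j)) :: 'k cpoly \<Rightarrow> 'k"
  have tb: "term_basis n (set ts) ?I (\<le>)" using \<Gamma> by (rule I_point_term_basis)
  interpret G: graded_quotient n ts bs "leading_forms n ?I" "gr_ring n ?I" "gr_map n ?I"
    using tb by (rule gr_graded_quotient)
  have det: "det G.gram = ?e (det (V_mat n ts bs 0))" if "top_count ts = 1"
    unfolding gram_eq_eval_V_mat[OF \<Gamma> that] by (rule comm_ring_hom.hom_det[OF peval_hom])
  have "strict_gorenstein n ?I \<longleftrightarrow> top_count ts = 1 \<and> det G.gram \<noteq> 0"
    unfolding strict_gorenstein_def by (rule G.gorenstein_iff)
  also have "\<dots> \<longleftrightarrow> hf_symmetric ts \<and> det G.gram \<noteq> 0"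
    using G.symmetric_of_nondegenerate top_count_of_symmetric by blast
  also have "\<dots> \<longleftrightarrow> hf_symmetric ts \<and> ?e (det (V_mat n ts bs 0)) \<noteq> 0"
    using det top_count_of_symmetric by auto
  finally show ?thesis .
qed

end

theorem corollary7p13:
  fixes n :: nat and ts bs :: "nat pterm list"
  assumes "order_ideal_enum n ts bs"
  shows "ideal (I_NonSGor n ts bs :: 'k::field cpoly set) (KC ts bs) \<and>
    (I_BBdf n ts bs :: 'k cpoly set) \<subseteq> I_NonSGor n ts bs \<and>
    bij_betw (I_point n ts bs)
      (rational_points ts bs (I_NonSGor n ts bs :: 'k cpoly set))
      {I :: (nat, 'k) mpoly set.
         zero_dimensional n I \<and> has_df_border_basis n ts I \<and> \<not> strict_gorenstein n I}"
proof -
  interpret bordered_order_ideal n ts bs using assms by (rule bordered_order_ideal.intro)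
  let ?N = "rational_points ts bs (I_NonSGor n ts bs :: 'k cpoly set)"
  let ?D = "rational_points ts bs (I_BBdf n ts bs :: 'k cpoly set)"
  have N_iff: "\<Gamma> \<in> ?N \<longleftrightarrow> \<Gamma> \<in> ?D \<and> \<not> strict_gorenstein n (I_point n ts bs \<Gamma>)" for \<Gamma>
    using rational_points_I_NonSGor[of \<Gamma>] strict_gorenstein_iff[of \<Gamma>] by blast
  have tb: "term_basis n (set ts) I (\<le>) \<longleftrightarrow> zero_dimensional n I \<and> has_df_border_basis n ts I"
    for I :: "(nat, 'k) mpoly set"
    using has_df_border_basis_iff[OF _ ts_terms distinct_ts, of I] term_basis.ideal[of n "set ts" I "(\<le>)"]
      term_basis.zero_dimensional[OF _ zero_in_ts, of n I "(\<le>)"] unfolding zero_dimensional_def by blast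
  have "inj_on (I_point n ts bs) ?N"
    using I_point_inj by (rule inj_on_subset) (use N_iff in blast)
  moreover have "I_point n ts bs ` ?N = {I :: (nat, 'k) mpoly set.
         zero_dimensional n I \<and> has_df_border_basis n ts I \<and> \<not> strict_gorenstein n I}"
  proof (intro Set.equalityI Set.subsetI)
    fix I :: "(nat, 'k) mpoly set" assume "I \<in> I_point n ts bs ` ?N"
    then obtain \<Gamma> where "\<Gamma> \<in> ?N" "I = I_point n ts bs \<Gamma>" by blast
    then show "I \<in> {I. zero_dimensional n I \<and> has_df_border_basis n ts I \<and> \<not> strict_gorenstein n I}"
      using N_iff[of \<Gamma>] tb[of I] I_point_term_basis[of \<Gamma>] by simp
  next
    fix I :: "(nat, 'k) mpoly set"
    assume I: "I \<in> {I. zero_dimensional n I \<and> has_df_border_basis n ts I \<and> \<not> strict_gorenstein n I}"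
    then obtain \<Gamma> where "\<Gamma> \<in> ?D" "I_point n ts bs \<Gamma> = I" using I_point_surj[of I] tb[of I] by blast
    then show "I \<in> I_point n ts bs ` ?N" using I N_iff[of \<Gamma>] by blast
  qed
  ultimately show ?thesis using I_NonSGor_ideal I_BBdf_subset by (simp add: bij_betw_def)
qed

end
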